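(* For every integer $m>0$ one has $\rho_m(\Delta_T)=\mathcal H$ in $H^0(X,\mathcal D_X^{(m)})$.
   Context: Let $p>2$ be a prime, $k=\mathbb F_p$, $G=SL_2$ over $k$, $\mathcal G$ its Lie algebra with standard basis $(E,F,H)$, and $X=\mathbb P^1_k$ the flag variety of $G$, covered by the two standard affine lines $\mathrm{Spec}\,k[t]$ and $\mathrm{Spec}\,k[t']$, $t'=1/t$. Distributions. $\mathrm{Dist}(G)=U(\mathcal G)$ is the algebra of distributions of $G$, identified with the reduction mod $p$ of the Kostant $\mathbb Z$-form of the enveloping algebra of $sl_2$, with $k$-basis $E^{[a]}\binom{H}{b}F^{[c]}$, where $E^{[n]}=E^n/n!$, $F^{[n]}=F^n/n!$, $\binom{H}{n}=H(H-1)\cdots(H-n+1)/n!$. $\mathrm{Dist}(G)_n$ is the subspace of distributions of order $\le n$ (spanned by the basis elements with $a+b+c\le n$), and $\epsilon_G$ is the unit of $\mathrm{Dist}(G)$. For $m\ge0$, $U^{(m)}(\mathcal G)$ is the quotient of the tensor algebra $\mathbb T_k(\mathrm{Dist}(G)_{2p^m-1})$ by the two-sided ideal generated by $\lambda-\lambda\epsilon_G$ ($\lambda\in k$), $\mu\otimes\mu'-\mu'\otimes\mu-[\mu,\mu']$ and $\mu''\otimes\mu-\mu''\mu$ for $\mu,\mu'\in\mathrm{Dist}(G)_{p^m}$, $\mu''\in\mathrm{Dist}(G)_{p^m-1}$. The element $\Delta_T:=\sum_{i=0}^{p-1}(-1)^i\binom{H}{i}$, of order $\le p-1$, is viewed in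 $U^{(m)}(\mathcal G)$. Differential operators. $\mathcal D_X=\bigcup_n\mathcal D_X^n$ is the sheaf of all (Grothendieck) differential operators on $X$ over $k$, filtered by order. $\mathcal D_X^{(m)}$ (Berthelot's differential operators of level $m$) is the sheaf of rings quotient of $\mathbb T_k(\mathcal D_X^{2p^m-1})$ by the two-sided ideal generated by $\lambda-\lambda 1_{O_X}$ ($\lambda\in k$), $D\otimes D'-D'\otimes D-[D,D']$, $D\otimes D''-DD''$ for $D,D'\in\mathcal D_X^{p^m}$, $D''\in\mathcal D_X^{p^m-1}$. Maps. The action of $G$ on $X$ defines the canonical algebra morphism $\rho:U(\mathcal G)\to H^0(X,\mathcal D_X)$, normalized by $E^{[n]}\mapsto\partial_t^{[n]}$, $F^{[n]}\mapsto\partial_{t'}^{[n]}$ (so $H\mapsto 2t'\partial_{t'}=-2t\partial_t$), where $\partial^{[n]}=\partial^n/n!$ are the divided-power derivations. It respects orders and so induces algebra morphisms $\rho_m:U^{(m)}(\mathcal G)\to H^0(X,\mathcal D_X^{(m)})$. The Dwork operator $\mathcal H\in H^0(X,\mathcal D_X^{(m)})$ ($m>0$) is the differential operator of order $p-1$ given on each standard chart, with $\tau=t$ or $\tau=t'$, by $\mathcal H=\sum_{r=0}^{p-1}(-\tau)^r\partial_\tau^{[r]}$ (the two expressions agree on the overlap). *)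

theory Defs
  imports
    "HOL-Analysis.Determinants"
    "HOL-Library.Poly_Mapping"
    "HOL-Computational_Algebra.Fraction_Field"
    "Berlekamp_Zassenhaus.Finite_Field"
    "HOL-Algebra.Module"
    "HOL-Algebra.QuotRing"
    "HOL-Algebra.Generated_Rings"
begin

section \<open>Rings\<close>

definition type_ring :: "'a::ring_1 ring" where
  "type_ring = \<lparr>carrier = UNIV, mult = (*), one = 1, zero = 0, add = (+)\<rparr>"

text \<open>\<open>ring_pres R S\<close> is the quotient of R by the two-sided ideal generated by S, and
  \<open>ring_pres_class R S\<close> is the projection.\<close>

definition ring_pres :: "('a, 'b) ring_scheme \<Rightarrow> 'a set \<Rightarrow> 'a set ring" where
  "ring_pres R S = R Quot (Idl\<^bsub>R\<^esub> S)"

definition ring_pres_class :: "('a, 'b) ring_scheme \<Rightarrow> 'a set \<Rightarrow> 'a \<Rightarrow> 'a set" where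
  "ring_pres_class R S x = (Idl\<^bsub>R\<^esub> S) +>\<^bsub>R\<^esub> x"


section \<open>Tensor algebras\<close>

text \<open>Words form the free monoid, so that finitely supported functions on words, with the
  convolution product, form the free associative algebra.\<close>

datatype 'v word_monoid = Letters (letters: "'v list")

instantiation word_monoid :: (type) monoid_add
begin

definition zero_word_monoid :: "'a word_monoid" where
  "0 = Letters []"

definition plus_word_monoid :: "'a word_monoid \<Rightarrow> 'a word_monoid \<Rightarrow> 'a word_monoid" where
  "u + w = Letters (letters u @ letters w)"

instance
  by standard (auto simp: zero_word_monoid_def plus_word_monoid_def)

end

type_synonym ('v, 'k) free_alg = "'v word_monoid \<Rightarrow>\<^sub>0 'k"

definition free_letter :: "'v \<Rightarrow> ('v, 'k::comm_ring_1) free_alg" where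
  "free_letter v = Poly_Mapping.single (Letters [v]) 1"

definition free_scalar :: "'k \<Rightarrow> ('v, 'k::comm_ring_1) free_alg" where
  "free_scalar c = Poly_Mapping.single 0 c"

definition free_algebra :: "'v set \<Rightarrow> ('v, 'k::comm_ring_1) free_alg ring" where
  "free_algebra V = type_ring
     \<lparr>carrier := {f. \<forall>w \<in> Poly_Mapping.keys f. set (letters w) \<subseteq> V}\<rparr>"

text \<open>The tensor algebra of a k-module M (k being a whole type), as the free algebra on the
  underlying set of M modulo the relations saying that M embeds k-linearly. Only the additive
  structure, the scalar multiplication and the carrier of M are used.\<close>

definition linearity_rels :: "('k::comm_ring_1, 'v) module \<Rightarrow> ('v, 'k) free_alg set" where
  "linearity_rels M =
     {free_letter (v \<oplus>\<^bsub>M\<^esub> w) - free_letter v - free_letter w | v w.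
        v \<in> carrier M \<and> w \<in> carrier M} \<union>
     {free_letter (c \<odot>\<^bsub>M\<^esub> v) - free_scalar c * free_letter v | c v. v \<in> carrier M}"

definition tensor_algebra :: "('k::comm_ring_1, 'v) module \<Rightarrow> ('v, 'k) free_alg set ring" where
  "tensor_algebra M = ring_pres (free_algebra (carrier M)) (linearity_rels M)"

definition tensor_class ::
    "('k::comm_ring_1, 'v) module \<Rightarrow> ('v, 'k) free_alg \<Rightarrow> ('v, 'k) free_alg set" where
  "tensor_class M = ring_pres_class (free_algebra (carrier M)) (linearity_rels M)"

definition tensor_gen :: "('k::comm_ring_1, 'v) module \<Rightarrow> 'v \<Rightarrow> ('v, 'k) free_alg set" where
  "tensor_gen M v = tensor_class M (free_letter v)"

definition tensor_scalar :: "('k::comm_ring_1, 'v) module \<Rightarrow> 'k \<Rightarrow> ('v, 'k) free_alg set" where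
  "tensor_scalar M c = tensor_class M (free_scalar c)"


section \<open>The enveloping algebra of sl2 over the rationals and its Kostant form\<close>

type_synonym mat2 = "rat ^ 2 ^ 2"

definition sl2 :: "(rat, mat2) module" where
  "sl2 = \<lparr>carrier = {A. trace A = 0}, mult = (**), one = mat 1, zero = 0, add = (+),
          module.smult = (\<lambda>c A. \<chi> i j. c * A $ i $ j)\<rparr>"

definition sl2_E :: mat2 where "sl2_E = vector [vector [0, 1], vector [0, 0]]"
definition sl2_F :: mat2 where "sl2_F = vector [vector [0, 0], vector [1, 0]]"
definition sl2_H :: mat2 where "sl2_H = vector [vector [1, 0], vector [0, -1]]"

type_synonym uea = "(mat2, rat) free_alg set set"

definition uea_rels :: "(mat2, rat) free_alg set set" where
  "uea_rels = (let T = tensor_algebra sl2; \<iota> = tensor_gen sl2 in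
     {\<iota> x \<otimes>\<^bsub>T\<^esub> \<iota> y \<ominus>\<^bsub>T\<^esub> \<iota> y \<otimes>\<^bsub>T\<^esub> \<iota> x \<ominus>\<^bsub>T\<^esub> \<iota> (x ** y - y ** x) | x y.
        x \<in> carrier sl2 \<and> y \<in> carrier sl2})"

definition uea_ring :: "uea ring" where
  "uea_ring = ring_pres (tensor_algebra sl2) uea_rels"

definition uea_gen :: "mat2 \<Rightarrow> uea" where
  "uea_gen x = ring_pres_class (tensor_algebra sl2) uea_rels (tensor_gen sl2 x)"

definition uea_scalar :: "rat \<Rightarrow> uea" where
  "uea_scalar c = ring_pres_class (tensor_algebra sl2) uea_rels (tensor_scalar sl2 c)"

definition uea_divpow :: "mat2 \<Rightarrow> nat \<Rightarrow> uea" where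
  "uea_divpow x n = uea_scalar (1 / fact n) \<otimes>\<^bsub>uea_ring\<^esub> (uea_gen x [^]\<^bsub>uea_ring\<^esub> n)"

primrec uea_falling :: "mat2 \<Rightarrow> nat \<Rightarrow> uea" where
  "uea_falling x 0 = \<one>\<^bsub>uea_ring\<^esub>"
| "uea_falling x (Suc n) =
     uea_falling x n \<otimes>\<^bsub>uea_ring\<^esub> (uea_gen x \<ominus>\<^bsub>uea_ring\<^esub> uea_scalar (of_nat n))"

definition uea_binom :: "mat2 \<Rightarrow> nat \<Rightarrow> uea" where
  "uea_binom x n = uea_scalar (1 / fact n) \<otimes>\<^bsub>uea_ring\<^esub> uea_falling x n"

definition kostant_ring :: "uea ring" where
  "kostant_ring = uea_ring
     \<lparr>carrier := generate_ring uea_ring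
        (range (uea_divpow sl2_E) \<union> range (uea_binom sl2_H) \<union> range (uea_divpow sl2_F))\<rparr>"


section \<open>Distributions on SL2 over the prime field\<close>

text \<open>The field with p elements is the type of integers modulo \<open>CARD('p)\<close>, for 'p of class
  \<open>prime_card\<close>. Constants whose type does not mention 'p take p or 'p as an argument.\<close>

type_synonym dist = "uea set"

definition dist_ring :: "nat \<Rightarrow> dist ring" where
  "dist_ring p = ring_pres kostant_ring {[p] \<cdot>\<^bsub>kostant_ring\<^esub> \<one>\<^bsub>kostant_ring\<^esub>}"

definition dist_class :: "nat \<Rightarrow> uea \<Rightarrow> dist" where
  "dist_class p = ring_pres_class kostant_ring {[p] \<cdot>\<^bsub>kostant_ring\<^esub> \<one>\<^bsub>kostant_ring\<^esub>}"

definition dist_algebra :: "('p::prime_card mod_ring, dist) module" where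
  "dist_algebra = (let D = dist_ring CARD('p) in
     \<lparr>carrier = carrier D, mult = mult D, one = one D, zero = zero D, add = add D,
      module.smult = (\<lambda>c \<mu>. [to_int_mod_ring c] \<cdot>\<^bsub>D\<^esub> \<mu>)\<rparr>)"

definition dist_basis :: "nat \<Rightarrow> nat \<Rightarrow> nat \<Rightarrow> nat \<Rightarrow> dist" where
  "dist_basis p a b c = dist_class p
     (uea_divpow sl2_E a \<otimes>\<^bsub>kostant_ring\<^esub> uea_binom sl2_H b \<otimes>\<^bsub>kostant_ring\<^esub> uea_divpow sl2_F c)"

text \<open>Distributions of order at most n: the linear span of the basis elements of total
  degree at most n.\<close>

definition dist_order :: "'p::prime_card itself \<Rightarrow> nat \<Rightarrow> dist set" where
  "dist_order _ n = \<Inter>{N. submodule N (type_ring :: 'p mod_ring ring) dist_algebra \<and>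
       {dist_basis CARD('p) a b c | a b c. a + b + c \<le> n} \<subseteq> N}"


section \<open>Level m algebras attached to a filtered algebra\<close>

text \<open>A is a k-algebra with filtration F, and q stands for the m-th power of p.\<close>

definition level_module ::
    "('k::comm_ring_1, 'v) module \<Rightarrow> (nat \<Rightarrow> 'v set) \<Rightarrow> nat \<Rightarrow> ('k, 'v) module" where
  "level_module A F q = A\<lparr>carrier := F (2 * q - 1)\<rparr>"

definition level_rels ::
    "('k::comm_ring_1, 'v) module \<Rightarrow> (nat \<Rightarrow> 'v set) \<Rightarrow> nat \<Rightarrow> ('v, 'k) free_alg set set" where
  "level_rels A F q = (let M = level_module A F q; T = tensor_algebra M; \<iota> = tensor_gen M in
     {tensor_scalar M c \<ominus>\<^bsub>T\<^esub> \<iota> (c \<odot>\<^bsub>A\<^esub> \<one>\<^bsub>A\<^esub>) | c. True} \<union>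
     {\<iota> x \<otimes>\<^bsub>T\<^esub> \<iota> y \<ominus>\<^bsub>T\<^esub> \<iota> y \<otimes>\<^bsub>T\<^esub> \<iota> x \<ominus>\<^bsub>T\<^esub> \<iota> (x \<otimes>\<^bsub>A\<^esub> y \<ominus>\<^bsub>A\<^esub> y \<otimes>\<^bsub>A\<^esub> x) | x y.
        x \<in> F q \<and> y \<in> F q})"

definition level_rels_left ::
    "('k::comm_ring_1, 'v) module \<Rightarrow> (nat \<Rightarrow> 'v set) \<Rightarrow> nat \<Rightarrow> ('v, 'k) free_alg set set" where
  "level_rels_left A F q = (let M = level_module A F q; T = tensor_algebra M; \<iota> = tensor_gen M in
     {\<iota> z \<otimes>\<^bsub>T\<^esub> \<iota> x \<ominus>\<^bsub>T\<^esub> \<iota> (z \<otimes>\<^bsub>A\<^esub> x) | x z. x \<in> F q \<and> z \<in> F (q - 1)})"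

definition level_rels_right ::
    "('k::comm_ring_1, 'v) module \<Rightarrow> (nat \<Rightarrow> 'v set) \<Rightarrow> nat \<Rightarrow> ('v, 'k) free_alg set set" where
  "level_rels_right A F q = (let M = level_module A F q; T = tensor_algebra M; \<iota> = tensor_gen M in
     {\<iota> x \<otimes>\<^bsub>T\<^esub> \<iota> z \<ominus>\<^bsub>T\<^esub> \<iota> (x \<otimes>\<^bsub>A\<^esub> z) | x z. x \<in> F q \<and> z \<in> F (q - 1)})"


section \<open>The level m algebra of distributions\<close>

definition ulevel_module ::
    "'p::prime_card itself \<Rightarrow> nat \<Rightarrow> ('p mod_ring, dist) module" where
  "ulevel_module P m = level_module dist_algebra (dist_order P) (CARD('p) ^ m)"

definition ulevel_rels ::
    "'p::prime_card itself \<Rightarrow> nat \<Rightarrow> (dist, 'p mod_ring) free_alg set set" where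
  "ulevel_rels P m =
     level_rels dist_algebra (dist_order P) (CARD('p) ^ m) \<union>
     level_rels_left dist_algebra (dist_order P) (CARD('p) ^ m)"

type_synonym 'p ulevel = "(dist, 'p mod_ring) free_alg set set"

definition ulevel_ring :: "nat \<Rightarrow> 'p::prime_card ulevel ring" where
  "ulevel_ring m = ring_pres (tensor_algebra (ulevel_module TYPE('p) m)) (ulevel_rels TYPE('p) m)"

definition to_ulevel :: "nat \<Rightarrow> dist \<Rightarrow> 'p::prime_card ulevel" where
  "to_ulevel m \<mu> = ring_pres_class (tensor_algebra (ulevel_module TYPE('p) m))
     (ulevel_rels TYPE('p) m) (tensor_gen (ulevel_module TYPE('p) m) \<mu>)"

definition Delta_T_dist :: "'p::prime_card itself \<Rightarrow> dist" where
  "Delta_T_dist _ = (let D = (dist_algebra :: ('p mod_ring, dist) module) in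
     \<Oplus>\<^bsub>D\<^esub>i \<in> {..<CARD('p)}. ((-1) ^ i) \<odot>\<^bsub>D\<^esub> dist_class CARD('p) (uea_binom sl2_H i))"

definition Delta_T :: "nat \<Rightarrow> 'p::prime_card ulevel" where
  "Delta_T m = to_ulevel m (Delta_T_dist TYPE('p))"


section \<open>The projective line\<close>

type_synonym 'p fun_field = "'p mod_ring poly fract"

definition const :: "'p::prime_card mod_ring \<Rightarrow> 'p fun_field" where
  "const c = Fract [:c:] 1"

definition coord_t :: "'p::prime_card fun_field" where
  "coord_t = Fract [:0, 1:] 1"

definition coords :: "'p::prime_card fun_field set" where
  "coords = {coord_t, inverse coord_t}"

text \<open>For a coordinate \<open>\<tau>\<close>, the chart ring \<open>k[\<tau>]\<close> is the image of the polynomial ring under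
  \<open>poly_in \<tau>\<close>. A point of the projective line is identified with its local ring inside the
  function field; two points of the two charts are glued exactly when their local rings agree.\<close>

definition poly_in :: "'p::prime_card fun_field \<Rightarrow> 'p mod_ring poly \<Rightarrow> 'p fun_field" where
  "poly_in \<tau> f = poly (map_poly const f) \<tau>"

type_synonym 'p point = "'p fun_field set"

definition prime_spec :: "'p::prime_card mod_ring poly set set" where
  "prime_spec = {P. primeideal P type_ring}"

definition local_ring ::
    "'p::prime_card fun_field \<Rightarrow> 'p mod_ring poly set \<Rightarrow> 'p point" where
  "local_ring \<tau> P = {poly_in \<tau> a / poly_in \<tau> b | a b. b \<notin> P}"

definition chart :: "'p::prime_card fun_field \<Rightarrow> 'p point set" where
  "chart \<tau> = local_ring \<tau> ` prime_spec"

definition proj_line :: "'p::prime_card point set" where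
  "proj_line = (\<Union>\<tau> \<in> coords. chart \<tau>)"

text \<open>A set is open iff its preimage in the spectrum of either chart ring is the complement
  of a Zariski closed set.\<close>

definition zariski_open :: "'p::prime_card point set \<Rightarrow> bool" where
  "zariski_open U \<longleftrightarrow> U \<subseteq> proj_line \<and>
     (\<forall>\<tau> \<in> coords. \<exists>I. {P \<in> prime_spec. local_ring \<tau> P \<in> U} = {P \<in> prime_spec. \<not> I \<subseteq> P})"

text \<open>Sections of the structure sheaf over a nonempty open set: the rational functions
  regular at each of its points. The empty set, over which the sections should be zero, is
  never used as an argument.\<close>

definition regular :: "'p::prime_card point set \<Rightarrow> 'p fun_field set" where
  "regular U = \<Inter>U"


section \<open>Differential operators on the projective line\<close>

type_synonym 'p operator = "'p fun_field \<Rightarrow> 'p fun_field"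

definition k_linear :: "'p::prime_card operator \<Rightarrow> bool" where
  "k_linear D \<longleftrightarrow> (\<forall>f g. D (f + g) = D f + D g) \<and> (\<forall>c f. D (const c * f) = const c * D f)"

primrec order_le :: "nat \<Rightarrow> 'p::prime_card operator \<Rightarrow> bool" where
  "order_le 0 D \<longleftrightarrow> k_linear D \<and> (\<forall>f g. D (f * g) - f * D g = 0)"
| "order_le (Suc n) D \<longleftrightarrow> k_linear D \<and> (\<forall>f. order_le n (\<lambda>g. D (f * g) - f * D g))"

text \<open>A differential operator over U is a family of compatible operators on the rings
  \<open>regular V\<close> for V nonempty open in U. The restriction maps of the structure sheaf are
  inclusions and these rings exhaust the function field (every rational function is regular on
  a nonempty open subset of U), so such a family is the same as one operator on the function
  field that preserves every \<open>regular V\<close>. Restriction to a smaller nonempty open set is then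
  the identity.\<close>

definition diffops_le :: "'p::prime_card point set \<Rightarrow> nat \<Rightarrow> 'p operator set" where
  "diffops_le U n = {D. order_le n D \<and>
     (\<forall>V. zariski_open V \<and> V \<noteq> {} \<and> V \<subseteq> U \<longrightarrow> D ` regular V \<subseteq> regular V)}"

definition operator_algebra ::
    "'p::prime_card operator set \<Rightarrow> ('p mod_ring, 'p operator) module" where
  "operator_algebra C = \<lparr>carrier = C, mult = (\<circ>), one = id, zero = (\<lambda>_. 0),
     add = (\<lambda>D D' f. D f + D' f), module.smult = (\<lambda>c D f. const c * D f)\<rparr>"

definition diffops :: "'p::prime_card point set \<Rightarrow> ('p mod_ring, 'p operator) module" where
  "diffops U = operator_algebra (\<Union>n. diffops_le U n)"

text \<open>Over the integers the divided power derivation \<open>\<partial>^n / n!\<close> sends \<open>\<tau>^j\<close> to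
  \<open>(j choose n) \<tau>^(j - n)\<close>. Its reduction is the unique differential operator on the chart
  of \<open>\<tau>\<close> with this effect on monomials.\<close>

definition divpow_deriv :: "'p::prime_card fun_field \<Rightarrow> nat \<Rightarrow> 'p operator" where
  "divpow_deriv \<tau> n = (THE D. D \<in> carrier (diffops (chart \<tau>)) \<and>
     (\<forall>j. D (\<tau> ^ j) = of_nat (j choose n) * \<tau> ^ (j - n)))"


section \<open>Differential operators of level m\<close>

text \<open>The sheaf of level m operators is the quotient of the sheaf of tensor algebras by the
  sheaf of ideals generated by the relations. Its stalks are the corresponding quotients built
  from the stalks of the sheaf of differential operators, and a section is a family of elements
  of the stalks that locally comes from an element of the tensor algebra over an open set.\<close>

definition stalk_le :: "'p::prime_card point \<Rightarrow> nat \<Rightarrow> 'p operator set" where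
  "stalk_le x n = (\<Union>U \<in> {U. zariski_open U \<and> x \<in> U}. diffops_le U n)"

definition stalk_diffops :: "'p::prime_card point \<Rightarrow> ('p mod_ring, 'p operator) module" where
  "stalk_diffops x = operator_algebra (\<Union>n. stalk_le x n)"

definition dlevel_module ::
    "nat \<Rightarrow> 'p::prime_card point \<Rightarrow> ('p mod_ring, 'p operator) module" where
  "dlevel_module m x = level_module (stalk_diffops x) (stalk_le x) (CARD('p) ^ m)"

definition dlevel_rels ::
    "nat \<Rightarrow> 'p::prime_card point \<Rightarrow> ('p operator, 'p mod_ring) free_alg set set" where
  "dlevel_rels m x =
     level_rels (stalk_diffops x) (stalk_le x) (CARD('p) ^ m) \<union>
     level_rels_right (stalk_diffops x) (stalk_le x) (CARD('p) ^ m)"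

type_synonym 'p dlevel = "('p operator, 'p mod_ring) free_alg set set"

definition dlevel_stalk :: "nat \<Rightarrow> 'p::prime_card point \<Rightarrow> 'p dlevel ring" where
  "dlevel_stalk m x = ring_pres (tensor_algebra (dlevel_module m x)) (dlevel_rels m x)"

definition dlevel_germ ::
    "nat \<Rightarrow> 'p::prime_card point \<Rightarrow> ('p operator, 'p mod_ring) free_alg \<Rightarrow> 'p dlevel" where
  "dlevel_germ m x \<xi> = ring_pres_class (tensor_algebra (dlevel_module m x)) (dlevel_rels m x)
     (tensor_class (dlevel_module m x) \<xi>)"

definition dlevel_sections ::
    "nat \<Rightarrow> 'p::prime_card point set \<Rightarrow> ('p point \<Rightarrow> 'p dlevel) ring" where
  "dlevel_sections m W =
     \<lparr>carrier = {\<sigma> \<in> extensional W. \<forall>x \<in> W. \<exists>U. zariski_open U \<and> x \<in> U \<and> U \<subseteq> W \<and>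
        (\<exists>\<xi> \<in> carrier (free_algebra (diffops_le U (2 * CARD('p) ^ m - 1))).
           \<forall>y \<in> U. \<sigma> y = dlevel_germ m y \<xi>)},
      mult = (\<lambda>\<sigma> \<sigma>'. \<lambda>x \<in> W. \<sigma> x \<otimes>\<^bsub>dlevel_stalk m x\<^esub> \<sigma>' x),
      one = (\<lambda>x \<in> W. \<one>\<^bsub>dlevel_stalk m x\<^esub>),
      zero = (\<lambda>x \<in> W. \<zero>\<^bsub>dlevel_stalk m x\<^esub>),
      add = (\<lambda>\<sigma> \<sigma>'. \<lambda>x \<in> W. \<sigma> x \<oplus>\<^bsub>dlevel_stalk m x\<^esub> \<sigma>' x)\<rparr>"

definition to_dlevel ::
    "nat \<Rightarrow> 'p::prime_card point set \<Rightarrow> 'p operator \<Rightarrow> 'p point \<Rightarrow> 'p dlevel" where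
  "to_dlevel m W D = (\<lambda>x \<in> W. dlevel_germ m x (free_letter D))"


section \<open>The canonical morphisms and the Dwork operator\<close>

text \<open>The conditions determine \<open>\<rho>\<close> on its domain, because the divided powers of E and F
  generate the algebra of distributions; likewise \<open>rho_level\<close> is determined on its domain by
  its values on generators. Over the prime field a ring morphism is automatically linear.\<close>

definition rho :: "dist \<Rightarrow> 'p::prime_card operator" where
  "rho = (SOME \<rho>.
     \<rho> \<in> Ring.ring_hom (dist_algebra :: ('p mod_ring, dist) module) (diffops proj_line) \<and>
     (\<forall>n. \<rho> ` dist_order TYPE('p) n \<subseteq> diffops_le proj_line n) \<and>
     (\<forall>n. \<rho> (dist_class CARD('p) (uea_divpow sl2_E n)) = divpow_deriv coord_t n) \<and>
     (\<forall>n. \<rho> (dist_class CARD('p) (uea_divpow sl2_F n)) = divpow_deriv (inverse coord_t) n))"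

definition rho_level :: "nat \<Rightarrow> 'p::prime_card ulevel \<Rightarrow> 'p point \<Rightarrow> 'p dlevel" where
  "rho_level m = (SOME r. r \<in> Ring.ring_hom (ulevel_ring m) (dlevel_sections m proj_line) \<and>
     (\<forall>\<mu> \<in> dist_order TYPE('p) (2 * CARD('p) ^ m - 1).
        r (to_ulevel m \<mu>) = to_dlevel m proj_line (rho \<mu>)))"

definition dwork_operator :: "'p::prime_card fun_field \<Rightarrow> 'p operator" where
  "dwork_operator \<tau> f = (\<Sum>r<CARD('p). (- \<tau>) ^ r * divpow_deriv \<tau> r f)"

definition dwork :: "nat \<Rightarrow> 'p::prime_card point \<Rightarrow> 'p dlevel" where
  "dwork m = (THE \<sigma>. \<sigma> \<in> carrier (dlevel_sections m proj_line) \<and>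
     (\<forall>\<tau> \<in> coords. restrict \<sigma> (chart \<tau>) = to_dlevel m (chart \<tau>) (dwork_operator \<tau>)))"

end

theory Submission
  imports Defs "HOL-Computational_Algebra.Formal_Power_Series"
begin


text \<open>The morphisms \<open>\<rho>\<close> and \<open>\<rho>\<^sub>m\<close> are only characterised by their properties, so the point is
  that they exist. The enveloping algebra over the rationals acts on Laurent polynomials in \<open>t\<close> by
  derivations. The divided powers of E and F and the binomials of H preserve integral Laurent
  polynomials, and the reductions of their actions modulo p are given by differential operators on
  the function field, namely coefficients of Taylor expansions \<open>f(t + \<epsilon>)\<close>. An operator of finite
  order is determined by its values on the powers of \<open>t\<close>, so composites match and \<open>\<rho>\<close> is
  multiplicative. Kostant's straightening formula for a divided power of F times a divided power of
  E shows that orders of distributions add up in products and drop by one in commutators; hence the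
  relations of level m make sense and \<open>\<rho>\<close> respects them.

  Finally \<open>\<Delta>\<^sub>T\<close> multiplies \<open>t\<^sup>j\<close> by the alternating sum over \<open>i < p\<close> of the binomials of \<open>- 2 j\<close>
  over \<open>i\<close>, and the two expressions of the Dwork operator multiply it by the same sums for \<open>j\<close> and
  \<open>- j\<close>. Such a sum for \<open>N\<close> is 1 modulo p if p divides \<open>N\<close> and 0 otherwise, so all three agree
  because p is odd.\<close>


section \<open>Ring presentations\<close>

text \<open>The specification of \<open>rho\<close> prescribes values only on the divided powers of
  E and F, and \<open>rho\<close> is an arbitrary map meeting it. Its values on the binomials of H
  are therefore recovered from \<open>H = E F - F E\<close> and
  \<open>(b + 1) binom(H, b + 1) = binom(H, b) (H - b)\<close>; dividing by \<open>b + 1\<close> is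
  possible since only \<open>b + 1 < p\<close> occurs in \<Delta>_T. Reduction modulo p is at first
  only a relation between elements of the enveloping algebra and operators on the function field; it
  becomes a function through the uniqueness of operators of finite order. Straightening shifts the
  argument of the polynomial in H between the divided powers. Single binomials are not stable under
  such shifts, integer-valued polynomials are, and the order filtration is handled with the latter.
  The two level m algebras are not symmetric: the factor of low order stands on the left for
  distributions and on the right for differential operators. The commutator relations carry one
  convention into the other. The morphism of level m is built at each point separately, but from one
  free algebra element for all points, so that its values are sections.\<close>

lemma ring_pres_facts:
  assumes "ring R" and "S \<subseteq> carrier R"
  shows ring_ring_pres: "ring (ring_pres R S)"
    and ring_pres_class_hom: "ring_pres_class R S \<in> Ring.ring_hom R (ring_pres R S)"
    and carrier_ring_pres: "carrier (ring_pres R S) = ring_pres_class R S ` carrier R"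
    and ring_pres_class_zero: "x \<in> S \<Longrightarrow> ring_pres_class R S x = \<zero>\<^bsub>ring_pres R S\<^esub>"
proof -
  interpret ring R by fact
  interpret I: ideal "Idl\<^bsub>R\<^esub> S" R by (rule genideal_ideal[OF assms(2)])
  show "ring (ring_pres R S)"
    unfolding ring_pres_def by (rule I.quotient_is_ring)
  show "ring_pres_class R S \<in> Ring.ring_hom R (ring_pres R S)"
    unfolding ring_pres_def ring_pres_class_def[abs_def] by (rule I.rcos_ring_hom)
  show "carrier (ring_pres R S) = ring_pres_class R S ` carrier R"
    unfolding ring_pres_def ring_pres_class_def by (auto simp: FactRing_simps)
  show "ring_pres_class R S x = \<zero>\<^bsub>ring_pres R S\<^esub>" if "x \<in> S"
  proof -
    have "x \<in> Idl\<^bsub>R\<^esub> S" using genideal_self[OF assms(2)] that by blast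
    then show ?thesis
      unfolding ring_pres_def ring_pres_class_def by (simp add: FactRing_def I.a_rcos_const)
  qed
qed

text \<open>The kernel of \<open>h\<close> is an ideal containing \<open>S\<close>, hence contains
  the generated ideal. The induced map evaluates \<open>h\<close> at an arbitrarily chosen
  representative of the coset.\<close>

lemma ring_pres_lift:
  assumes R: "ring R" and S: "S \<subseteq> carrier R" and T: "ring T"
    and h: "h \<in> Ring.ring_hom R T" and zero: "\<And>x. x \<in> S \<Longrightarrow> h x = \<zero>\<^bsub>T\<^esub>"
  obtains g where "g \<in> Ring.ring_hom (ring_pres R S) T"
    and "\<And>x. x \<in> carrier R \<Longrightarrow> g (ring_pres_class R S x) = h x"
proof -
  interpret ring R by fact
  interpret T: ring T by fact
  interpret h: ring_hom_ring R T h
    by (rule ring_hom_ringI2[OF R T h])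
  interpret I: ideal "Idl\<^bsub>R\<^esub> S" R by (rule genideal_ideal[OF S])
  have ker: "Idl\<^bsub>R\<^esub> S \<subseteq> a_kernel R T h"
  proof (rule genideal_minimal)
    show "ideal (a_kernel R T h) R" by (rule h.kernel_is_ideal)
    show "S \<subseteq> a_kernel R T h" unfolding a_kernel_def' using S zero by blast
  qed
  \<comment> \<open>This makes the chosen representative in \<open>g\<close> irrelevant.\<close>
  have const: "h y = h x" if "x \<in> carrier R" "y \<in> ring_pres_class R S x" for x y
  proof -
    from that obtain i where i: "i \<in> Idl\<^bsub>R\<^esub> S" "y = i \<oplus>\<^bsub>R\<^esub> x"
      by (auto simp: ring_pres_class_def a_r_coset_def r_coset_def)
    then have "i \<in> carrier R" "h i = \<zero>\<^bsub>T\<^esub>" using ker unfolding a_kernel_def' by blast+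
    with i(2) that(1) show ?thesis by simp
  qed
  define g where "g A = h (SOME x. x \<in> A)" for A
  have g: "g (ring_pres_class R S x) = h x" if "x \<in> carrier R" for x
  proof -
    have "x \<in> ring_pres_class R S x"
      unfolding ring_pres_class_def by (rule I.a_rcos_self[OF that])
    then show ?thesis
      unfolding g_def by (rule someI2) (rule const[OF that])
  qed
  note facts = ring_pres_facts[OF R S]
  have "g \<in> Ring.ring_hom (ring_pres R S) T"
  proof (rule ring_hom_memI)
    fix A B assume A: "A \<in> carrier (ring_pres R S)" and B: "B \<in> carrier (ring_pres R S)"
    from A obtain x where x: "x \<in> carrier R" "A = ring_pres_class R S x"
      unfolding facts(3) by blast
    from B obtain y where y: "y \<in> carrier R" "B = ring_pres_class R S y"
      unfolding facts(3) by blast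
    show "g A \<in> carrier T" using x by (simp add: g)
    have "A \<otimes>\<^bsub>ring_pres R S\<^esub> B = ring_pres_class R S (x \<otimes>\<^bsub>R\<^esub> y)"
      using x y ring_hom_mult[OF facts(2)] by simp
    with x y show "g (A \<otimes>\<^bsub>ring_pres R S\<^esub> B) = g A \<otimes>\<^bsub>T\<^esub> g B"
      by (simp add: g)
    have "A \<oplus>\<^bsub>ring_pres R S\<^esub> B = ring_pres_class R S (x \<oplus>\<^bsub>R\<^esub> y)"
      using x y ring_hom_add[OF facts(2)] by simp
    with x y show "g (A \<oplus>\<^bsub>ring_pres R S\<^esub> B) = g A \<oplus>\<^bsub>T\<^esub> g B"
      by (simp add: g)
  next
    show "g \<one>\<^bsub>ring_pres R S\<^esub> = \<one>\<^bsub>T\<^esub>"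
      using g[of "\<one>\<^bsub>R\<^esub>"] ring_hom_one[OF facts(2)] h.hom_one by simp
  qed
  with g show ?thesis using that by blast
qed

lemma ring_type_ring: "ring type_ring"
proof (rule ringI)
  show "abelian_group (type_ring :: 'a ring)"
    by (rule abelian_groupI) (auto simp: type_ring_def ac_simps intro: exI[where x = "- x" for x :: 'a])
  show "monoid (type_ring :: 'a ring)"
    by (rule monoidI) (auto simp: type_ring_def mult.assoc)
qed (auto simp: type_ring_def algebra_simps)

lemma ring_hom_a_minus:
  assumes "ring R" "ring S" "h \<in> Ring.ring_hom R S" "x \<in> carrier R" "y \<in> carrier R"
  shows "h (x \<ominus>\<^bsub>R\<^esub> y) = h x \<ominus>\<^bsub>S\<^esub> h y"
proof -
  interpret h: ring_hom_ring R S h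
    by (rule ring_hom_ringI2[OF assms(1-3)])
  show ?thesis using assms by (simp add: a_minus_def)
qed

lemma type_ring_simps [simp]:
  "carrier (type_ring :: 'a::ring_1 ring) = UNIV"
  "x \<otimes>\<^bsub>type_ring\<^esub> y = x * y" "\<one>\<^bsub>type_ring\<^esub> = 1"
  "x \<oplus>\<^bsub>type_ring\<^esub> y = x + y" "\<zero>\<^bsub>type_ring\<^esub> = 0"
  for x y :: "'a::ring_1"
  by (auto simp: type_ring_def)

lemma type_ring_a_inv [simp]: "\<ominus>\<^bsub>type_ring\<^esub> x = - (x::'a::ring_1)"
proof -
  interpret ring "type_ring :: 'a ring" by (rule ring_type_ring)
  show ?thesis using minus_equality[of "- x" x] by simp
qed

lemma type_ring_a_minus [simp]: "x \<ominus>\<^bsub>type_ring\<^esub> y = x - (y::'a::ring_1)"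
  by (simp add: a_minus_def)


section \<open>Free algebras\<close>

definition free_eval :: "('k \<Rightarrow> 'r) \<Rightarrow> ('v \<Rightarrow> 'r) \<Rightarrow> ('v, 'k::comm_ring_1) free_alg \<Rightarrow> 'r::ring_1" where
  "free_eval \<kappa> g \<xi> =
     (\<Sum>w \<in> Poly_Mapping.keys \<xi>. \<kappa> (Poly_Mapping.lookup \<xi> w) * prod_list (map g (letters w)))"

lemma poly_mapping_single_induct [case_names zero single add]:
  fixes \<xi> :: "'a \<Rightarrow>\<^sub>0 'b::comm_monoid_add"
  assumes "P 0" "\<And>w c. P (Poly_Mapping.single w c)" "\<And>a b. P a \<Longrightarrow> P b \<Longrightarrow> P (a + b)"
  shows "P \<xi>"
proof -
  have "\<xi> = (\<Sum>w \<in> Poly_Mapping.keys \<xi>. Poly_Mapping.single w (Poly_Mapping.lookup \<xi> w))"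
    by (rule poly_mapping_eqI)
      (auto simp: lookup_sum lookup_single when_def in_keys_iff sum.delta)
  moreover have "P (\<Sum>w \<in> A. Poly_Mapping.single w (Poly_Mapping.lookup \<xi> w))" if "finite A" for A
    using that by induction (auto intro: assms)
  ultimately show ?thesis by (metis finite_keys)
qed

text \<open>The target may be noncommutative, as it is for operators; commutation of the scalars
  with the images of letters is what lets them be collected in front of a word.\<close>

locale free_evaluation =
  fixes \<kappa> :: "'k::comm_ring_1 \<Rightarrow> 'r::ring_1" and g :: "'v \<Rightarrow> 'r"
  assumes scal_add: "\<kappa> (a + b) = \<kappa> a + \<kappa> b"
    and scal_mult: "\<kappa> (a * b) = \<kappa> a * \<kappa> b"
    and scal_one: "\<kappa> 1 = 1"
    and scal_central: "\<kappa> a * g v = g v * \<kappa> a"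
begin

lemma scal_zero: "\<kappa> 0 = 0"
  using scal_add[of 0 0] by simp

lemma free_eval_superset:
  assumes "finite A" "Poly_Mapping.keys \<xi> \<subseteq> A"
  shows "free_eval \<kappa> g \<xi> =
    (\<Sum>w \<in> A. \<kappa> (Poly_Mapping.lookup \<xi> w) * prod_list (map g (letters w)))"
  unfolding free_eval_def
  by (rule sum.mono_neutral_left) (use assms in \<open>auto simp: in_keys_iff scal_zero\<close>)

lemma free_eval_zero: "free_eval \<kappa> g 0 = 0"
  by (simp add: free_eval_def)

lemma free_eval_add: "free_eval \<kappa> g (\<xi> + \<eta>) = free_eval \<kappa> g \<xi> + free_eval \<kappa> g \<eta>"
proof -
  let ?A = "Poly_Mapping.keys \<xi> \<union> Poly_Mapping.keys \<eta>"
  have "Poly_Mapping.keys (\<xi> + \<eta>) \<subseteq> ?A" by (rule Poly_Mapping.keys_add)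
  then show ?thesis
    by (simp add: free_eval_superset[of ?A] lookup_add scal_add distrib_right sum.distrib)
qed

lemma free_eval_single:
  "free_eval \<kappa> g (Poly_Mapping.single w c) = \<kappa> c * prod_list (map g (letters w))"
  by (simp add: free_eval_superset[of "{w}"])

lemma scal_prod_list: "prod_list (map g vs) * \<kappa> a = \<kappa> a * prod_list (map g vs)"
proof (induction vs)
  case (Cons v vs)
  then show ?case by (simp add: mult.assoc) (simp add: scal_central flip: mult.assoc)
qed simp

lemma free_eval_mult: "free_eval \<kappa> g (\<xi> * \<eta>) = free_eval \<kappa> g \<xi> * free_eval \<kappa> g \<eta>"
proof (induction \<xi> rule: poly_mapping_single_induct)
  case (single w c)
  show ?case
  proof (induction \<eta> rule: poly_mapping_single_induct)
    case (single v d)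
    let ?w = "prod_list (map g (letters w))" and ?v = "prod_list (map g (letters v))"
    have "\<kappa> (c * d) * (?w * ?v) = \<kappa> c * ((\<kappa> d * ?w) * ?v)"
      by (simp add: scal_mult mult.assoc)
    also have "\<kappa> d * ?w = ?w * \<kappa> d"
      by (rule scal_prod_list[symmetric])
    also have "\<kappa> c * (?w * \<kappa> d * ?v) = \<kappa> c * ?w * (\<kappa> d * ?v)"
      by (simp add: mult.assoc)
    finally show ?case
      by (simp add: mult_single free_eval_single plus_word_monoid_def)
  qed (auto simp: free_eval_zero free_eval_add distrib_left)
qed (auto simp: free_eval_zero free_eval_add distrib_right)

lemma free_eval_letter: "free_eval \<kappa> g (free_letter v) = g v"
  by (simp add: free_letter_def free_eval_single scal_one)

lemma free_eval_scalar: "free_eval \<kappa> g (free_scalar c) = \<kappa> c"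
  by (simp add: free_scalar_def free_eval_single zero_word_monoid_def)

lemma free_eval_one: "free_eval \<kappa> g 1 = 1"
  using free_eval_scalar[of 1] by (simp add: free_scalar_def scal_one)

lemma free_eval_diff: "free_eval \<kappa> g (\<xi> - \<eta>) = free_eval \<kappa> g \<xi> - free_eval \<kappa> g \<eta>"
  using free_eval_add[of "\<xi> - \<eta>" \<eta>] by simp

end

lemma mem_free_algebra:
  "\<xi> \<in> carrier (free_algebra V) \<longleftrightarrow> (\<forall>w \<in> Poly_Mapping.keys \<xi>. set (letters w) \<subseteq> V)"
  by (simp add: free_algebra_def)

lemma free_alg_closed:
  shows "0 \<in> carrier (free_algebra V)" "1 \<in> carrier (free_algebra V)"
    "\<xi> \<in> carrier (free_algebra V) \<Longrightarrow> - \<xi> \<in> carrier (free_algebra V)"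
    "\<xi> \<in> carrier (free_algebra V) \<Longrightarrow> \<eta> \<in> carrier (free_algebra V) \<Longrightarrow> \<xi> + \<eta> \<in> carrier (free_algebra V)"
    "\<xi> \<in> carrier (free_algebra V) \<Longrightarrow> \<eta> \<in> carrier (free_algebra V) \<Longrightarrow> \<xi> * \<eta> \<in> carrier (free_algebra V)"
    "v \<in> V \<Longrightarrow> free_letter v \<in> carrier (free_algebra V)"
    "free_scalar c \<in> carrier (free_algebra V)"
proof -
  show "\<xi> + \<eta> \<in> carrier (free_algebra V)"
    if "\<xi> \<in> carrier (free_algebra V)" "\<eta> \<in> carrier (free_algebra V)"
    using that Poly_Mapping.keys_add[of \<xi> \<eta>] unfolding mem_free_algebra by blast
  show "\<xi> * \<eta> \<in> carrier (free_algebra V)"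
    if h: "\<xi> \<in> carrier (free_algebra V)" "\<eta> \<in> carrier (free_algebra V)"
    unfolding mem_free_algebra
  proof
    fix w assume w: "w \<in> Poly_Mapping.keys (\<xi> * \<eta>)"
    obtain u v where uv: "w = u + v" "u \<in> Poly_Mapping.keys \<xi>" "v \<in> Poly_Mapping.keys \<eta>"
      using w Poly_Mapping.keys_mult[of \<xi> \<eta>] by blast
    then have "set (letters u) \<subseteq> V" "set (letters v) \<subseteq> V"
      using h unfolding mem_free_algebra by blast+
    with uv show "set (letters w) \<subseteq> V"
      by (simp add: plus_word_monoid_def)
  qed
  show "1 \<in> carrier (free_algebra V)"
    by (simp add: mem_free_algebra zero_word_monoid_def)
  show "- \<xi> \<in> carrier (free_algebra V)" if "\<xi> \<in> carrier (free_algebra V)"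
    using that by (simp add: mem_free_algebra in_keys_iff)
  show "free_letter v \<in> carrier (free_algebra V)" if "v \<in> V"
    using that by (simp add: mem_free_algebra free_letter_def)
  show "free_scalar c \<in> carrier (free_algebra V)"
    by (simp add: mem_free_algebra free_scalar_def zero_word_monoid_def)
qed (simp add: mem_free_algebra)

lemma free_algebra_simps [simp]:
  "\<xi> \<otimes>\<^bsub>free_algebra V\<^esub> \<eta> = \<xi> * \<eta>" "\<one>\<^bsub>free_algebra V\<^esub> = 1"
  "\<xi> \<oplus>\<^bsub>free_algebra V\<^esub> \<eta> = \<xi> + \<eta>" "\<zero>\<^bsub>free_algebra V\<^esub> = 0"
  by (auto simp: free_algebra_def type_ring_def)

lemma free_alg_closed_diff:
  "\<xi> \<in> carrier (free_algebra V) \<Longrightarrow> \<eta> \<in> carrier (free_algebra V) \<Longrightarrow> \<xi> - \<eta> \<in> carrier (free_algebra V)"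
  using free_alg_closed(4)[of \<xi> V "- \<eta>"] free_alg_closed(3)[of \<eta> V] by simp

lemma ring_free_algebra: "ring (free_algebra V)"
proof (rule ringI)
  show "abelian_group (free_algebra V)"
  proof (rule abelian_groupI)
    fix \<xi> assume "\<xi> \<in> carrier (free_algebra V)"
    then show "\<exists>\<eta>\<in>carrier (free_algebra V). \<eta> \<oplus>\<^bsub>free_algebra V\<^esub> \<xi> = \<zero>\<^bsub>free_algebra V\<^esub>"
      by (auto intro!: bexI[of _ "- \<xi>"] free_alg_closed)
  qed (auto simp: ac_simps free_alg_closed)
  show "monoid (free_algebra V)"
    by (rule monoidI) (auto simp: mult.assoc free_alg_closed)
qed (simp_all add: distrib_left distrib_right)

text \<open>The carrier of a module need only be closed under the operations for its tensor algebra
  to be a ring.\<close>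

locale linear_carrier =
  fixes M :: "('k::comm_ring_1, 'v) module"
  assumes add_closed: "v \<in> carrier M \<Longrightarrow> w \<in> carrier M \<Longrightarrow> v \<oplus>\<^bsub>M\<^esub> w \<in> carrier M"
    and smult_closed: "v \<in> carrier M \<Longrightarrow> c \<odot>\<^bsub>M\<^esub> v \<in> carrier M"
begin

lemma linearity_rels_carrier: "linearity_rels M \<subseteq> carrier (free_algebra (carrier M))"
  by (auto simp: linearity_rels_def intro!: free_alg_closed free_alg_closed_diff add_closed smult_closed)

lemma ring_tensor_algebra: "ring (tensor_algebra M)"
  unfolding tensor_algebra_def
  by (rule ring_ring_pres[OF ring_free_algebra linearity_rels_carrier])

lemma tensor_class_hom: "tensor_class M \<in> Ring.ring_hom (free_algebra (carrier M)) (tensor_algebra M)"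
  unfolding tensor_algebra_def tensor_class_def
  by (rule ring_pres_class_hom[OF ring_free_algebra linearity_rels_carrier])

lemma carrier_tensor_algebra:
  "carrier (tensor_algebra M) = tensor_class M ` carrier (free_algebra (carrier M))"
  unfolding tensor_algebra_def tensor_class_def
  by (rule carrier_ring_pres[OF ring_free_algebra linearity_rels_carrier])

lemma tensor_closed:
  "v \<in> carrier M \<Longrightarrow> tensor_gen M v \<in> carrier (tensor_algebra M)"
  "tensor_scalar M c \<in> carrier (tensor_algebra M)"
  by (auto simp: carrier_tensor_algebra tensor_gen_def tensor_scalar_def free_alg_closed)

lemma tensor_class_zero:
  "x \<in> linearity_rels M \<Longrightarrow> tensor_class M x = \<zero>\<^bsub>tensor_algebra M\<^esub>"
  unfolding tensor_algebra_def tensor_class_def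
  by (rule ring_pres_class_zero[OF ring_free_algebra linearity_rels_carrier])

lemma tensor_algebra_lift:
  assumes "ring T" "h \<in> Ring.ring_hom (free_algebra (carrier M)) T"
    and "\<And>x. x \<in> linearity_rels M \<Longrightarrow> h x = \<zero>\<^bsub>T\<^esub>"
  obtains h' where "h' \<in> Ring.ring_hom (tensor_algebra M) T"
    "\<And>\<xi>. \<xi> \<in> carrier (free_algebra (carrier M)) \<Longrightarrow> h' (tensor_class M \<xi>) = h \<xi>"
  using ring_pres_lift[OF ring_free_algebra linearity_rels_carrier assms]
  unfolding tensor_algebra_def tensor_class_def by blast

end

section \<open>Integer-valued polynomials\<close>

text \<open>These polynomials form a ring stable under integral affine substitutions, and by
  Newton's expansion they are the integral span of the binomials. Both facts are used to compute in
  the Kostant form.\<close>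

definition intval :: "rat poly \<Rightarrow> bool" where
  "intval P \<longleftrightarrow> (\<forall>n::int. poly P (of_int n) \<in> \<int>)"

primrec pfall :: "nat \<Rightarrow> rat poly" where
  "pfall 0 = 1"
| "pfall (Suc n) = pfall n * [:- of_nat n, 1:]"

definition pbin :: "nat \<Rightarrow> rat poly" where
  "pbin n = smult (1 / fact n) (pfall n)"

lemma poly_pbin: "poly (pbin n) x = x gchoose n"
proof -
  have "poly (pfall n) x = (\<Prod>i = 0..<n. x - of_nat i)"
    by (induction n) (auto simp: algebra_simps)
  then show ?thesis
    by (simp add: pbin_def gbinomial_prod_rev)
qed

lemma degree_pbin: "degree (pbin n) = n"
proof -
  have "pfall n \<noteq> 0 \<and> degree (pfall n) = n"
    by (induction n) (auto simp: degree_mult_eq simp del: mult_pCons_right)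
  then show ?thesis by (simp add: pbin_def)
qed

text \<open>The rational binomial is already an integer, also for negative upper argument; the floor
  only changes the type.\<close>

definition ibinom :: "int \<Rightarrow> nat \<Rightarrow> int" where
  "ibinom k n = \<lfloor>(of_int k :: rat) gchoose n\<rfloor>"

lemma of_int_ibinom: "of_int (ibinom k n) = (of_int k :: rat) gchoose n"
  unfolding ibinom_def by (simp flip: of_int_gbinomial)

lemma intval_pbin: "intval (pbin n)"
  unfolding intval_def poly_pbin by (simp flip: of_int_ibinom)

lemma intval_mult: "intval P \<Longrightarrow> intval Q \<Longrightarrow> intval (P * Q)"
  by (auto simp: intval_def)

lemma intval_diff: "intval P \<Longrightarrow> intval Q \<Longrightarrow> intval (P - Q)"
  by (auto simp: intval_def)

lemma intval_smult: "intval P \<Longrightarrow> intval (smult (of_int c) P)"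
  by (auto simp: intval_def)

lemma intval_pcompose: "intval P \<Longrightarrow> intval (pcompose P [:of_int k, of_int l:])"
proof -
  assume "intval P"
  moreover have "poly (pcompose P [:of_int k, of_int l:]) (of_int n) = poly P (of_int (k + n * l))" for n
    by (simp add: poly_pcompose)
  ultimately show ?thesis unfolding intval_def by presburger
qed

lemma intval_shift: "intval P \<Longrightarrow> intval (pcompose P [:2 * of_nat k, 1:])"
  using intval_pcompose[of P "2 * int k" 1] by simp

lemma intvalD: "intval P \<Longrightarrow> poly P (of_int n) \<in> \<int>"
  unfolding intval_def by blast

text \<open>Newton's scheme: the binomial over \<open>d + 1\<close> vanishes at 0, ..., d and is 1
  at \<open>d + 1\<close>, so the next coefficient is the error at \<open>d + 1\<close>, which is an
  integer, and earlier values are not disturbed.\<close>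

lemma newton_interpolation:
  assumes "intval P"
  shows "\<exists>c :: nat \<Rightarrow> int. \<forall>m \<le> d. poly (\<Sum>k\<le>d. smult (of_int (c k)) (pbin k)) (of_nat m) = poly P (of_nat m)"
proof (induction d)
  case 0
  obtain z where "poly P (of_int 0) = of_int z"
    using intvalD[OF assms] by (rule Ints_cases)
  then have "\<forall>m \<le> 0. poly (\<Sum>k\<le>0. smult (of_int z) (pbin k)) (of_nat m) = poly P (of_nat m)"
    by (simp add: poly_pbin)
  then show ?case by (rule exI[of _ "\<lambda>_. z"])
next
  case (Suc d)
  then obtain c where c: "\<And>m. m \<le> d \<Longrightarrow>
      poly (\<Sum>k\<le>d. smult (of_int (c k)) (pbin k)) (of_nat m) = poly P (of_nat m)" by blast
  let ?S = "\<Sum>k\<le>d. smult (of_int (c k)) (pbin k)"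
  have "poly P (of_int (int (Suc d))) \<in> \<int>" by (rule intvalD[OF assms])
  moreover have "poly ?S (of_int (int (Suc d))) \<in> \<int>"
    unfolding poly_sum poly_smult
    by (intro Ints_sum Ints_mult Ints_of_int intvalD[OF intval_pbin])
  ultimately have "poly P (of_int (int (Suc d))) - poly ?S (of_int (int (Suc d))) \<in> \<int>"
    by (rule Ints_diff)
  then obtain z where z: "poly P (of_nat (Suc d)) - poly ?S (of_nat (Suc d)) = of_int z"
    unfolding of_int_of_nat_eq by (rule Ints_cases)
  show ?case
  proof (intro exI[of _ "c(Suc d := z)"] allI impI)
    fix m assume m: "m \<le> Suc d"
    have eq: "(\<Sum>k\<le>Suc d. smult (of_int ((c(Suc d := z)) k)) (pbin k)) = ?S + smult (of_int z) (pbin (Suc d))"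
      unfolding sum.atMost_Suc by (intro arg_cong2[where f = "(+)"] sum.cong) auto
    have "poly ?S (of_nat m) + of_int z * poly (pbin (Suc d)) (of_nat m) = poly P (of_nat m)"
    proof (cases "m = Suc d")
      case True
      have one: "poly (pbin (Suc d)) (of_nat (Suc d)) = 1"
        unfolding poly_pbin binomial_gbinomial[symmetric] by simp
      have "b + c * 1 = a" if "a - b = c" for a b c :: rat
        using that by simp
      from this[OF z] show ?thesis
        unfolding True one .
    next
      case False
      with m have "m \<le> d" by simp
      then have "poly (pbin (Suc d)) (of_nat m) = 0"
        unfolding poly_pbin binomial_gbinomial[symmetric] by (simp add: binomial_eq_0)
      then show ?thesis by (simp only: c[OF \<open>m \<le> d\<close>] mult_zero_right add_0_right)
    qed
    then show "poly (\<Sum>k\<le>Suc d. smult (of_int ((c(Suc d := z)) k)) (pbin k)) (of_nat m) = poly P (of_nat m)"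
      by (simp only: eq poly_add poly_smult)
  qed
qed

text \<open>Both sides have degree at most \<open>degree P\<close> and agree at
  \<open>degree P + 1\<close> points.\<close>

lemma newton_expansion:
  assumes "intval P"
  obtains c :: "nat \<Rightarrow> int" where "P = (\<Sum>k\<le>degree P. smult (of_int (c k)) (pbin k))"
proof -
  let ?d = "degree P"
  obtain c where c: "\<And>m. m \<le> ?d \<Longrightarrow>
      poly (\<Sum>k\<le>?d. smult (of_int (c k)) (pbin k)) (of_nat m) = poly P (of_nat m)"
    using newton_interpolation[OF assms, of ?d] by blast
  let ?S = "\<Sum>k\<le>?d. smult (of_int (c k)) (pbin k)"
  have deg: "degree ?S \<le> ?d"
    by (rule degree_sum_le) (auto intro: order.trans[OF degree_smult_le] simp: degree_pbin)
  have "P = ?S"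
  proof (rule poly_eqI_degree[of "of_nat ` {..?d}"])
    show "poly P x = poly ?S x" if "x \<in> of_nat ` {..?d}" for x
      using that c by auto
    show "card (of_nat ` {..?d} :: rat set) > degree P" "card (of_nat ` {..?d} :: rat set) > degree ?S"
      using deg by (auto simp: card_image inj_on_def)
  qed
  then show ?thesis using that by blast
qed

text \<open>A shift keeps the leading coefficient, so the leading terms of the two products cancel.
  This is the source of the drop of order in commutators of distributions.\<close>

lemma degree_shift_commutator:
  fixes P Q :: "rat poly" and k k' l l' :: rat
  defines "D \<equiv> pcompose P [:k, 1:] * pcompose Q [:l, 1:] - pcompose Q [:k', 1:] * pcompose P [:l', 1:]"
  shows "D = 0 \<or> degree D < degree P + degree Q"
proof (rule disjCI)
  assume "\<not> degree D < degree P + degree Q"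
  moreover have "degree D \<le> degree P + degree Q"
    unfolding D_def
    by (rule degree_diff_le; rule order.trans[OF degree_mult_le]) (simp_all add: degree_pcompose)
  ultimately have deg: "degree D = degree P + degree Q" by simp
  have lead: "coeff (pcompose R [:s, 1:]) (degree R) = lead_coeff R" for R :: "rat poly" and s
    using lead_coeff_comp[of "[:s, 1:]" R] by (simp add: degree_pcompose)
  have "coeff D (degree P + degree Q) = 0"
    using coeff_mult_degree_sum[of "pcompose P [:k, 1:]" "pcompose Q [:l, 1:]"]
      coeff_mult_degree_sum[of "pcompose Q [:k', 1:]" "pcompose P [:l', 1:]"]
    by (simp add: D_def degree_pcompose lead add.commute mult.commute)
  then show "D = 0" using deg by (metis leading_coeff_0_iff)
qed


section \<open>Additive spans\<close>

inductive_set zspan :: "'a::ab_group_add set \<Rightarrow> 'a set" for S where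
  zero: "0 \<in> zspan S"
| base: "x \<in> S \<Longrightarrow> x \<in> zspan S"
| add: "x \<in> zspan S \<Longrightarrow> y \<in> zspan S \<Longrightarrow> x + y \<in> zspan S"
| uminus: "x \<in> zspan S \<Longrightarrow> - x \<in> zspan S"

lemma zspan_diff: "x \<in> zspan S \<Longrightarrow> y \<in> zspan S \<Longrightarrow> x - y \<in> zspan S"
  using zspan.add[of x S "- y"] zspan.uminus by auto

lemma zspan_sum: "(\<And>i. i \<in> A \<Longrightarrow> x i \<in> zspan S) \<Longrightarrow> sum x A \<in> zspan S"
  by (induction A rule: infinite_finite_induct) (auto intro: zspan.zero zspan.add)

lemma zspan_subset:
  assumes "\<And>x. x \<in> S \<Longrightarrow> x \<in> zspan T" "x \<in> zspan S"
  shows "x \<in> zspan T"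
  using assms(2) by induction (auto intro: assms(1) zspan.intros(1,3,4))

text \<open>Serves to reduce claims about products and commutators of spans to their
  generators.\<close>

lemma zspan_biadditive:
  assumes "\<And>x x' y. b (x + x') y = b x y + b x' y" "\<And>x y y'. b x (y + y') = b x y + b x y'"
    and "\<And>x y. x \<in> S \<Longrightarrow> y \<in> T \<Longrightarrow> b x y \<in> zspan U"
    and "x \<in> zspan S" "y \<in> zspan T"
  shows "b x y \<in> zspan U"
proof -
  have zero: "b 0 y = 0" "b x 0 = 0" for x y
    using assms(1)[of 0 0] assms(2)[of _ 0 0] by simp_all
  have minus: "b (- x) y = - b x y" "b x (- y) = - b x y" for x y
    using assms(1)[of "- x" x y] assms(2)[of x "- y" y] by (simp_all add: zero eq_neg_iff_add_eq_0)
  have "b x y \<in> zspan U" if "x \<in> S" for x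
    using assms(5)
    by (induction y rule: zspan.induct) (auto simp: zero minus assms(2) intro: zspan.intros(1,3,4) assms(3) that)
  with assms(4) show ?thesis
    by (induction x rule: zspan.induct) (auto simp: zero minus assms(1) intro: zspan.intros(1,3,4))
qed


section \<open>Kostant's straightening formula\<close>

text \<open>The last three assumptions are the brackets \<open>[e, f] = h\<close>,
  \<open>[h, e] = 2 e\<close> and \<open>[f, h] = 2 f\<close>, solved so as to move \<open>e\<close>
  to the left and \<open>f\<close> to the right. The sort asks for a unit but not for
  \<open>0 \<noteq> 1\<close>, so an instance involves no proof that the enveloping algebra is
  nonzero.\<close>

locale sl2_triple =
  fixes sc :: "rat \<Rightarrow> 'a::{ring, monoid_mult}" and e f h :: 'a
  assumes sc_add: "sc (a + b) = sc a + sc b"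
    and sc_mult: "sc (a * b) = sc a * sc b"
    and sc_one: "sc 1 = 1"
    and sc_central: "x * sc a = sc a * x"
    and fe: "f * e = e * f - h"
    and he: "h * e = e * (h + sc 2)"
    and fh: "f * h = (h + sc 2) * f"
begin

lemma sc_zero: "sc 0 = 0"
  using sc_add[of 0 0] by simp

lemma sc_minus: "sc (- a) = - sc a"
  using sc_add[of "- a" a] by (simp add: sc_zero eq_neg_iff_add_eq_0)

lemma sc_left_commute: "x * (sc a * y) = sc a * (x * y)"
  by (simp add: sc_central flip: mult.assoc)

text \<open>The value of a polynomial at \<open>h\<close>. A Horner scheme with coefficients mapped
  by \<open>sc\<close> replaces \<open>poly\<close>, whose argument lives in a commutative
  ring.\<close>

definition pev :: "rat poly \<Rightarrow> 'a" where
  "pev P = fold_coeffs (\<lambda>a y. sc a + h * y) P 0"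

lemma pev_0 [simp]: "pev 0 = 0"
  by (simp add: pev_def)

lemma pev_pCons [simp]: "pev (pCons a P) = sc a + h * pev P"
  by (cases "P = 0 \<and> a = 0") (auto simp: pev_def sc_zero)

lemma pev_const: "pev [:a:] = sc a"
  by simp

lemma pev_1 [simp]: "pev 1 = 1"
  using pev_const[of 1] by (simp add: sc_one one_pCons del: pev_pCons)

lemma pev_add: "pev (P + Q) = pev P + pev Q"
  by (induction P Q rule: poly_induct2) (auto simp: sc_add algebra_simps)

lemma pev_smult: "pev (smult c P) = sc c * pev P"
proof (induction P)
  case (pCons a P)
  then show ?case by (simp add: sc_mult distrib_left sc_left_commute[of h])
qed simp

lemma pev_mult: "pev (P * Q) = pev P * pev Q"
  by (induction P) (auto simp: pev_add pev_smult sc_zero algebra_simps)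

lemma pev_diff: "pev (P - Q) = pev P - pev Q"
  using pev_add[of "P - Q" Q] by simp

lemma pev_mult_right:
  assumes "h * x = x * (h + sc k)"
  shows "pev P * x = x * pev (pcompose P [:k, 1:])"
proof (induction P)
  case (pCons a P)
  have "pev (pCons a P) * x = sc a * x + h * x * pev (pcompose P [:k, 1:])"
    by (simp add: algebra_simps pCons.IH)
  then show ?case
    by (simp add: assms pcompose_pCons pev_add pev_mult sc_one sc_zero algebra_simps sc_central[of x] sc_left_commute[of x] pev_smult)
qed auto

lemma pev_mult_left:
  assumes "x * h = (h + sc k) * x"
  shows "x * pev P = pev (pcompose P [:k, 1:]) * x"
proof (induction P)
  case (pCons a P)
  have "x * pev (pCons a P) = sc a * x + x * h * pev P"
    by (simp add: algebra_simps sc_central[of x])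
  also have "x * h * pev P = (h + sc k) * (pev (pcompose P [:k, 1:]) * x)"
    by (simp add: assms mult.assoc flip: pCons.IH)
  finally show ?case
    by (simp add: pcompose_pCons pev_add pev_mult sc_one sc_zero algebra_simps sc_central[of x] sc_left_commute[of x] pev_smult)
qed auto

definition dp :: "'a \<Rightarrow> nat \<Rightarrow> 'a" where
  "dp x n = sc (1 / fact n) * x ^ n"

lemma dp_0 [simp]: "dp x 0 = 1"
  by (simp add: dp_def sc_one)

lemma dp_Suc: "x * dp x n = sc (of_nat (Suc n)) * dp x (Suc n)"
proof -
  have "sc (of_nat (Suc n)) * dp x (Suc n) = sc (of_nat (Suc n) * (1 / fact (Suc n))) * x ^ Suc n"
    by (simp only: dp_def sc_mult mult.assoc)
  also have "of_nat (Suc n) * (1 / fact (Suc n)) = (1 / fact n :: rat)"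
    by (simp add: field_simps del: of_nat_Suc)
  finally show ?thesis by (simp only: dp_def sc_left_commute[of x] power_Suc)
qed

lemma dp_mult: "dp x a * dp x b = sc (of_nat ((a + b) choose a)) * dp x (a + b)"
proof -
  have "dp x a * dp x b = sc (1 / fact a * (1 / fact b)) * x ^ (a + b)"
    by (simp only: dp_def sc_mult mult.assoc sc_left_commute[of "x ^ a"] power_add)
  also have "1 / fact a * (1 / fact b) = of_nat ((a + b) choose a) * (1 / fact (a + b) :: rat)"
    using binomial_fact[of a "a + b", where ?'a = rat] by simp
  finally show ?thesis by (simp only: dp_def sc_mult mult.assoc)
qed

lemma h_e_power: "h * e ^ n = e ^ n * (h + sc (2 * of_nat n))"
proof (induction n)
  case (Suc n)
  have "h * e ^ Suc n = e * ((h + sc 2) * e ^ n)"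
    by (simp add: he flip: mult.assoc)
  also have "\<dots> = e * (e ^ n * (h + sc (2 * of_nat n)) + sc 2 * e ^ n)"
    by (simp add: distrib_right Suc.IH)
  also have "\<dots> = e ^ Suc n * (h + sc (2 * of_nat (Suc n)))"
    by (simp add: algebra_simps sc_add sc_central[of e] sc_central[of "e ^ n"] sc_left_commute[of e])
  finally show ?case .
qed (simp add: sc_zero)

lemma f_power_h: "f ^ n * h = (h + sc (2 * of_nat n)) * f ^ n"
proof (induction n)
  case (Suc n)
  have "f ^ Suc n * h = f ^ n * (h + sc 2) * f"
    by (simp add: fh power_Suc2 mult.assoc del: power_Suc)
  also have "\<dots> = ((h + sc (2 * of_nat n)) * f ^ n + sc 2 * f ^ n) * f"
    by (simp add: distrib_left Suc.IH sc_central[of "f ^ n"])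
  also have "\<dots> = (h + sc (2 * of_nat (Suc n))) * f ^ Suc n"
    by (simp add: algebra_simps sc_add power_Suc2 del: power_Suc)
  finally show ?case .
qed (simp add: sc_zero)

lemma pev_dp_e: "pev P * dp e n = dp e n * pev (pcompose P [:2 * of_nat n, 1:])"
  by (simp only: dp_def mult.assoc sc_left_commute[of "pev P"] pev_mult_right[OF h_e_power])

lemma dp_f_pev: "dp f n * pev P = pev (pcompose P [:2 * of_nat n, 1:]) * dp f n"
  by (simp only: dp_def mult.assoc sc_left_commute[of "pev Q" for Q] pev_mult_left[OF f_power_h])

lemma f_pev: "f * pev P = pev (pcompose P [:2, 1:]) * f"
  by (rule pev_mult_left) (rule fh)

text \<open>Passing \<open>f\<close> through the \<open>n + 1\<close> factors \<open>e\<close>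
  leaves \<open>- h\<close> at each place. Moved to the right, these become
  \<open>- (h + 2 i)\<close> for \<open>i \<le> n\<close>, with sum
  \<open>- (n + 1) (h + n)\<close>.\<close>

lemma f_e_power: "f * e ^ Suc n = e ^ Suc n * f + sc (of_nat (Suc n)) * (e ^ n * pev [:- of_nat n, -1:])"
proof (induction n)
  case (Suc n)
  have "f * e ^ Suc (Suc n) = (f * e ^ Suc n) * e"
    by (simp only: power_Suc2 mult.assoc)
  also have "\<dots> = e ^ Suc n * (f * e) + sc (of_nat (Suc n)) * (e ^ n * (pev [:- of_nat n, -1:] * e))"
    by (simp only: Suc.IH distrib_right mult.assoc)
  also have "f * e = e * f + pev [:0, -1:]"
    by (simp add: fe sc_minus sc_zero sc_one)
  also have "pev [:- of_nat n, -1:] * e = e * pev (pcompose [:- of_nat n, -1:] [:2, 1:])"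
    by (rule pev_mult_right) (rule he)
  also have "e ^ Suc n * (e * f + pev [:0, -1:]) + sc (of_nat (Suc n)) * (e ^ n * (e * pev (pcompose [:- of_nat n, -1:] [:2, 1:])))
    = e ^ Suc (Suc n) * f + e ^ Suc n * pev ([:0, -1:] + smult (of_nat (Suc n)) (pcompose [:- of_nat n, -1:] [:2, 1:]))"
    by (simp only: pev_add pev_smult distrib_left sc_left_commute[of e] sc_left_commute[of "e ^ n"] mult.assoc power_Suc2 add.assoc)
  also have "[:0, -1:] + smult (of_nat (Suc n)) (pcompose [:- of_nat n, -1:] [:2, 1:])
    = smult (of_nat (Suc (Suc n))) [:- of_nat (Suc n), -1:: rat:]"
    by (simp add: pcompose_pCons algebra_simps)
  finally show ?case
    by (simp only: pev_smult sc_left_commute[of "e ^ Suc n"])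
qed (simp add: fe sc_one sc_zero sc_minus)

text \<open>Divided powers with negative exponents vanish; this makes the summation ranges below
  independent of the exponents of \<open>e\<close>.\<close>

definition dpz :: "'a \<Rightarrow> int \<Rightarrow> 'a" where
  "dpz x k = (if k < 0 then 0 else dp x (nat k))"

lemma f_dpz_e: "f * dpz e k = dpz e k * f + dpz e (k - 1) * pev [:1 - of_int k, -1:]"
proof (cases "k \<le> 0")
  case True
  then show ?thesis by (cases "k = 0") (auto simp: dpz_def)
next
  case False
  then obtain n where k: "k = int (Suc n)" by (metis not_le zero_less_imp_eq_int Suc_pred)
  have "f * dp e (Suc n) = sc (1 / fact (Suc n)) * (f * e ^ Suc n)"
    by (simp only: dp_def sc_left_commute[of f])
  also have "\<dots> = dp e (Suc n) * f + sc (1 / fact (Suc n) * of_nat (Suc n)) * (e ^ n * pev [:- of_nat n, -1:])"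
    by (simp only: f_e_power dp_def sc_mult distrib_left mult.assoc)
  also have "1 / fact (Suc n) * of_nat (Suc n) = (1 / fact n :: rat)"
    by (simp add: field_simps del: of_nat_Suc)
  also have "sc (1 / fact n) * (e ^ n * pev [:- of_nat n, -1:]) = dp e n * pev [:- of_nat n, -1:]"
    by (simp add: dp_def mult.assoc)
  finally show ?thesis using k by (simp add: dpz_def nat_add_distrib)
qed

text \<open>The binomial of \<open>2 j - a - c - h\<close> over \<open>j\<close>: the middle factor
  in Kostant's formula when the power of \<open>f\<close> stands on the left. The exponent
  \<open>a\<close> is an integer to fit \<open>dpz\<close>.\<close>

definition kostant_poly :: "int \<Rightarrow> nat \<Rightarrow> nat \<Rightarrow> rat poly" where
  "kostant_poly a c j = pcompose (pbin j) [:of_int (2 * int j - a - int c), -1:]"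

text \<open>The comparison of coefficients in the induction of \<open>dp_f_dpz_e\<close>; it is
  Pascal's rule together with the absorption identity.\<close>

lemma kostant_poly_step:
  fixes y :: rat and c j :: nat
  shows "(of_nat c - of_nat j) * (y gchoose Suc j) + (y - of_nat j + of_nat (Suc c)) * (y gchoose j)
     = of_nat (Suc c) * ((y + 1) gchoose Suc j)"
proof -
  have "of_nat (Suc j) * (y gchoose Suc j) = (y - of_nat j) * (y gchoose j)"
    by (metis gbinomial_absorb_comp gbinomial_absorption)
  then show ?thesis
    unfolding gbinomial_Suc_Suc by (simp add: algebra_simps)
qed

text \<open>In the induction on \<open>c\<close> one multiplies by \<open>f\<close> on the left,
  uses \<open>f * dp f c = (c + 1) * dp f (c + 1)\<close>, lets \<open>f\<close> pass the power of
  \<open>e\<close> in each summand, and divides by \<open>c + 1\<close> at the end, which the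
  rational scalars allow.\<close>

lemma dp_f_dpz_e:
  "dp f c * dpz e a = (\<Sum>j\<le>c. dpz e (a - int j) * pev (kostant_poly a c j) * dp f (c - j))"
proof (induction c)
  case 0
  have "kostant_poly a 0 0 = 1" by (simp add: kostant_poly_def pbin_def)
  then show ?case by simp
next
  case (Suc c)
  \<comment> \<open>When \<open>f\<close> meets summand \<open>j\<close>, either it passes to the
    right and merges with the power of \<open>f\<close>, which gives \<open>A j\<close>, or it
    lowers the exponent of \<open>e\<close> by one, which gives \<open>B j\<close>, a contribution
    to index \<open>j + 1\<close>.\<close>
  define A where "A j = smult (of_nat (Suc c) - of_nat j) (pcompose (kostant_poly a c j) [:2, 1:])" for j
  define B where "B j = [:1 - of_int (a - int j), -1:] * kostant_poly a c j" for j
  have step: "f * (dpz e (a - int j) * pev (kostant_poly a c j) * dp f (c - j))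
      = dpz e (a - int j) * pev (A j) * dp f (Suc c - j)
      + dpz e (a - int (Suc j)) * pev (B j) * dp f (Suc c - Suc j)" if "j \<le> c" for j
  proof -
    let ?R = "kostant_poly a c j"
    have "f * (dpz e (a - int j) * pev ?R * dp f (c - j)) = f * dpz e (a - int j) * (pev ?R * dp f (c - j))"
      by (simp only: mult.assoc)
    also have "\<dots> = dpz e (a - int j) * (f * pev ?R * dp f (c - j))
        + dpz e (a - int (Suc j)) * (pev (B j) * dp f (c - j))"
    proof -
      have "pev (B j) = pev [:1 - of_int (a - int j), -1:] * pev ?R"
        by (simp only: B_def pev_mult)
      moreover have "a - int (Suc j) = a - int j - 1" by simp
      ultimately show ?thesis
        by (simp only: f_dpz_e distrib_right mult.assoc)
    qed
    also have "f * pev ?R * dp f (c - j) = pev (pcompose ?R [:2, 1:]) * (f * dp f (c - j))"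
      by (simp only: f_pev mult.assoc)
    also have "f * dp f (c - j) = sc (of_nat (Suc c) - of_nat j) * dp f (Suc c - j)"
      using dp_Suc[of f "c - j"] that by (simp add: Suc_diff_le of_nat_diff algebra_simps)
    finally show ?thesis
      by (simp only: A_def pev_smult sc_left_commute[of "dpz e k" for k] sc_left_commute[of "pev Q" for Q] mult.assoc diff_Suc_Suc)
  qed
  have poly_id: "A (Suc j) + B j = smult (of_nat (Suc c)) (kostant_poly a (Suc c) (Suc j))" for j
  proof (rule poly_eq_poly_eq_iff[THEN iffD1], rule ext)
    fix x :: rat
    \<comment> \<open>With this \<open>y\<close> the binomials in \<open>A (Suc j)\<close> and
      \<open>B j\<close> have upper argument \<open>y\<close> and the one on the right has
      \<open>y + 1\<close>.\<close>
    define y :: rat where "y = 2 * of_nat j - of_int a - of_nat c - x"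
    have "poly (A (Suc j) + B j) x = (of_nat c - of_nat j) * (y gchoose Suc j)
        + (y - of_nat j + of_nat (Suc c)) * (y gchoose j)"
      by (simp add: A_def B_def kostant_poly_def poly_pcompose poly_pbin y_def algebra_simps)
    also have "\<dots> = of_nat (Suc c) * ((y + 1) gchoose Suc j)"
      by (rule kostant_poly_step)
    also have "\<dots> = poly (smult (of_nat (Suc c)) (kostant_poly a (Suc c) (Suc j))) x"
      by (simp add: kostant_poly_def poly_pcompose poly_pbin y_def algebra_simps)
    finally show "poly (A (Suc j) + B j) x = poly (smult (of_nat (Suc c)) (kostant_poly a (Suc c) (Suc j))) x" .
  qed
  have A0: "A 0 = smult (of_nat (Suc c)) (kostant_poly a (Suc c) 0)"
    by (simp add: A_def kostant_poly_def pbin_def)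
  \<comment> \<open>The factor \<open>c + 1 - j\<close> vanishes at \<open>j = c + 1\<close>, so the
    sum of the \<open>A j\<close> may run to \<open>c + 1\<close> as in the target.\<close>
  have AS: "A (Suc c) = 0" by (simp add: A_def)
  let ?t = "\<lambda>j P. dpz e (a - int j) * pev P * dp f (Suc c - j)"
  have "sc (of_nat (Suc c)) * (dp f (Suc c) * dpz e a) = f * (dp f c * dpz e a)"
    by (simp only: dp_Suc flip: mult.assoc)
  also have "\<dots> = (\<Sum>j\<le>c. ?t j (A j) + ?t (Suc j) (B j))"
    unfolding Suc.IH sum_distrib_left by (rule sum.cong) (simp_all only: step atMost_iff)
  also have "\<dots> = (\<Sum>j\<le>Suc c. ?t j (A j)) + (\<Sum>j\<le>c. ?t (Suc j) (B j))"
    by (simp add: sum.distrib AS)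
  also have "\<dots> = ?t 0 (A 0) + (\<Sum>j\<le>c. ?t (Suc j) (A (Suc j) + B j))"
    by (simp only: sum.atMost_Suc_shift sum.distrib pev_add distrib_left distrib_right add.assoc)
  also have "\<dots> = (\<Sum>j\<le>Suc c. ?t j (smult (of_nat (Suc c)) (kostant_poly a (Suc c) j)))"
    by (simp only: sum.atMost_Suc_shift poly_id A0)
  also have "\<dots> = sc (of_nat (Suc c)) * (\<Sum>j\<le>Suc c. ?t j (kostant_poly a (Suc c) j))"
    by (simp only: sum_distrib_left pev_smult sc_left_commute[of "dpz e k" for k] mult.assoc)
  finally have "sc (1 / of_nat (Suc c)) * (sc (of_nat (Suc c)) * (dp f (Suc c) * dpz e a))
     = sc (1 / of_nat (Suc c)) * (sc (of_nat (Suc c)) * (\<Sum>j\<le>Suc c. ?t j (kostant_poly a (Suc c) j)))"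
    by (rule arg_cong)
  moreover have "sc (1 / of_nat (Suc c)) * (sc (of_nat (Suc c)) * x) = x" for x
    by (simp add: sc_one del: of_nat_Suc flip: mult.assoc sc_mult)
  ultimately show ?case by (simp only:)
qed

end

section \<open>The order filtration on the Kostant form: products and commutators\<close>

context sl2_triple
begin

text \<open>The middle factor is any integer-valued polynomial, counted by its degree, since the
  shifts that arise in products lead out of the binomials. The span is the same, see
  \<open>kspan_eq\<close>.\<close>

definition kgens :: "nat \<Rightarrow> 'a set" where
  "kgens n = {dp e a * pev P * dp f c | a P c. intval P \<and> a + degree P + c \<le> n}"

lemma kgensI: "intval P \<Longrightarrow> a + degree P + c \<le> n \<Longrightarrow> dp e a * pev P * dp f c \<in> kgens n"
  unfolding kgens_def by blast

lemma intval_kostant_poly: "intval (kostant_poly a c j)"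
  using intval_pcompose[OF intval_pbin, of j "2 * int j - a - int c" "-1"]
  by (simp add: kostant_poly_def)

lemma degree_kostant_poly: "degree (kostant_poly a c j) = j"
  by (simp add: kostant_poly_def degree_pcompose degree_pbin)

text \<open>The middle factor of summand \<open>j\<close> of a product of two generators. The two
  binomial coefficients come from merging divided powers of \<open>e\<close> and of
  \<open>f\<close>, the two shifts from moving these powers past \<open>P\<close> and
  \<open>Q\<close>.\<close>

definition kterm :: "nat \<Rightarrow> rat poly \<Rightarrow> nat \<Rightarrow> nat \<Rightarrow> rat poly \<Rightarrow> nat \<Rightarrow> nat \<Rightarrow> rat poly" where
  "kterm a P c a' Q c' j =
     smult (of_int (int (((a + (a' - j)) choose a) * ((c - j + c') choose (c - j)))))
       (pcompose P [:2 * of_nat (a' - j), 1:] * kostant_poly (int a') c j * pcompose Q [:2 * of_nat (c - j), 1:])"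

lemma intval_kterm: "intval P \<Longrightarrow> intval Q \<Longrightarrow> intval (kterm a P c a' Q c' j)"
  unfolding kterm_def by (intro intval_smult intval_mult intval_shift intval_kostant_poly)

lemma degree_kterm: "degree (kterm a P c a' Q c' j) \<le> degree P + j + degree Q"
  unfolding kterm_def
  by (intro order.trans[OF degree_smult_le] order.trans[OF degree_mult_le] add_mono)
    (simp_all add: degree_pcompose degree_kostant_poly)

text \<open>Only the inner product of a power of \<open>f\<close> with a power of \<open>e\<close>
  is in the wrong order. After Kostant's formula the new powers are moved outwards and merged with
  the old ones; the case distinction is the vanishing of \<open>dpz\<close> at negative
  exponents.\<close>

lemma kgen_mult:
  "(dp e a * pev P * dp f c) * (dp e a' * pev Q * dp f c') =
    (\<Sum>j\<le>c. if j \<le> a' then dp e (a + (a' - j)) * pev (kterm a P c a' Q c' j) * dp f (c - j + c') else 0)"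
proof -
  have tm: "dp e a * pev P * (dp e b * pev R * dp f d) * (pev Q * dp f c') =
      dp e (a + b) * pev (smult (of_int (int (((a + b) choose a) * ((d + c') choose d))))
        (pcompose P [:2 * of_nat b, 1:] * R * pcompose Q [:2 * of_nat d, 1:])) * dp f (d + c')"
    (is "?L = ?R") for b d R
  proof -
    let ?c1 = "of_nat ((a + b) choose a) :: rat" and ?c2 = "of_nat ((d + c') choose d) :: rat"
    let ?P = "pcompose P [:2 * of_nat b, 1:]" and ?Q = "pcompose Q [:2 * of_nat d, 1:]"
    have "?L = dp e a * (pev P * dp e b) * pev R * (dp f d * pev Q) * dp f c'"
      by (simp only: mult.assoc)
    also have "\<dots> = (dp e a * dp e b) * (pev ?P * pev R * pev ?Q) * (dp f d * dp f c')"
      by (simp only: pev_dp_e dp_f_pev mult.assoc)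
    also have "\<dots> = sc ?c1 * dp e (a + b) * pev (?P * R * ?Q) * (sc ?c2 * dp f (d + c'))"
      by (simp only: dp_mult pev_mult)
    also have "\<dots> = dp e (a + b) * (sc (?c1 * ?c2) * pev (?P * R * ?Q)) * dp f (d + c')"
      by (simp only: sc_mult mult.assoc sc_left_commute[of "dp e k" for k] sc_left_commute[of "pev S" for S])
    finally show ?thesis by (simp only: pev_smult of_int_of_nat_eq of_nat_mult of_int_mult)
  qed
  have "(dp e a * pev P * dp f c) * (dp e a' * pev Q * dp f c') =
      dp e a * pev P * (dp f c * dpz e (int a')) * (pev Q * dp f c')"
    by (simp add: dpz_def mult.assoc)
  also have "\<dots> = (\<Sum>j\<le>c. dp e a * pev P * (dpz e (int a' - int j) * pev (kostant_poly (int a') c j) * dp f (c - j)) * (pev Q * dp f c'))"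
    by (simp only: dp_f_dpz_e sum_distrib_left sum_distrib_right)
  also have "\<dots> = (\<Sum>j\<le>c. if j \<le> a' then dp e (a + (a' - j)) * pev (kterm a P c a' Q c' j) * dp f (c - j + c') else 0)"
  proof (rule sum.cong[OF refl])
    fix j
    have "dpz e (int a' - int j) = (if j \<le> a' then dp e (a' - j) else 0)"
      by (auto simp: dpz_def nat_diff_distrib')
    then show "dp e a * pev P * (dpz e (int a' - int j) * pev (kostant_poly (int a') c j) * dp f (c - j)) * (pev Q * dp f c')
        = (if j \<le> a' then dp e (a + (a' - j)) * pev (kterm a P c a' Q c' j) * dp f (c - j + c') else 0)"
      using tm[of "a' - j" "kostant_poly (int a') c j" "c - j"]
      by (simp only: kterm_def split: if_split) simp
  qed
  finally show ?thesis .
qed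

text \<open>In summand \<open>j\<close> both outer exponents lose \<open>j\<close> and the middle
  degree gains at most \<open>j\<close>, so the order is at most \<open>n + m - j\<close>.\<close>

lemma kgens_mult: "x \<in> kgens n \<Longrightarrow> y \<in> kgens m \<Longrightarrow> x * y \<in> zspan (kgens (n + m))"
proof -
  assume "x \<in> kgens n" "y \<in> kgens m"
  then obtain a P c a' Q c' where xy: "x = dp e a * pev P * dp f c" "y = dp e a' * pev Q * dp f c'"
    and P: "intval P" "intval Q" and deg: "a + degree P + c \<le> n" "a' + degree Q + c' \<le> m"
    unfolding kgens_def by blast
  show ?thesis
    unfolding xy kgen_mult
  proof (rule zspan_sum)
    fix j assume "j \<in> {..c}"
    then show "(if j \<le> a' then dp e (a + (a' - j)) * pev (kterm a P c a' Q c' j) * dp f (c - j + c') else 0)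
        \<in> zspan (kgens (n + m))"
      using deg degree_kterm[of a P c a' Q c' j]
      by (auto intro!: zspan.zero zspan.base kgensI intval_kterm P)
  qed
qed

text \<open>Summands with \<open>j \<ge> 1\<close> have lower order already. For
  \<open>j = 0\<close> the two products have equal outer powers and equal binomial coefficients, and
  the leading terms of the middle factors cancel by \<open>degree_shift_commutator\<close>.\<close>

lemma kgens_commutator:
  assumes "x \<in> kgens n" "y \<in> kgens m"
  shows "x * y - y * x \<in> zspan (kgens (n + m - 1))"
proof -
  from assms obtain a P c a' Q c' where xy: "x = dp e a * pev P * dp f c" "y = dp e a' * pev Q * dp f c'"
    and P: "intval P" "intval Q" and deg: "a + degree P + c \<le> n" "a' + degree Q + c' \<le> m"
    unfolding kgens_def by blast
  let ?t = "\<lambda>a P c a' Q c' j. if j \<le> a' then dp e (a + (a' - j)) * pev (kterm a P c a' Q c' j) * dp f (c - j + c') else 0"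
  have low: "(\<Sum>j\<in>{1..c}. ?t a P c a' Q c' j) \<in> zspan (kgens (n + m - 1))"
    if "intval P" "intval Q" "a + degree P + c + (a' + degree Q + c') \<le> n + m" for a P c a' Q c'
  proof (rule zspan_sum)
    fix j assume "j \<in> {1..c}"
    then show "?t a P c a' Q c' j \<in> zspan (kgens (n + m - 1))"
      using that degree_kterm[of a P c a' Q c' j]
      by (auto intro!: zspan.zero zspan.base kgensI intval_kterm)
  qed
  have split: "(\<Sum>j\<le>c. g j) = g 0 + (\<Sum>j\<in>{1..c}. g j)" for g :: "nat \<Rightarrow> 'a" and c
    by (simp add: atMost_atLeast0 sum.atLeast_Suc_atMost)
  let ?C = "int (((a + a') choose a) * ((c + c') choose c))"
  let ?PQ = "pcompose P [:2 * of_nat a', 1:] * pcompose Q [:2 * of_nat c, 1:]"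
  let ?QP = "pcompose Q [:2 * of_nat a, 1:] * pcompose P [:2 * of_nat c', 1:]"
  have K0: "kostant_poly k l 0 = 1" for k l by (simp add: kostant_poly_def pbin_def)
  have "(a + a') choose a = (a' + a) choose a'" "(c + c') choose c = (c' + c) choose c'"
    using binomial_symmetric[of a "a + a'"] binomial_symmetric[of c "c + c'"] by (simp_all add: add.commute)
  then have top: "?t a P c a' Q c' 0 - ?t a' Q c' a P c 0 =
      dp e (a + a') * pev (smult (of_int ?C) (?PQ - ?QP)) * dp f (c + c')"
    by (simp add: kterm_def K0 add.commute smult_diff_right pev_diff algebra_simps)
  have "dp e (a + a') * pev (smult (of_int ?C) (?PQ - ?QP)) * dp f (c + c') \<in> zspan (kgens (n + m - 1))"
  proof (cases "?PQ - ?QP = 0")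
    case True
    then show ?thesis by (simp add: zspan.zero)
  next
    case False
    \<comment> \<open>Here \<open>degree P + degree Q\<close> is positive, hence so is
      \<open>n + m\<close>, and the truncated \<open>n + m - 1\<close> is a genuine
      predecessor.\<close>
    then have "degree (?PQ - ?QP) < degree P + degree Q"
      using degree_shift_commutator by blast
    then have "a + a' + degree (smult (of_int ?C) (?PQ - ?QP)) + (c + c') \<le> n + m - 1"
      using deg degree_smult_le[of "of_int ?C" "?PQ - ?QP"] by linarith
    then show ?thesis
      by (intro zspan.base kgensI intval_smult intval_diff intval_mult intval_shift P)
  qed
  moreover have "x * y - y * x = (?t a P c a' Q c' 0 - ?t a' Q c' a P c 0)
      + ((\<Sum>j\<in>{1..c}. ?t a P c a' Q c' j) - (\<Sum>j\<in>{1..c'}. ?t a' Q c' a P c j))"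
    unfolding xy kgen_mult split by (simp only: algebra_simps)
  moreover have "(\<Sum>j\<in>{1..c}. ?t a P c a' Q c' j) - (\<Sum>j\<in>{1..c'}. ?t a' Q c' a P c j)
      \<in> zspan (kgens (n + m - 1))"
    by (intro zspan_diff low P) (use deg in linarith)+
  ultimately show ?thesis
    unfolding top by (simp only: zspan.add)
qed

definition kspan :: "nat \<Rightarrow> 'a set" where
  "kspan n = zspan (kgens n)"

lemma kspan_mult: "x \<in> kspan n \<Longrightarrow> y \<in> kspan m \<Longrightarrow> x * y \<in> kspan (n + m)"
  unfolding kspan_def
  by (rule zspan_biadditive[OF distrib_right distrib_left kgens_mult])

lemma kspan_commutator: "x \<in> kspan n \<Longrightarrow> y \<in> kspan m \<Longrightarrow> x * y - y * x \<in> kspan (n + m - 1)"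
  unfolding kspan_def
  by (rule zspan_biadditive[OF _ _ kgens_commutator]) (simp_all only: distrib_left distrib_right add_diff_add)

lemma kspan_mono: "n \<le> m \<Longrightarrow> x \<in> kspan n \<Longrightarrow> x \<in> kspan m"
  unfolding kspan_def kgens_def
  by (erule zspan_subset[rotated]) (force intro!: zspan.base)

definition kbasis :: "nat \<Rightarrow> 'a set" where
  "kbasis n = {dp e a * pev (pbin b) * dp f c | a b c. a + b + c \<le> n}"

lemma sc_int_zspan: "x \<in> zspan S \<Longrightarrow> sc (of_int k) * x \<in> zspan S"
proof -
  assume x: "x \<in> zspan S"
  have nat: "sc (of_nat n) * x \<in> zspan S" for n
    by (induction n) (auto simp: sc_zero sc_add sc_one distrib_right intro: zspan.zero zspan.add x)
  show ?thesis
    by (cases k rule: int_cases2) (use nat zspan.uminus[OF nat] in \<open>auto simp: sc_minus\<close>)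
qed

lemma pev_sum: "pev (sum P A) = (\<Sum>i\<in>A. pev (P i))"
  by (induction A rule: infinite_finite_induct) (auto simp: pev_add)

text \<open>Newton's expansion of the middle factor has integer coefficients and stops at the
  degree, so passing to binomials does not raise the order.\<close>

lemma kspan_eq: "kspan n = zspan (kbasis n)"
proof (intro equalityI subsetI)
  fix x assume "x \<in> zspan (kbasis n)"
  then show "x \<in> kspan n"
    unfolding kspan_def
  proof (rule zspan_subset[rotated])
    fix y assume "y \<in> kbasis n"
    then show "y \<in> zspan (kgens n)"
      unfolding kbasis_def by (auto intro!: zspan.base kgensI intval_pbin simp: degree_pbin)
  qed
next
  fix x assume "x \<in> kspan n"
  then show "x \<in> zspan (kbasis n)"
    unfolding kspan_def
  proof (rule zspan_subset[rotated])
    fix y assume "y \<in> kgens n"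
    then obtain a P c where y: "y = dp e a * pev P * dp f c" and P: "intval P" and deg: "a + degree P + c \<le> n"
      unfolding kgens_def by blast
    obtain z :: "nat \<Rightarrow> int" where z: "P = (\<Sum>k\<le>degree P. smult (of_int (z k)) (pbin k))"
      using newton_expansion[OF P] .
    have "y = dp e a * pev (\<Sum>k\<le>degree P. smult (of_int (z k)) (pbin k)) * dp f c"
      unfolding y using z by simp
    also have "\<dots> = (\<Sum>k\<le>degree P. sc (of_int (z k)) * (dp e a * pev (pbin k) * dp f c))"
      by (simp only: pev_sum pev_smult sum_distrib_left sum_distrib_right sc_left_commute[of "dp e k" for k] mult.assoc)
    also have "\<dots> \<in> zspan (kbasis n)"
    proof (rule zspan_sum, rule sc_int_zspan, rule zspan.base)
      fix k assume "k \<in> {..degree P}"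
      then have "a + k + c \<le> n" using deg by simp
      then show "dp e a * pev (pbin k) * dp f c \<in> kbasis n"
        unfolding kbasis_def by blast
    qed
    finally show "y \<in> zspan (kbasis n)" .
  qed
qed

end

section \<open>The enveloping algebra\<close>

lemma free_scalar_hom:
  "free_scalar (a + b) = free_scalar a + free_scalar b"
  "free_scalar (a * b) = free_scalar a * free_scalar b"
  "free_scalar 1 = 1"
  "free_scalar c * \<xi> = \<xi> * free_scalar c"
proof -
  show "free_scalar c * \<xi> = \<xi> * free_scalar c"
    by (induction \<xi> rule: poly_mapping_single_induct)
      (auto simp: free_scalar_def mult_single distrib_left distrib_right mult.commute)
qed (auto simp: free_scalar_def single_add mult_single)

lemma linear_carrier_sl2: "linear_carrier sl2"
proof
  fix v w :: mat2 assume "v \<in> carrier sl2" "w \<in> carrier sl2"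
  then show "v \<oplus>\<^bsub>sl2\<^esub> w \<in> carrier sl2"
    by (simp add: sl2_def trace_def sum.distrib)
next
  fix v :: mat2 and c assume "v \<in> carrier sl2"
  then show "c \<odot>\<^bsub>sl2\<^esub> v \<in> carrier sl2"
    by (simp add: sl2_def trace_def flip: sum_distrib_left)
qed

lemma sl2_commutator_closed: "x ** y - y ** x \<in> carrier sl2"
  by (simp add: sl2_def trace_sub trace_mul_sym[of x y])

lemma sl2_carriers: "sl2_E \<in> carrier sl2" "sl2_F \<in> carrier sl2" "sl2_H \<in> carrier sl2"
  by (simp_all add: sl2_def trace_def sum_2 sl2_E_def sl2_F_def sl2_H_def)

lemma sl2_brackets:
  "sl2_E ** sl2_F - sl2_F ** sl2_E = sl2_H"
  "sl2_H ** sl2_E - sl2_E ** sl2_H = 2 \<odot>\<^bsub>sl2\<^esub> sl2_E"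
  "sl2_F ** sl2_H - sl2_H ** sl2_F = 2 \<odot>\<^bsub>sl2\<^esub> sl2_F"
  by (simp_all add: vec_eq_iff forall_2 matrix_matrix_mult_def sum_2 sl2_E_def sl2_F_def sl2_H_def sl2_def)

interpretation sl2: linear_carrier sl2
  by (rule linear_carrier_sl2)

lemma uea_rels_carrier: "uea_rels \<subseteq> carrier (tensor_algebra sl2)"
proof -
  interpret T: ring "tensor_algebra sl2" by (rule sl2.ring_tensor_algebra)
  show ?thesis
    unfolding uea_rels_def Let_def
    by (auto intro!: T.minus_closed T.m_closed sl2.tensor_closed sl2_commutator_closed)
qed

lemma ring_uea: "ring uea_ring"
  unfolding uea_ring_def by (rule ring_ring_pres[OF sl2.ring_tensor_algebra uea_rels_carrier])

definition uea_proj :: "(mat2, rat) free_alg \<Rightarrow> uea" where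
  "uea_proj \<xi> = ring_pres_class (tensor_algebra sl2) uea_rels (tensor_class sl2 \<xi>)"

lemma uea_proj_hom: "uea_proj \<in> Ring.ring_hom (free_algebra (carrier sl2)) uea_ring"
  unfolding uea_proj_def[abs_def] uea_ring_def
  using ring_hom_trans[OF sl2.tensor_class_hom ring_pres_class_hom[OF sl2.ring_tensor_algebra uea_rels_carrier]]
  by (simp add: comp_def)

lemma carrier_uea: "carrier uea_ring = uea_proj ` carrier (free_algebra (carrier sl2))"
  unfolding uea_ring_def carrier_ring_pres[OF sl2.ring_tensor_algebra uea_rels_carrier]
    sl2.carrier_tensor_algebra uea_proj_def by auto

lemma uea_gen_proj: "uea_gen x = uea_proj (free_letter x)"
  by (simp add: uea_gen_def uea_proj_def tensor_gen_def)

lemma uea_scalar_proj: "uea_scalar c = uea_proj (free_scalar c)"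
  by (simp add: uea_scalar_def uea_proj_def tensor_scalar_def)

text \<open>As a type of class \<open>ring\<close> with unit, the enveloping algebra becomes an
  instance of \<open>sl2_triple\<close>, and the computations above apply to it.\<close>

typedef uea_alg = "carrier uea_ring"
proof -
  interpret ring uea_ring by (rule ring_uea)
  show ?thesis using zero_closed by blast
qed

setup_lifting type_definition_uea_alg

instantiation uea_alg :: "{ring, monoid_mult}"
begin

interpretation U: ring uea_ring by (rule ring_uea)

lift_definition zero_uea_alg :: uea_alg is "\<zero>\<^bsub>uea_ring\<^esub>" by simp
lift_definition one_uea_alg :: uea_alg is "\<one>\<^bsub>uea_ring\<^esub>" by simp
lift_definition plus_uea_alg :: "uea_alg \<Rightarrow> uea_alg \<Rightarrow> uea_alg" is "add uea_ring" by simp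
lift_definition minus_uea_alg :: "uea_alg \<Rightarrow> uea_alg \<Rightarrow> uea_alg" is "a_minus uea_ring" by simp
lift_definition uminus_uea_alg :: "uea_alg \<Rightarrow> uea_alg" is "a_inv uea_ring" by simp
lift_definition times_uea_alg :: "uea_alg \<Rightarrow> uea_alg \<Rightarrow> uea_alg" is "mult uea_ring" by simp

instance
proof
  fix a b c :: uea_alg
  show "a + b + c = a + (b + c)" by transfer (rule U.a_assoc)
  show "a + b = b + a" by transfer (rule U.a_comm)
  show "0 + a = a" by transfer (rule U.l_zero)
  show "- a + a = 0" by transfer (rule U.l_neg)
  show "a - b = a + - b" by transfer (simp add: a_minus_def)
  show "a * b * c = a * (b * c)" by transfer (rule U.m_assoc)
  show "1 * a = a" by transfer (rule U.l_one)
  show "a * 1 = a" by transfer (rule U.r_one)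
  show "(a + b) * c = a * c + b * c" by transfer (rule U.l_distr)
  show "a * (b + c) = a * b + a * c" by transfer (rule U.r_distr)
qed

end

lift_definition uea_scal :: "rat \<Rightarrow> uea_alg" is uea_scalar
  by (auto simp: uea_scalar_proj carrier_uea free_alg_closed)

definition uea_of :: "mat2 \<Rightarrow> uea_alg" where
  "uea_of x = Abs_uea_alg (uea_gen x)"

lemma uea_gen_closed: "x \<in> carrier sl2 \<Longrightarrow> uea_gen x \<in> carrier uea_ring"
  by (auto simp: uea_gen_proj carrier_uea free_alg_closed)

lemma Rep_uea_of: "x \<in> carrier sl2 \<Longrightarrow> Rep_uea_alg (uea_of x) = uea_gen x"
  by (simp add: uea_of_def Abs_uea_alg_inverse uea_gen_closed)

lemma uea_proj_linear:
  assumes "v \<in> carrier sl2"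
  shows "uea_gen (c \<odot>\<^bsub>sl2\<^esub> v) = uea_scalar c \<otimes>\<^bsub>uea_ring\<^esub> uea_gen v"
proof -
  interpret F: ring "free_algebra (carrier sl2) :: (mat2, rat) free_alg ring" by (rule ring_free_algebra)
  interpret T: ring "tensor_algebra sl2" by (rule sl2.ring_tensor_algebra)
  interpret U: ring uea_ring by (rule ring_uea)
  let ?l = "free_letter (c \<odot>\<^bsub>sl2\<^esub> v) :: (mat2, rat) free_alg" and ?r = "free_scalar c * free_letter v"
  have mem: "?l \<in> carrier (free_algebra (carrier sl2))" "?r \<in> carrier (free_algebra (carrier sl2))"
    using assms by (auto intro!: free_alg_closed sl2.smult_closed)
  have "?l - ?r \<in> linearity_rels sl2"
    using assms by (auto simp: linearity_rels_def)
  then have "tensor_class sl2 (?l - ?r) = \<zero>\<^bsub>tensor_algebra sl2\<^esub>"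
    by (rule sl2.tensor_class_zero)
  then have "uea_proj (?l - ?r) = uea_proj 0"
    using ring_hom_zero[OF sl2.tensor_class_hom ring_free_algebra sl2.ring_tensor_algebra]
    by (simp add: uea_proj_def)
  then have "uea_proj ?l = uea_proj 0 \<oplus>\<^bsub>uea_ring\<^esub> uea_proj ?r"
    using ring_hom_add[OF uea_proj_hom free_alg_closed_diff[OF mem] mem(2)] by simp
  also have "\<dots> = uea_proj ?r"
    using ring_hom_add[OF uea_proj_hom free_alg_closed(1) mem(2)] by simp
  finally have "uea_proj ?l = uea_proj ?r" .
  then show ?thesis
    using ring_hom_mult[OF uea_proj_hom, of "free_scalar c" "free_letter v"] assms
    by (simp add: uea_gen_proj uea_scalar_proj free_alg_closed)
qed

lemma uea_bracket:
  assumes "x \<in> carrier sl2" "y \<in> carrier sl2"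
  shows "uea_gen x \<otimes>\<^bsub>uea_ring\<^esub> uea_gen y \<ominus>\<^bsub>uea_ring\<^esub> uea_gen y \<otimes>\<^bsub>uea_ring\<^esub> uea_gen x = uea_gen (x ** y - y ** x)"
proof -
  interpret T: ring "tensor_algebra sl2" by (rule sl2.ring_tensor_algebra)
  interpret U: ring uea_ring by (rule ring_uea)
  note hom = ring_pres_class_hom[OF sl2.ring_tensor_algebra uea_rels_carrier, folded uea_ring_def]
  let ?\<pi> = "ring_pres_class (tensor_algebra sl2) uea_rels" and ?g = "tensor_gen sl2"
  have c: "?g x \<in> carrier (tensor_algebra sl2)" "?g y \<in> carrier (tensor_algebra sl2)"
    "?g (x ** y - y ** x) \<in> carrier (tensor_algebra sl2)"
    using assms by (auto intro!: sl2.tensor_closed sl2_commutator_closed)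
  have "?g x \<otimes>\<^bsub>tensor_algebra sl2\<^esub> ?g y \<ominus>\<^bsub>tensor_algebra sl2\<^esub> ?g y \<otimes>\<^bsub>tensor_algebra sl2\<^esub> ?g x
      \<ominus>\<^bsub>tensor_algebra sl2\<^esub> ?g (x ** y - y ** x) \<in> uea_rels"
    using assms unfolding uea_rels_def Let_def by blast
  from ring_pres_class_zero[OF sl2.ring_tensor_algebra uea_rels_carrier this]
  have "(?\<pi> (?g x) \<otimes>\<^bsub>uea_ring\<^esub> ?\<pi> (?g y) \<ominus>\<^bsub>uea_ring\<^esub> ?\<pi> (?g y) \<otimes>\<^bsub>uea_ring\<^esub> ?\<pi> (?g x))
      \<ominus>\<^bsub>uea_ring\<^esub> ?\<pi> (?g (x ** y - y ** x)) = \<zero>\<^bsub>uea_ring\<^esub>"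
    using c by (simp add: ring_hom_a_minus[OF T.ring_axioms U.ring_axioms hom] ring_hom_mult[OF hom] flip: uea_ring_def)
  then show ?thesis
    using c ring_hom_closed[OF hom] by (simp add: uea_gen_def)
qed

lemma uea_scalar_hom:
  "uea_scalar (a + b) = uea_scalar a \<oplus>\<^bsub>uea_ring\<^esub> uea_scalar b"
  "uea_scalar (a * b) = uea_scalar a \<otimes>\<^bsub>uea_ring\<^esub> uea_scalar b"
  "uea_scalar 1 = \<one>\<^bsub>uea_ring\<^esub>"
  "x \<in> carrier uea_ring \<Longrightarrow> x \<otimes>\<^bsub>uea_ring\<^esub> uea_scalar c = uea_scalar c \<otimes>\<^bsub>uea_ring\<^esub> x"
proof -
  note hom = ring_hom_add[OF uea_proj_hom] ring_hom_mult[OF uea_proj_hom] ring_hom_one[OF uea_proj_hom]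
  show "uea_scalar (a + b) = uea_scalar a \<oplus>\<^bsub>uea_ring\<^esub> uea_scalar b"
    "uea_scalar (a * b) = uea_scalar a \<otimes>\<^bsub>uea_ring\<^esub> uea_scalar b"
    "uea_scalar 1 = \<one>\<^bsub>uea_ring\<^esub>"
    using hom(1)[of "free_scalar a" "free_scalar b"] hom(2)[of "free_scalar a" "free_scalar b"] hom(3)
    by (simp_all add: uea_scalar_proj free_scalar_hom(1,2,3) free_alg_closed)
  assume "x \<in> carrier uea_ring"
  then obtain \<xi> where "\<xi> \<in> carrier (free_algebra (carrier sl2))" "x = uea_proj \<xi>"
    unfolding carrier_uea by blast
  then show "x \<otimes>\<^bsub>uea_ring\<^esub> uea_scalar c = uea_scalar c \<otimes>\<^bsub>uea_ring\<^esub> x"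
    using hom(2)[of \<xi> "free_scalar c"] hom(2)[of "free_scalar c" \<xi>]
    by (simp add: uea_scalar_proj free_scalar_hom(4) free_alg_closed)
qed

global_interpretation uea: sl2_triple uea_scal "uea_of sl2_E" "uea_of sl2_F" "uea_of sl2_H"
  defines uea_dp = uea.dp and uea_pev = uea.pev and uea_kspan = uea.kspan and uea_kbasis = uea.kbasis
proof -
  interpret U: ring uea_ring by (rule ring_uea)
  have br: "uea_of x * uea_of y - uea_of y * uea_of x = uea_of (x ** y - y ** x)"
    if "x \<in> carrier sl2" "y \<in> carrier sl2" for x y
    using uea_bracket[OF that] that
    by (simp add: minus_uea_alg.rep_eq times_uea_alg.rep_eq Rep_uea_of sl2_commutator_closed flip: Rep_uea_alg_inject)
  have lin: "uea_of (c \<odot>\<^bsub>sl2\<^esub> x) = uea_scal c * uea_of x" if "x \<in> carrier sl2" for c x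
    using uea_proj_linear[OF that, of c] that
    by (simp add: times_uea_alg.rep_eq Rep_uea_of sl2.smult_closed uea_scal.rep_eq flip: Rep_uea_alg_inject)
  have cent: "x * uea_scal a = uea_scal a * x" for x a
    by transfer (rule uea_scalar_hom(4))
  show "sl2_triple uea_scal (uea_of sl2_E) (uea_of sl2_F) (uea_of sl2_H)"
  proof
    fix a b x
    show "uea_scal (a + b) = uea_scal a + uea_scal b" by transfer (rule uea_scalar_hom)
    show "uea_scal (a * b) = uea_scal a * uea_scal b" by transfer (rule uea_scalar_hom)
    show "uea_scal 1 = 1" by transfer (rule uea_scalar_hom)
    show "x * uea_scal a = uea_scal a * x" by (rule cent)
    show "uea_of sl2_F * uea_of sl2_E = uea_of sl2_E * uea_of sl2_F - uea_of sl2_H"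
      using br[OF sl2_carriers(1,2)] by (simp add: sl2_brackets algebra_simps)
    show "uea_of sl2_H * uea_of sl2_E = uea_of sl2_E * (uea_of sl2_H + uea_scal 2)"
      using br[OF sl2_carriers(3,1)] lin[OF sl2_carriers(1), of 2]
      by (simp add: sl2_brackets algebra_simps cent[of "uea_of sl2_E"])
    show "uea_of sl2_F * uea_of sl2_H = (uea_of sl2_H + uea_scal 2) * uea_of sl2_F"
      using br[OF sl2_carriers(2,3)] lin[OF sl2_carriers(2), of 2]
      by (simp add: sl2_brackets algebra_simps)
  qed
qed

lemma Rep_uea_power: "Rep_uea_alg (x ^ n) = Rep_uea_alg x [^]\<^bsub>uea_ring\<^esub> n"
proof -
  interpret U: ring uea_ring by (rule ring_uea)
  show ?thesis
    by (induction n) (simp_all add: one_uea_alg.rep_eq times_uea_alg.rep_eq power_Suc2 del: power_Suc)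
qed

lemma Rep_uea_dp: "x \<in> carrier sl2 \<Longrightarrow> Rep_uea_alg (uea_dp (uea_of x) n) = uea_divpow x n"
  by (simp add: uea.dp_def uea_divpow_def times_uea_alg.rep_eq uea_scal.rep_eq Rep_uea_power Rep_uea_of)

lemma Rep_uea_binom: "Rep_uea_alg (uea_pev (pbin n)) = uea_binom sl2_H n"
proof -
  interpret U: ring uea_ring by (rule ring_uea)
  have "uea_pev [:- of_nat n, 1:] = uea_of sl2_H - uea_scal (of_nat n)" for n
    by (simp add: uea.sc_minus uea.sc_one uea.sc_zero)
  then have "Rep_uea_alg (uea_pev (pfall n)) = uea_falling sl2_H n" for n
    by (induction n) (simp_all add: one_uea_alg.rep_eq times_uea_alg.rep_eq minus_uea_alg.rep_eq
      Rep_uea_of sl2_carriers uea_scal.rep_eq uea.pev_mult del: uea.pev_pCons mult_pCons_right)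
  then show ?thesis
    by (simp add: pbin_def uea.pev_smult uea_binom_def times_uea_alg.rep_eq uea_scal.rep_eq)
qed

section \<open>Distributions\<close>

lemma kostant_gens_carrier:
  "range (uea_divpow sl2_E) \<union> range (uea_binom sl2_H) \<union> range (uea_divpow sl2_F) \<subseteq> carrier uea_ring"
  using Rep_uea_alg by (auto simp: sl2_carriers simp flip: Rep_uea_dp Rep_uea_binom)

lemma kostant_ring_simps [simp]:
  "mult kostant_ring = mult uea_ring" "add kostant_ring = add uea_ring"
  "one kostant_ring = one uea_ring" "zero kostant_ring = zero uea_ring"
  by (simp_all add: kostant_ring_def)

lemma ring_kostant: "ring kostant_ring"
  unfolding kostant_ring_def by (rule ring.generate_ring_is_ring[OF ring_uea kostant_gens_carrier])

lemma kostant_subset_uea: "carrier kostant_ring \<subseteq> carrier uea_ring"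
  unfolding kostant_ring_def using ring.generate_ring_incl[OF ring_uea kostant_gens_carrier] by simp

lemma kostant_gens:
  "Rep_uea_alg (uea_dp (uea_of sl2_E) n) \<in> carrier kostant_ring"
  "Rep_uea_alg (uea_dp (uea_of sl2_F) n) \<in> carrier kostant_ring"
  "Rep_uea_alg (uea_pev (pbin n)) \<in> carrier kostant_ring"
  by (auto simp: kostant_ring_def Rep_uea_dp Rep_uea_binom sl2_carriers intro: generate_ring.incl)

lemma kostant_closed:
  assumes "Rep_uea_alg x \<in> carrier kostant_ring" "Rep_uea_alg y \<in> carrier kostant_ring"
  shows "Rep_uea_alg (x + y) \<in> carrier kostant_ring" "Rep_uea_alg (x * y) \<in> carrier kostant_ring"
    "Rep_uea_alg (- x) \<in> carrier kostant_ring"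
proof -
  interpret K: ring kostant_ring by (rule ring_kostant)
  show "Rep_uea_alg (x + y) \<in> carrier kostant_ring" "Rep_uea_alg (x * y) \<in> carrier kostant_ring"
    using K.a_closed[OF assms] K.m_closed[OF assms] by (simp_all add: plus_uea_alg.rep_eq times_uea_alg.rep_eq)
  show "Rep_uea_alg (- x) \<in> carrier kostant_ring"
    using assms(1) by (simp add: kostant_ring_def uminus_uea_alg.rep_eq generate_ring.a_inv)
qed

lemma kostant_zero: "Rep_uea_alg 0 \<in> carrier kostant_ring"
  using ring.ring_simprules(2)[OF ring_kostant] by (simp add: zero_uea_alg.rep_eq)

lemma kspan_kostant: "x \<in> uea_kspan n \<Longrightarrow> Rep_uea_alg x \<in> carrier kostant_ring"
  unfolding uea.kspan_eq
  by (induction rule: zspan.induct)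
    (auto simp: uea.kbasis_def intro!: kostant_closed kostant_zero kostant_gens)

context
  fixes p :: nat
begin

interpretation K: ring kostant_ring by (rule ring_kostant)

lemma dist_rel_carrier: "{[p] \<cdot>\<^bsub>kostant_ring\<^esub> \<one>\<^bsub>kostant_ring\<^esub>} \<subseteq> carrier kostant_ring"
  using K.add.nat_pow_closed[OF K.one_closed, of p] by simp

lemma ring_dist_ring: "ring (dist_ring p)"
  unfolding dist_ring_def by (rule ring_ring_pres[OF ring_kostant dist_rel_carrier])

lemma dist_class_hom: "dist_class p \<in> Ring.ring_hom kostant_ring (dist_ring p)"
  unfolding dist_ring_def dist_class_def by (rule ring_pres_class_hom[OF ring_kostant dist_rel_carrier])

text \<open>Reduction modulo p of an element of the Kostant form; only for such elements are its
  algebraic rules available, hence the recurring membership assumptions.\<close>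

definition dist_of :: "uea_alg \<Rightarrow> dist" where
  "dist_of x = dist_class p (Rep_uea_alg x)"

lemma dist_of_hom:
  assumes "Rep_uea_alg x \<in> carrier kostant_ring" "Rep_uea_alg y \<in> carrier kostant_ring"
  shows "dist_of x \<in> carrier (dist_ring p)"
    "dist_of (x + y) = dist_of x \<oplus>\<^bsub>dist_ring p\<^esub> dist_of y"
    "dist_of (x * y) = dist_of x \<otimes>\<^bsub>dist_ring p\<^esub> dist_of y"
    "dist_of (x - y) = dist_of x \<ominus>\<^bsub>dist_ring p\<^esub> dist_of y"
    "dist_of 1 = \<one>\<^bsub>dist_ring p\<^esub>" "dist_of 0 = \<zero>\<^bsub>dist_ring p\<^esub>"
    "dist_of (- x) = \<ominus>\<^bsub>dist_ring p\<^esub> dist_of x"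
proof -
  interpret D: ring "dist_ring p" by (rule ring_dist_ring)
  note hom = dist_class_hom
  have add: "dist_of (x + y) = dist_of x \<oplus>\<^bsub>dist_ring p\<^esub> dist_of y"
    if "Rep_uea_alg x \<in> carrier kostant_ring" "Rep_uea_alg y \<in> carrier kostant_ring" for x y
    using ring_hom_add[OF hom that] by (simp add: dist_of_def plus_uea_alg.rep_eq)
  have closed: "dist_of x \<in> carrier (dist_ring p)" if "Rep_uea_alg x \<in> carrier kostant_ring" for x
    using ring_hom_closed[OF hom that] by (simp add: dist_of_def)
  show "dist_of x \<in> carrier (dist_ring p)" by (rule closed[OF assms(1)])
  show "dist_of (x + y) = dist_of x \<oplus>\<^bsub>dist_ring p\<^esub> dist_of y" by (rule add[OF assms])
  show "dist_of (x * y) = dist_of x \<otimes>\<^bsub>dist_ring p\<^esub> dist_of y"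
    using ring_hom_mult[OF hom assms] by (simp add: dist_of_def times_uea_alg.rep_eq)
  show "dist_of 1 = \<one>\<^bsub>dist_ring p\<^esub>"
    using ring_hom_one[OF hom] by (simp add: dist_of_def one_uea_alg.rep_eq)
  show zero: "dist_of 0 = \<zero>\<^bsub>dist_ring p\<^esub>"
    using ring_hom_zero[OF hom ring_kostant ring_dist_ring] by (simp add: dist_of_def zero_uea_alg.rep_eq)
  have minus: "dist_of (- x) = \<ominus>\<^bsub>dist_ring p\<^esub> dist_of x" if "Rep_uea_alg x \<in> carrier kostant_ring" for x
    using add[OF kostant_closed(3)[OF that that] that] closed[OF that] closed[OF kostant_closed(3)[OF that that]]
    by (simp add: zero D.minus_equality)
  show "dist_of (- x) = \<ominus>\<^bsub>dist_ring p\<^esub> dist_of x" by (rule minus[OF assms(1)])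
  show "dist_of (x - y) = dist_of x \<ominus>\<^bsub>dist_ring p\<^esub> dist_of y"
    using add[OF assms(1) kostant_closed(3)[OF assms(2,2)]] minus[OF assms(2)] by (simp add: a_minus_def)
qed

lemma dist_basis_eq:
  "dist_basis p a b c = dist_of (uea_dp (uea_of sl2_E) a * uea_pev (pbin b) * uea_dp (uea_of sl2_F) c)"
  by (simp add: dist_basis_def dist_of_def times_uea_alg.rep_eq Rep_uea_dp Rep_uea_binom sl2_carriers)

end

lemma dist_algebra_simps [simp]:
  fixes A :: "('p::prime_card mod_ring, dist) module"
  defines "A \<equiv> dist_algebra"
  shows "carrier A = carrier (dist_ring CARD('p))" "mult A = mult (dist_ring CARD('p))"
    "add A = add (dist_ring CARD('p))" "one A = one (dist_ring CARD('p))" "zero A = zero (dist_ring CARD('p))"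
    "c \<odot>\<^bsub>A\<^esub> \<mu> = [to_int_mod_ring c] \<cdot>\<^bsub>dist_ring CARD('p)\<^esub> \<mu>"
  by (simp_all add: A_def dist_algebra_def Let_def)

lemma dist_algebra_derived [simp]:
  fixes A :: "('p::prime_card mod_ring, dist) module"
  defines "A \<equiv> dist_algebra"
  shows "a_inv A = a_inv (dist_ring CARD('p))" "a_minus A = a_minus (dist_ring CARD('p))"
    "add_pow A (k :: int) \<mu> = add_pow (dist_ring CARD('p)) k \<mu>"
proof -
  show inv: "a_inv A = a_inv (dist_ring CARD('p))"
    by (simp add: fun_eq_iff a_inv_def m_inv_def A_def)
  then show "a_minus A = a_minus (dist_ring CARD('p))"
    by (simp add: fun_eq_iff a_minus_def A_def)
  show "add_pow A (k :: int) \<mu> = add_pow (dist_ring CARD('p)) k \<mu>"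
    by (simp add: add_pow_def int_pow_def nat_pow_def m_inv_def A_def Let_def)
qed

lemma ring_dist_algebra: "ring (dist_algebra :: ('p::prime_card mod_ring, dist) module)"
proof -
  interpret D: ring "dist_ring CARD('p)" by (rule ring_dist_ring)
  show ?thesis
  proof (rule ringI)
    show "abelian_group (dist_algebra :: ('p mod_ring, dist) module)"
      by (rule abelian_groupI) (auto simp: D.a_ac intro: D.l_neg)
    show "monoid (dist_algebra :: ('p mod_ring, dist) module)"
      by (rule monoidI) (auto simp: D.m_assoc)
  qed (auto simp: D.l_distr D.r_distr)
qed

text \<open>Scalars of the prime field act as integer multiples, so the image of an additive group
  is a submodule, and the linear span of the basis elements is the image of their integral span.
  Bounds on orders can thus be proved before reduction.\<close>

lemma dist_order_eq:
  "dist_order TYPE('p::prime_card) n = dist_of CARD('p) ` uea_kspan n"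
proof -
  let ?D = "dist_algebra :: ('p mod_ring, dist) module" and ?d = "dist_of CARD('p)"
  let ?B = "{dist_basis CARD('p) a b c | a b c. a + b + c \<le> n}"
  interpret D: ring "dist_ring CARD('p)" by (rule ring_dist_ring)
  interpret A: ring ?D by (rule ring_dist_algebra)
  have sub: "subgroup (?d ` uea_kspan n) (add_monoid ?D)"
  proof (rule group.subgroupI[OF A.a_group])
    show "?d ` uea_kspan n \<subseteq> carrier (add_monoid ?D)"
      by (auto intro: dist_of_hom(1) kspan_kostant)
    show "?d ` uea_kspan n \<noteq> {}"
      unfolding uea.kspan_def using zspan.zero by blast
    fix u assume "u \<in> ?d ` uea_kspan n"
    then obtain x where x: "x \<in> uea_kspan n" "u = ?d x" by blast
    have "inv\<^bsub>add_monoid ?D\<^esub> u = ?d (- x)"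
      using dist_of_hom(7)[OF kspan_kostant[OF x(1)] kspan_kostant[OF x(1)]] x(2)
      unfolding a_inv_def[symmetric] by simp
    moreover have "- x \<in> uea_kspan n"
      using x(1) unfolding uea.kspan_def by (rule zspan.uminus)
    ultimately show "inv\<^bsub>add_monoid ?D\<^esub> u \<in> ?d ` uea_kspan n" by blast
    fix v assume "v \<in> ?d ` uea_kspan n"
    then obtain y where y: "y \<in> uea_kspan n" "v = ?d y" by blast
    have "u \<otimes>\<^bsub>add_monoid ?D\<^esub> v = ?d (x + y)"
      using dist_of_hom(2)[OF kspan_kostant[OF x(1)] kspan_kostant[OF y(1)]] x(2) y(2) by simp
    moreover have "x + y \<in> uea_kspan n"
      using x(1) y(1) unfolding uea.kspan_def by (rule zspan.add)
    ultimately show "u \<otimes>\<^bsub>add_monoid ?D\<^esub> v \<in> ?d ` uea_kspan n" by blast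
  qed
  have subm: "submodule (?d ` uea_kspan n) (type_ring :: 'p mod_ring ring) ?D"
  proof (rule submodule.intro)
    show "subgroup (?d ` uea_kspan n) (add_monoid ?D)"
      by (rule sub)
    show "submodule_axioms (?d ` uea_kspan n) (type_ring :: 'p mod_ring ring) ?D"
    proof
      fix c :: "'p mod_ring" and u assume "u \<in> ?d ` uea_kspan n"
      then show "c \<odot>\<^bsub>?D\<^esub> u \<in> ?d ` uea_kspan n"
        using group.subgroup_int_pow_closed[OF A.a_group sub, of u "to_int_mod_ring c"]
        unfolding add_pow_def[symmetric] by simp
    qed
  qed
  have basis: "?B \<subseteq> ?d ` uea_kspan n"
    unfolding uea.kspan_eq uea.kbasis_def dist_basis_eq by (blast intro: zspan.base)
  show ?thesis
  proof (intro equalityI subsetI)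
    fix \<mu> assume "\<mu> \<in> dist_order TYPE('p) n"
    then show "\<mu> \<in> ?d ` uea_kspan n"
      unfolding dist_order_def using subm basis by blast
  next
    fix \<mu> assume "\<mu> \<in> ?d ` uea_kspan n"
    then obtain x where x: "x \<in> zspan (uea_kbasis n)" "\<mu> = ?d x"
      unfolding uea.kspan_eq by blast
    have "?d x \<in> N" if N: "submodule N (type_ring :: 'p mod_ring ring) ?D" "?B \<subseteq> N" for N
    proof -
      interpret N: subgroup N "add_monoid ?D"
        by (rule submodule.axioms(1)[OF N(1)])
      \<comment> \<open>Membership in the Kostant form is carried along because
        \<open>dist_of\<close> is known to be additive only there.\<close>
      have "Rep_uea_alg x \<in> carrier kostant_ring \<and> ?d x \<in> N"
        using x(1)
      proof (induction x rule: zspan.induct)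
        case zero
        then show ?case
          using N.one_closed dist_of_hom(6)[OF kostant_zero kostant_zero] kostant_zero by simp
      next
        case (base x)
        then have "x \<in> uea_kspan n" unfolding uea.kspan_eq by (rule zspan.base)
        moreover have "?d x \<in> ?B" using base unfolding uea.kbasis_def dist_basis_eq by blast
        ultimately show ?case using N(2) kspan_kostant by blast
      next
        case (add x y)
        then show ?case using N.m_closed dist_of_hom(2) kostant_closed(1) by simp
      next
        case (uminus x)
        then have k: "Rep_uea_alg x \<in> carrier kostant_ring" and "?d x \<in> N" by simp_all
        then show ?case
          using N.m_inv_closed[of "?d x"] dist_of_hom(7)[OF k k] kostant_closed(3)[OF k k]
          unfolding a_inv_def[symmetric] by simp
      qed
      then show ?thesis by blast
    qed
    then show "\<mu> \<in> dist_order TYPE('p) n"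
      unfolding dist_order_def x(2) by blast
  qed
qed

lemma dist_order_facts:
  fixes u v :: dist
  assumes u: "u \<in> dist_order TYPE('p::prime_card) n" and v: "v \<in> dist_order TYPE('p) m"
  shows "u \<in> carrier (dist_ring CARD('p))"
    "u \<otimes>\<^bsub>dist_ring CARD('p)\<^esub> v \<in> dist_order TYPE('p) (n + m)"
    "u \<otimes>\<^bsub>dist_ring CARD('p)\<^esub> v \<ominus>\<^bsub>dist_ring CARD('p)\<^esub> v \<otimes>\<^bsub>dist_ring CARD('p)\<^esub> u
      \<in> dist_order TYPE('p) (n + m - 1)"
proof -
  let ?d = "dist_of CARD('p)"
  obtain x y where x: "x \<in> uea_kspan n" "u = ?d x" and y: "y \<in> uea_kspan m" "v = ?d y"
    using u v unfolding dist_order_eq by blast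
  note xk = kspan_kostant[OF x(1)] and yk = kspan_kostant[OF y(1)]
  show "u \<in> carrier (dist_ring CARD('p))"
    unfolding x by (rule dist_of_hom(1)[OF xk xk])
  show "u \<otimes>\<^bsub>dist_ring CARD('p)\<^esub> v \<in> dist_order TYPE('p) (n + m)"
    unfolding x y dist_order_eq dist_of_hom(3)[OF xk yk, symmetric]
    by (rule imageI) (rule uea.kspan_mult[OF x(1) y(1)])
  have "u \<otimes>\<^bsub>dist_ring CARD('p)\<^esub> v \<ominus>\<^bsub>dist_ring CARD('p)\<^esub> v \<otimes>\<^bsub>dist_ring CARD('p)\<^esub> u = ?d (x * y - y * x)"
    unfolding x y using dist_of_hom(3)[OF xk yk] dist_of_hom(3)[OF yk xk]
      dist_of_hom(4)[OF kostant_closed(2)[OF xk yk] kostant_closed(2)[OF yk xk]] by simp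
  then show "u \<otimes>\<^bsub>dist_ring CARD('p)\<^esub> v \<ominus>\<^bsub>dist_ring CARD('p)\<^esub> v \<otimes>\<^bsub>dist_ring CARD('p)\<^esub> u
      \<in> dist_order TYPE('p) (n + m - 1)"
    unfolding dist_order_eq using uea.kspan_commutator[OF x(1) y(1)] by blast
qed

lemma dist_order_mono: "n \<le> m \<Longrightarrow> u \<in> dist_order TYPE('p::prime_card) n \<Longrightarrow> u \<in> dist_order TYPE('p) m"
  unfolding dist_order_eq using uea.kspan_mono by blast

lemma dist_order_submodule:
  fixes u v :: dist
  assumes "u \<in> dist_order TYPE('p::prime_card) n" "v \<in> dist_order TYPE('p) n"
  shows "u \<oplus>\<^bsub>dist_ring CARD('p)\<^esub> v \<in> dist_order TYPE('p) n"
    "[to_int_mod_ring (c :: 'p mod_ring)] \<cdot>\<^bsub>dist_ring CARD('p)\<^esub> u \<in> dist_order TYPE('p) n"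
proof -
  let ?D = "dist_algebra :: ('p mod_ring, dist) module"
  have "u \<oplus>\<^bsub>?D\<^esub> v \<in> N" "c \<odot>\<^bsub>?D\<^esub> u \<in> N"
    if "submodule N (type_ring :: 'p mod_ring ring) ?D" "u \<in> N" "v \<in> N" for N
  proof -
    interpret N: submodule N "type_ring :: 'p mod_ring ring" ?D by (rule that)
    show "u \<oplus>\<^bsub>?D\<^esub> v \<in> N" using N.m_closed[OF that(2,3)] by simp
    show "c \<odot>\<^bsub>?D\<^esub> u \<in> N" using N.smult_closed[of c u] that(2) by simp
  qed
  with assms show "u \<oplus>\<^bsub>dist_ring CARD('p)\<^esub> v \<in> dist_order TYPE('p) n"
    "[to_int_mod_ring (c :: 'p mod_ring)] \<cdot>\<^bsub>dist_ring CARD('p)\<^esub> u \<in> dist_order TYPE('p) n"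
    unfolding dist_order_def by (auto simp del: dist_algebra_simps simp flip: dist_algebra_simps[where ?'p = 'p])
qed

lemma dist_order_basis:
  "a + b + c \<le> n \<Longrightarrow> dist_basis CARD('p) a b c \<in> dist_order TYPE('p::prime_card) n"
  unfolding dist_order_def by blast

lemma dist_basis_binom: "dist_basis p 0 b 0 = dist_class p (uea_binom sl2_H b)"
  by (simp add: dist_basis_eq dist_of_def uea.dp_0 Rep_uea_binom)

lemma dist_order_one: "\<one>\<^bsub>dist_ring CARD('p)\<^esub> \<in> dist_order TYPE('p::prime_card) n"
  using dist_order_basis[of 0 0 0 n, where ?'p = 'p] dist_of_hom(5)[OF kostant_zero kostant_zero, of "CARD('p)"]
  by (simp add: dist_basis_eq uea.dp_0 pbin_def uea.sc_one)

section \<open>Differential operators on the function field\<close>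

lemma k_linear_zero: "k_linear D \<Longrightarrow> D 0 = 0"
  unfolding k_linear_def by (metis add_cancel_right_right add_0)

lemma k_linear_diff: "k_linear D \<Longrightarrow> D (f - g) = D f - D g"
  unfolding k_linear_def by (metis add_diff_cancel_right' diff_add_cancel)

lemma k_linear_sum: "k_linear D \<Longrightarrow> D (sum f A) = (\<Sum>i\<in>A. D (f i))"
  by (induction A rule: infinite_finite_induct) (auto simp: k_linear_zero k_linear_def)

lemma order_le_k_linear: "order_le n D \<Longrightarrow> k_linear D"
  by (cases n) auto

lemma order_le_zero: "order_le n (\<lambda>_. 0)"
  by (induction n) (auto simp: k_linear_def)

lemma order_le_add: "order_le n D \<Longrightarrow> order_le n D' \<Longrightarrow> order_le n (\<lambda>g. D g + D' g)"
proof (induction n arbitrary: D D')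
  case 0
  then show ?case by (auto simp: k_linear_def algebra_simps)
next
  case (Suc n)
  have "order_le n (\<lambda>g. (D (f * g) - f * D g) + (D' (f * g) - f * D' g))" for f
    by (rule Suc.IH) (use Suc.prems in auto)
  moreover have "(\<lambda>g. (D (f * g) - f * D g) + (D' (f * g) - f * D' g))
      = (\<lambda>g. (D (f * g) + D' (f * g)) - f * (D g + D' g))" for f
    by (auto simp: algebra_simps)
  ultimately show ?case
    using Suc.prems by (auto simp: k_linear_def algebra_simps)
qed

lemma order_le_Suc: "order_le n D \<Longrightarrow> order_le (Suc n) D"
proof (induction n arbitrary: D)
  case 0
  then show ?case using order_le_zero[of 0] by auto
qed auto

lemma order_le_mono: "n \<le> m \<Longrightarrow> order_le n D \<Longrightarrow> order_le m D"
  by (induction rule: dec_induct) (auto intro: order_le_Suc simp del: order_le.simps)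

text \<open>The bracket with multiplication by \<open>f\<close> is a derivation:
  \<open>[D D', f] = D [D', f] + [D, f] D'\<close>. Both summands fall under the induction on
  \<open>m + n\<close>, or vanish when the operator inside the bracket has order 0.\<close>

lemma order_le_comp: "order_le m D \<Longrightarrow> order_le n D' \<Longrightarrow> order_le (m + n) (D \<circ> D')"
proof (induction "m + n" arbitrary: m n D D')
  case 0
  then show ?case by (auto simp: k_linear_def)
next
  case (Suc s)
  have lin: "k_linear D" "k_linear D'" using Suc.prems order_le_k_linear by blast+
  have "order_le s (\<lambda>g. (D \<circ> D') (f * g) - f * (D \<circ> D') g)" for f
  proof -
    have "order_le s (D \<circ> (\<lambda>g. D' (f * g) - f * D' g))"
    proof (cases n)
      case 0
      then have "D \<circ> (\<lambda>g. D' (f * g) - f * D' g) = (\<lambda>_. 0)"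
        using Suc.prems(2) k_linear_zero[OF lin(1)] by auto
      then show ?thesis by (simp only: order_le_zero)
    next
      case (Suc n')
      then show ?thesis
        using Suc.hyps(1)[of m n' D "\<lambda>g. D' (f * g) - f * D' g"] Suc.hyps(2) Suc.prems by auto
    qed
    moreover have "order_le s ((\<lambda>g. D (f * g) - f * D g) \<circ> D')"
    proof (cases m)
      case 0
      then have "(\<lambda>g. D (f * g) - f * D g) \<circ> D' = (\<lambda>_. 0)"
        using Suc.prems(1) by auto
      then show ?thesis by (simp only: order_le_zero)
    next
      case (Suc m')
      then show ?thesis
        using Suc.hyps(1)[of m' n "\<lambda>g. D (f * g) - f * D g" D'] Suc.hyps(2) Suc.prems by auto
    qed
    ultimately have "order_le s (\<lambda>g. (D \<circ> (\<lambda>g. D' (f * g) - f * D' g)) g + ((\<lambda>g. D (f * g) - f * D g) \<circ> D') g)"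
      by (rule order_le_add)
    moreover have "(\<lambda>g. (D \<circ> (\<lambda>g. D' (f * g) - f * D' g)) g + ((\<lambda>g. D (f * g) - f * D g) \<circ> D') g)
        = (\<lambda>g. (D \<circ> D') (f * g) - f * (D \<circ> D') g)"
      by (auto simp: k_linear_diff[OF lin(1)])
    ultimately show ?thesis by (simp only:)
  qed
  moreover have "k_linear (D \<circ> D')" using lin by (auto simp: k_linear_def)
  ultimately show ?case
    unfolding Suc.hyps(2)[symmetric] by simp
qed

lemma order_le_mult: "order_le 0 (\<lambda>g. c * g)"
  by (auto simp: k_linear_def algebra_simps)

lemma order_le_lmult: "order_le n D \<Longrightarrow> order_le n (\<lambda>g. c * D g)"
  using order_le_comp[OF order_le_mult, of n D c] by (simp add: comp_def)

lemma order_le_sum: "(\<And>i. i \<in> A \<Longrightarrow> order_le n (D i)) \<Longrightarrow> order_le n (\<lambda>g. \<Sum>i\<in>A. D i g)"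
  by (induction A rule: infinite_finite_induct) (auto intro: order_le_zero order_le_add simp del: order_le.simps)

lemma order_le_diff: "order_le n D \<Longrightarrow> order_le n D' \<Longrightarrow> order_le n (\<lambda>g. D g - D' g)"
  using order_le_add[OF _ order_le_lmult, of n D D' "-1"] by simp

lemma order_le_0_cases:
  assumes "order_le 0 D"
  obtains c where "D = (\<lambda>g. c * g)"
proof
  show "D = (\<lambda>g. D 1 * g)"
  proof
    fix g
    have "\<forall>f g. D (f * g) = f * D g" using assms by simp
    from this[rule_format, of g 1] show "D g = D 1 * g" by (simp add: mult.commute)
  qed
qed

text \<open>By Jacobi, \<open>[[D, D'], f] = [D, [D', f]] + [[D, f], D']\<close>, and induction on
  \<open>m + n\<close> applies when both orders are positive. If one operator has order 0, it is a
  multiplication, and the commutator is, up to sign, a bracket from the definition of the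
  order.\<close>

lemma order_le_commutator:
  "order_le m D \<Longrightarrow> order_le n D' \<Longrightarrow> order_le (m + n - 1) (\<lambda>g. D (D' g) - D' (D g))"
proof (induction "m + n" arbitrary: m n D D' rule: less_induct)
  case less
  have lin: "k_linear D" "k_linear D'" using less.prems order_le_k_linear by blast+
  consider "m = 0" "n = 0" | n' where "m = 0" "n = Suc n'" | m' where "m = Suc m'" "n = 0"
    | m' n' where "m = Suc m'" "n = Suc n'"
    by (cases m; cases n)
  then show ?case
  proof cases
    case 1
    then obtain c d where "D = (\<lambda>g. c * g)" "D' = (\<lambda>g. d * g)"
      using less.prems order_le_0_cases by metis
    then have "(\<lambda>g. D (D' g) - D' (D g)) = (\<lambda>_. 0)" by (simp add: mult.left_commute)
    then show ?thesis by (simp only: order_le_zero)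
  next
    case (2 n')
    then obtain c where c: "D = (\<lambda>g. c * g)"
      using less.prems order_le_0_cases by metis
    have "order_le n' (\<lambda>g. D' (c * g) - c * D' g)"
      using less.prems(2) 2 by simp
    from order_le_lmult[OF this, of "-1"] show ?thesis
      using 2 by (simp add: c)
  next
    case (3 m')
    then obtain c where c: "D' = (\<lambda>g. c * g)"
      using less.prems order_le_0_cases by metis
    have "order_le m' (\<lambda>g. D (c * g) - c * D g)"
      using less.prems(1) 3 by simp
    then show ?thesis
      using 3 by (simp add: c)
  next
    case (4 m' n')
    let ?C = "\<lambda>D D' g. D (D' g) - D' (D g)"
    have "order_le (m' + n') (\<lambda>g. ?C D D' (f * g) - f * ?C D D' g)" for f
    proof -
      let ?f = "\<lambda>D g. D (f * g) - f * D g"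
      have "order_le m' (?f D)" "order_le n' (?f D')"
        using less.prems 4 by auto
      then have "order_le (m' + n') (?C D (?f D'))" "order_le (m' + n') (?C (?f D) D')"
        using less.hyps[of m n' D "?f D'"] less.hyps[of m' n "?f D" D'] less.prems 4 by auto
      then have "order_le (m' + n') (\<lambda>g. ?C D (?f D') g + ?C (?f D) D' g)"
        by (rule order_le_add)
      moreover have "(\<lambda>g. ?C D (?f D') g + ?C (?f D) D' g) = (\<lambda>g. ?C D D' (f * g) - f * ?C D D' g)"
        by (auto simp: k_linear_diff[OF lin(1)] k_linear_diff[OF lin(2)] algebra_simps)
      ultimately show ?thesis by (simp only:)
    qed
    moreover have "k_linear (?C D D')"
      using lin by (auto simp: k_linear_def algebra_simps)
    ultimately show ?thesis using 4 by simp
  qed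
qed

text \<open>The bracket of \<open>D\<close> with the denominator \<open>b\<close> has smaller order
  and still vanishes on \<open>A\<close>, hence at \<open>f\<close> by induction. So
  \<open>b * D f = D (b * f) = 0\<close>.\<close>

lemma order_le_vanish:
  assumes A: "\<And>a b. a \<in> A \<Longrightarrow> b \<in> A \<Longrightarrow> a * b \<in> A"
    and D: "order_le n D" "\<And>a. a \<in> A \<Longrightarrow> D a = 0"
    and b: "b \<in> A" "b \<noteq> 0" "b * f \<in> A"
  shows "D f = 0"
  using D
proof (induction n arbitrary: D)
  case 0
  then have "D (b * f) = b * D f" by simp
  then show ?case using 0 b by simp
next
  case (Suc n)
  have "order_le n (\<lambda>g. D (b * g) - b * D g)" using Suc.prems by simp
  moreover have "D (b * a) - b * D a = 0" if "a \<in> A" for a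
    using Suc.prems(2) A b(1) that by simp
  ultimately have "D (b * f) - b * D f = 0" by (rule Suc.IH)
  then show ?case using Suc.prems(2) b by simp
qed


section \<open>Taylor expansions\<close>

lemma const_hom:
  "const (a + b) = const a + const b" "const (a * b) = const a * const b"
  "const 1 = 1" "const 0 = 0" "const (- a) = - const a"
  by (simp_all add: const_def One_fract_def Zero_fract_def one_pCons mult.commute)

lemma const_of_nat: "const (of_nat n) = of_nat n"
  by (induction n) (simp_all add: const_hom)

lemma const_of_int: "const (of_int n) = of_int n"
  by (cases n rule: int_cases2) (simp_all add: const_hom const_of_nat)

lemma const_eq_0_iff: "const c = 0 \<longleftrightarrow> c = 0"
  by (simp add: const_def Zero_fract_def eq_fract)

text \<open>Used with values in the function field, where it yields \<open>poly_in\<close>, and with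
  values in power series over it, where it yields Taylor expansions of polynomials.\<close>

locale field_hom_eval =
  fixes \<kappa> :: "'k::field \<Rightarrow> 'r::comm_ring_1" and x :: 'r
  assumes add: "\<kappa> (a + b) = \<kappa> a + \<kappa> b" and mult: "\<kappa> (a * b) = \<kappa> a * \<kappa> b" and one: "\<kappa> 1 = 1"
begin

lemma zero: "\<kappa> 0 = 0"
  using add[of 0 0] by simp

definition ev :: "'k poly \<Rightarrow> 'r" where
  "ev P = poly (map_poly \<kappa> P) x"

lemma ev_0 [simp]: "ev 0 = 0"
  by (simp add: ev_def)

lemma ev_pCons [simp]: "ev (pCons a P) = \<kappa> a + x * ev P"
  by (simp add: ev_def Polynomial.map_poly_pCons zero)

lemma ev_add: "ev (P + Q) = ev P + ev Q"
  by (induction P Q rule: poly_induct2) (auto simp: add algebra_simps)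

lemma ev_smult: "ev (smult c P) = \<kappa> c * ev P"
  by (induction P) (auto simp: mult algebra_simps)

lemma ev_mult: "ev (P * Q) = ev P * ev Q"
  by (induction P) (auto simp: ev_add ev_smult zero algebra_simps)

lemma ev_1 [simp]: "ev 1 = 1"
  by (simp add: one_pCons one)

end

interpretation poly_in: field_hom_eval const \<tau>
  rewrites "field_hom_eval.ev const \<tau> = poly_in \<tau>" for \<tau> :: "'p::prime_card fun_field"
proof -
  show *: "field_hom_eval (const :: 'p mod_ring \<Rightarrow> _)" by unfold_locales (simp_all add: const_hom)
  show "field_hom_eval.ev const \<tau> = poly_in \<tau>"
    by (simp add: fun_eq_iff field_hom_eval.ev_def[OF *] poly_in_def)
qed

lemma poly_in_t: "poly_in coord_t P = Fract P 1"
  by (induction P) (auto simp: Zero_fract_def const_def coord_t_def)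

lemma poly_in_t_eq_0_iff: "poly_in coord_t P = 0 \<longleftrightarrow> P = 0"
  by (simp add: poly_in_t Zero_fract_def eq_fract)

lemma fun_field_cases:
  fixes f :: "'p::prime_card fun_field"
  obtains a b where "b \<noteq> 0" "f = poly_in coord_t a / poly_in coord_t b"
proof (cases f)
  case (Fract a b)
  then show ?thesis using that[of b a] by (simp add: poly_in_t)
qed

text \<open>If \<open>x\<close> has constant term \<open>t\<close>, then denominators become units, and this is the ring morphism
  sending \<open>t\<close> to \<open>x\<close>.\<close>

definition taylor :: "'p::prime_card fun_field fps \<Rightarrow> 'p fun_field \<Rightarrow> 'p fun_field fps" where
  "taylor x f = (let (a, b) = SOME (a, b). b \<noteq> 0 \<and> f = poly_in coord_t a / poly_in coord_t b in
     poly (map_poly (\<lambda>c. fps_const (const c)) a) x * inverse (poly (map_poly (\<lambda>c. fps_const (const c)) b) x))"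

locale taylor_expansion =
  fixes x :: "'p::prime_card fun_field fps"
  assumes x0: "fps_nth x 0 = coord_t"
begin

sublocale E: field_hom_eval "\<lambda>c. fps_const (const c)" x
  by unfold_locales (simp_all add: const_hom flip: fps_const_add fps_const_mult)

lemma ev_nth_0: "fps_nth (E.ev P) 0 = poly_in coord_t P"
  by (induction P) (simp_all add: x0)

lemma ev_unit: "b \<noteq> 0 \<Longrightarrow> E.ev b * inverse (E.ev b) = 1"
  using inverse_mult_eq_1[of "E.ev b"] by (simp add: ev_nth_0 poly_in_t_eq_0_iff mult.commute)

text \<open>Two fractions for one function give equal cross products of polynomials, which
  evaluation preserves, and the denominators are units. Hence the choice in \<open>taylor\<close>
  does not matter.\<close>

lemma taylor_fraction:
  assumes "b \<noteq> 0"
  shows "taylor x (poly_in coord_t a / poly_in coord_t b) = E.ev a * inverse (E.ev b)"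
proof -
  let ?f = "poly_in coord_t a / poly_in coord_t b"
  define ab where "ab = (SOME (a, b). b \<noteq> 0 \<and> ?f = poly_in coord_t a / poly_in coord_t b)"
  have "case ab of (a, b) \<Rightarrow> b \<noteq> 0 \<and> ?f = poly_in coord_t a / poly_in coord_t b"
    unfolding ab_def by (rule someI[of _ "(a, b)"]) (use assms in simp)
  then obtain a' b' where ab: "ab = (a', b')" "b' \<noteq> 0" "?f = poly_in coord_t a' / poly_in coord_t b'"
    by (cases ab) auto
  then have "poly_in coord_t (a * b') = poly_in coord_t (a' * b)"
    using assms by (simp add: poly_in.ev_mult poly_in_t_eq_0_iff field_simps)
  then have "a * b' = a' * b" by (simp add: poly_in_t eq_fract)
  then have eq: "E.ev a * E.ev b' = E.ev a' * E.ev b" by (metis E.ev_mult)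
  have "taylor x ?f = E.ev a' * inverse (E.ev b')"
    unfolding taylor_def ab_def[symmetric] ab(1) by (simp flip: E.ev_def)
  also have "\<dots> = (E.ev a' * E.ev b) * inverse (E.ev b) * inverse (E.ev b')"
    using ev_unit[OF assms] by (simp add: mult.assoc)
  also have "\<dots> = E.ev a * inverse (E.ev b) * (E.ev b' * inverse (E.ev b'))"
    unfolding eq[symmetric] by (simp only: ac_simps)
  finally show ?thesis using ev_unit[OF ab(2)] by simp
qed

lemma taylor_poly: "taylor x (poly_in coord_t a) = E.ev a"
  using taylor_fraction[of 1 a] ev_unit[of 1] by simp

lemma taylor_one: "taylor x 1 = 1"
  using taylor_poly[of 1] by simp

lemma taylor_mult: "taylor x (f * g) = taylor x f * taylor x g"
proof -
  obtain a b where f: "b \<noteq> 0" "f = poly_in coord_t a / poly_in coord_t b" by (rule fun_field_cases)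
  obtain c d where g: "d \<noteq> 0" "g = poly_in coord_t c / poly_in coord_t d" by (rule fun_field_cases)
  have "f * g = poly_in coord_t (a * c) / poly_in coord_t (b * d)"
    using f g by (simp add: poly_in.ev_mult)
  moreover have "inverse (E.ev (b * d)) = inverse (E.ev b) * inverse (E.ev d)"
    by (simp add: E.ev_mult fps_inverse_mult)
  ultimately show ?thesis
    using f g by (simp add: taylor_fraction E.ev_mult ac_simps)
qed

lemma taylor_add: "taylor x (f + g) = taylor x f + taylor x g"
proof -
  obtain a b where f: "b \<noteq> 0" "f = poly_in coord_t a / poly_in coord_t b" by (rule fun_field_cases)
  obtain c d where g: "d \<noteq> 0" "g = poly_in coord_t c / poly_in coord_t d" by (rule fun_field_cases)
  let ?u = "E.ev b" and ?v = "E.ev d"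
  have "f + g = poly_in coord_t (a * d + c * b) / poly_in coord_t (b * d)"
    using f g by (simp add: poly_in.ev_mult poly_in.ev_add poly_in_t_eq_0_iff field_simps)
  moreover have "inverse (E.ev (b * d)) = inverse ?u * inverse ?v"
    by (simp add: E.ev_mult fps_inverse_mult)
  ultimately have "taylor x (f + g) = (E.ev a * ?v + E.ev c * ?u) * (inverse ?u * inverse ?v)"
    using f(1) g(1) by (simp add: taylor_fraction E.ev_mult E.ev_add)
  also have "\<dots> = E.ev a * inverse ?u * (?v * inverse ?v) + E.ev c * inverse ?v * (?u * inverse ?u)"
    by (simp add: algebra_simps)
  finally show ?thesis
    using f g by (simp add: taylor_fraction ev_unit)
qed

lemma taylor_const: "taylor x (const c) = fps_const (const c)"
  using taylor_poly[of "[:c:]"] by simp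

lemma taylor_nth_0: "fps_nth (taylor x f) 0 = f"
proof -
  obtain a b where f: "b \<noteq> 0" "f = poly_in coord_t a / poly_in coord_t b" by (rule fun_field_cases)
  then show ?thesis
    by (simp add: taylor_fraction ev_nth_0 field_simps)
qed

lemma taylor_coord: "taylor x coord_t = x"
  using taylor_poly[of "[:0, 1:]"] by (simp add: const_hom)

lemma taylor_inverse: "f \<noteq> 0 \<Longrightarrow> taylor x (inverse f) = inverse (taylor x f)"
  using taylor_mult[of f "inverse f"] fps_inverse_unique[of "taylor x f" "taylor x (inverse f)"]
  by (simp add: taylor_one)

abbreviation coef :: "nat \<Rightarrow> 'p operator" where
  "coef n f \<equiv> fps_nth (taylor x f) n"

lemma coef_k_linear: "k_linear (coef n)"
  by (simp add: k_linear_def taylor_add taylor_mult taylor_const)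

text \<open>Multiplicativity of the expansion is a Leibniz rule. Removing its term
  \<open>f * coef n g\<close> leaves the sum of \<open>coef i f * coef (n - i) g\<close> over
  \<open>i \<ge> 1\<close>, of order below \<open>n\<close> in \<open>g\<close>.\<close>

lemma order_coef: "order_le n (coef n)"
proof (induction n rule: less_induct)
  case (less n)
  show ?case
  proof (cases n)
    case 0
    then show ?thesis using coef_k_linear[of 0] by (simp add: taylor_nth_0)
  next
    case (Suc k)
    have "order_le k (\<lambda>g. \<Sum>i\<in>{1..n}. coef i f * coef (n - i) g)" for f
    proof (rule order_le_sum)
      fix i assume i: "i \<in> {1..n}"
      then have "order_le (n - i) (coef (n - i))" by (intro less) auto
      then have "order_le k (coef (n - i))" by (rule order_le_mono[rotated]) (use i Suc in auto)
      then show "order_le k (\<lambda>g. coef i f * coef (n - i) g)" by (rule order_le_lmult)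
    qed
    moreover have "(\<lambda>g. \<Sum>i\<in>{1..n}. coef i f * coef (n - i) g) = (\<lambda>g. coef n (f * g) - f * coef n g)" for f
      by (simp add: fun_eq_iff taylor_mult fps_mult_nth sum.atLeast_Suc_atMost taylor_nth_0)
    ultimately show ?thesis
      using coef_k_linear[of n] Suc by simp
  qed
qed

end

text \<open>The recursion for the coefficients of the inverse series divides by the constant term
  only. With \<open>R\<close> a local ring this bounds the denominators in expansions of
  fractions.\<close>

lemma fps_inverse_nth_closed:
  fixes F :: "'a::field fps"
  assumes R: "\<And>a b. a \<in> R \<Longrightarrow> b \<in> R \<Longrightarrow> a + b \<in> R" "\<And>a b. a \<in> R \<Longrightarrow> b \<in> R \<Longrightarrow> a * b \<in> R"
    "\<And>a. a \<in> R \<Longrightarrow> - a \<in> R" "0 \<in> R"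
    and F: "\<And>n. fps_nth F n \<in> R" "fps_nth F 0 \<noteq> 0" "inverse (fps_nth F 0) \<in> R"
  shows "fps_nth (inverse F) n \<in> R"
proof (induction n rule: less_induct)
  case (less n)
  show ?case
  proof (cases "n = 0")
    case True
    then show ?thesis using F by simp
  next
    case False
    have "0 = fps_nth (F * inverse F) n"
      using inverse_mult_eq_1[OF F(2)] False by (simp add: mult.commute)
    also have "\<dots> = fps_nth F 0 * fps_nth (inverse F) n + (\<Sum>i=1..n. fps_nth F i * fps_nth (inverse F) (n - i))"
      by (simp add: fps_mult_nth sum.atLeast_Suc_atMost)
    finally have rec: "fps_nth F 0 * fps_nth (inverse F) n = - (\<Sum>i=1..n. fps_nth F i * fps_nth (inverse F) (n - i))"
      by (simp only: eq_neg_iff_add_eq_0)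
    have "fps_nth (inverse F) n = inverse (fps_nth F 0) * (fps_nth F 0 * fps_nth (inverse F) n)"
      by (simp only: left_inverse[OF F(2)] mult_1_left flip: mult.assoc)
    then have "fps_nth (inverse F) n = inverse (fps_nth F 0) * - (\<Sum>i=1..n. fps_nth F i * fps_nth (inverse F) (n - i))"
      by (simp only: rec)
    moreover have "(\<Sum>i\<in>A. fps_nth F i * fps_nth (inverse F) (n - i)) \<in> R" if "A \<subseteq> {1..n}" for A
      using finite_subset[OF that finite_atLeastAtMost] that
      by (induction A rule: finite_induct) (auto intro!: R F less)
    ultimately show ?thesis using R F(3) by auto
  qed
qed

section \<open>Divided power derivations\<close>

lemma ibinom_0 [simp]: "ibinom k 0 = 1"
  by (simp add: ibinom_def)

lemma ibinom_Suc_Suc: "ibinom (k + 1) (Suc n) = ibinom k n + ibinom k (Suc n)"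
proof -
  have "(of_int (ibinom (k + 1) (Suc n)) :: rat) = of_int (ibinom k n + ibinom k (Suc n))"
    by (simp add: of_int_ibinom gbinomial_Suc_Suc)
  then show ?thesis by (simp only: of_int_eq_iff)
qed

lemma ibinom_of_nat: "ibinom (int j) n = int (j choose n)"
proof -
  have "(of_int (ibinom (int j) n) :: rat) = of_int (int (j choose n))"
    by (simp add: of_int_ibinom binomial_gbinomial)
  then show ?thesis by (simp only: of_int_eq_iff)
qed

lemma coord_t_nz: "(coord_t :: 'p::prime_card fun_field) \<noteq> 0"
  by (simp add: coord_t_def Zero_fract_def eq_fract)

lemma coords_nz: "\<tau> \<in> coords \<Longrightarrow> \<tau> \<noteq> 0"
  by (auto simp: coords_def coord_t_nz)

lemma coord_t_neq_inverse: "inverse coord_t \<noteq> (coord_t :: 'p::prime_card fun_field)"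
proof
  assume "inverse coord_t = (coord_t :: 'p fun_field)"
  then have "coord_t * coord_t = (1 :: 'p fun_field)"
    using coord_t_nz by (metis right_inverse)
  then show False by (simp add: coord_t_def One_fract_def eq_fract one_pCons)
qed

lemma coords_inverse: "\<tau> \<in> coords \<Longrightarrow> \<sigma> \<in> coords \<Longrightarrow> \<sigma> = \<tau> \<or> \<sigma> = inverse \<tau>"
  by (auto simp: coords_def)

text \<open>The image of \<open>t\<close> under the shift of \<tau> by the series variable:
  \<open>t + X\<close> if \<tau> is \<open>t\<close>, and \<open>1 / (1 / t + X)\<close> if \<tau>
  is \<open>1 / t\<close>.\<close>

definition shifted_t :: "'p::prime_card fun_field \<Rightarrow> 'p fun_field fps" where
  "shifted_t \<tau> = (if \<tau> = coord_t then fps_const coord_t + fps_X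
     else inverse (fps_const (inverse coord_t) + fps_X))"

lemma taylor_expansion_shifted_t: "taylor_expansion (shifted_t \<tau>)"
  by standard (simp add: shifted_t_def)

lemma taylor_shifted_t: "\<tau> \<in> coords \<Longrightarrow> taylor (shifted_t \<tau>) \<tau> = fps_const \<tau> + fps_X"
proof -
  assume "\<tau> \<in> coords"
  interpret T: taylor_expansion "shifted_t \<tau>" by (rule taylor_expansion_shifted_t)
  consider "\<tau> = coord_t" | "\<tau> = inverse coord_t" using \<open>\<tau> \<in> coords\<close> unfolding coords_def by blast
  then show ?thesis
  proof cases
    case 1
    then show ?thesis using T.taylor_coord by (simp add: shifted_t_def)
  next
    case 2
    have "taylor (shifted_t \<tau>) \<tau> = inverse (shifted_t \<tau>)"
      using T.taylor_inverse[OF coord_t_nz] T.taylor_coord 2 by simp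
    also have "\<dots> = fps_const \<tau> + fps_X"
    proof -
      have "inverse (inverse (fps_const (inverse coord_t) + fps_X)) = fps_const (inverse coord_t :: 'a fun_field) + fps_X"
        by (rule fps_inverse_idempotent) (simp add: coord_t_nz)
      then show ?thesis using 2 by (simp add: shifted_t_def coord_t_neq_inverse)
    qed
    finally show ?thesis .
  qed
qed

text \<open>The Hasse derivatives, defined on the whole function field; they are the divided power
  derivations, see \<open>divpow_deriv_eq\<close>.\<close>

definition hasse :: "'p::prime_card fun_field \<Rightarrow> nat \<Rightarrow> 'p operator" where
  "hasse \<tau> n f = fps_nth (taylor (shifted_t \<tau>) f) n"

lemma order_hasse: "order_le n (hasse \<tau> n)"
  using taylor_expansion.order_coef[OF taylor_expansion_shifted_t, of n \<tau>]
  unfolding hasse_def[abs_def] .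

text \<open>Multiplying by \<tau> multiplies the expansion by \<open>\<tau> + X\<close>, which is
  Pascal's rule for the coefficients. The induction runs in both directions from exponent 0, as
  negative exponents are needed to compare the charts.\<close>

lemma hasse_powi:
  assumes \<tau>: "\<tau> \<in> coords"
  shows "hasse \<tau> n (\<tau> powi j) = of_int (ibinom j n) * \<tau> powi (j - int n)"
proof -
  interpret T: taylor_expansion "shifted_t \<tau>" by (rule taylor_expansion_shifted_t)
  have nz: "\<tau> \<noteq> 0" by (rule coords_nz[OF \<tau>])
  have rec: "hasse \<tau> n (\<tau> powi (i + 1)) = \<tau> * hasse \<tau> n (\<tau> powi i)
      + (if n = 0 then 0 else hasse \<tau> (n - 1) (\<tau> powi i))" for i n
  proof -
    have "taylor (shifted_t \<tau>) (\<tau> powi (i + 1))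
        = fps_const \<tau> * taylor (shifted_t \<tau>) (\<tau> powi i) + fps_X * taylor (shifted_t \<tau>) (\<tau> powi i)"
      unfolding power_int_add_1[OF disjI1[OF nz]] T.taylor_mult taylor_shifted_t[OF \<tau>]
      by (simp add: algebra_simps)
    then show ?thesis by (simp add: hasse_def)
  qed
  have shift: "\<tau> * \<tau> powi k = \<tau> powi (k + 1)" for k
    using nz by (simp add: power_int_add_1 mult.commute)
  have "\<forall>n. hasse \<tau> n (\<tau> powi j) = of_int (ibinom j n) * \<tau> powi (j - int n)"
  proof (induction j rule: int_induct[where k = 0])
    case base
    have "ibinom 0 n = (if n = 0 then 1 else 0)" for n
      using ibinom_of_nat[of 0 n] by (cases n) auto
    then show ?case by (auto simp: hasse_def T.taylor_one)
  next
    case (step1 i)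
    show ?case
    proof
      fix n
      show "hasse \<tau> n (\<tau> powi (i + 1)) = of_int (ibinom (i + 1) n) * \<tau> powi (i + 1 - int n)"
      proof (cases n)
        case 0
        then show ?thesis using step1 shift[of i] by (simp add: rec)
      next
        case (Suc k)
        have "hasse \<tau> n (\<tau> powi (i + 1)) = of_int (ibinom i n) * (\<tau> * \<tau> powi (i - int n)) + of_int (ibinom i k) * \<tau> powi (i - int k)"
          using step1 Suc by (simp add: rec)
        also have "\<dots> = of_int (ibinom (i + 1) n) * \<tau> powi (i + 1 - int n)"
        proof -
          have e: "i - int n + 1 = i - int k" "i + 1 - int n = i - int k" using Suc by simp_all
          show ?thesis
            unfolding shift e unfolding Suc ibinom_Suc_Suc of_int_add distrib_right by (rule add.commute)
        qed
        finally show ?thesis .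
      qed
    qed
  next
    case (step2 i)
    \<comment> \<open>Downwards, the value for \<open>n\<close> at the smaller exponent involves the
      value for \<open>n - 1\<close> at the same exponent; this forces an inner induction on
      \<open>n\<close> and a division by \<tau>.\<close>
    have *: "\<tau> * hasse \<tau> n (\<tau> powi (i - 1)) = of_int (ibinom i n) * \<tau> powi (i - int n)
      - (if n = 0 then 0 else hasse \<tau> (n - 1) (\<tau> powi (i - 1)))" for n
      using rec[of n "i - 1"] step2(2) by simp
    show ?case
    proof
      fix n
      show "hasse \<tau> n (\<tau> powi (i - 1)) = of_int (ibinom (i - 1) n) * \<tau> powi (i - 1 - int n)"
      proof (induction n)
        case 0
        have "\<tau> * hasse \<tau> 0 (\<tau> powi (i - 1)) = \<tau> * \<tau> powi (i - 1)"
          using *[of 0] shift[of "i - 1"] by simp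
        then show ?case using nz by simp
      next
        case (Suc n)
        have "\<tau> * hasse \<tau> (Suc n) (\<tau> powi (i - 1))
            = (of_int (ibinom i (Suc n)) - of_int (ibinom (i - 1) n)) * \<tau> powi (i - int (Suc n))"
          using *[of "Suc n"] Suc by (simp add: algebra_simps)
        also have "of_int (ibinom i (Suc n)) - of_int (ibinom (i - 1) n) = (of_int (ibinom (i - 1) (Suc n)) :: 'a fun_field)"
          using ibinom_Suc_Suc[of "i - 1" n] by simp
        also have "\<tau> powi (i - int (Suc n)) = \<tau> * \<tau> powi (i - 1 - int (Suc n))"
          using shift[of "i - 1 - int (Suc n)"] by (simp add: algebra_simps)
        finally have "\<tau> * hasse \<tau> (Suc n) (\<tau> powi (i - 1))
            = \<tau> * (of_int (ibinom (i - 1) (Suc n)) * \<tau> powi (i - 1 - int (Suc n)))"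
          by (simp only: mult.left_commute)
        then show ?case by (rule mult_left_cancel[OF nz, THEN iffD1])
      qed
    qed
  qed
  then show ?thesis by blast
qed

lemma hasse_power:
  assumes "\<tau> \<in> coords"
  shows "hasse \<tau> n (\<tau> ^ j) = of_nat (j choose n) * \<tau> ^ (j - n)"
proof (cases "n \<le> j")
  case True
  then show ?thesis
    using hasse_powi[OF assms, of n "int j"] by (simp add: ibinom_of_nat flip: of_nat_diff)
next
  case False
  then show ?thesis
    using hasse_powi[OF assms, of n "int j"] by (simp add: ibinom_of_nat binomial_eq_0)
qed

lemma poly_in_monom: "poly_in \<tau> (monom c n) = const c * \<tau> ^ n"
  by (induction n) (simp_all add: monom_0 monom_Suc const_hom)

section \<open>Fractions in a chart and uniqueness of operators\<close>

text \<open>In the chart at infinity, a sufficiently high power of \<open>1 / t\<close> turns a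
  polynomial in \<open>t\<close> into one in \<open>1 / t\<close>.\<close>

lemma fractions_of_chart:
  fixes f :: "'p::prime_card fun_field"
  assumes "\<tau> \<in> coords"
  obtains a b where "b \<noteq> 0" "poly_in \<tau> b \<noteq> 0" "f = poly_in \<tau> a / poly_in \<tau> b"
proof -
  have rev: "\<exists>d c. inverse coord_t ^ d * poly_in coord_t a = poly_in (inverse coord_t) c" for a :: "'p mod_ring poly"
  proof (induction a)
    case 0
    show ?case by (auto intro!: exI[of _ 0])
  next
    case (pCons a0 a)
    then obtain d c where dc: "inverse coord_t ^ d * poly_in coord_t a = poly_in (inverse coord_t) c" by blast
    have "inverse coord_t ^ Suc d * poly_in coord_t (pCons a0 a)
        = const a0 * inverse coord_t ^ Suc d + (inverse coord_t * coord_t) * (inverse coord_t ^ d * poly_in coord_t a)"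
      by (simp add: algebra_simps)
    also have "\<dots> = poly_in (inverse coord_t) (monom a0 (Suc d) + c)"
      by (simp add: dc poly_in.ev_add poly_in_monom coord_t_nz)
    finally show ?case by blast
  qed
  consider "\<tau> = coord_t" | "\<tau> = inverse coord_t" using assms unfolding coords_def by blast
  then show ?thesis
  proof cases
    case 1
    then show ?thesis using that fun_field_cases[of f] poly_in_t_eq_0_iff by metis
  next
    case 2
    obtain a b where ab: "b \<noteq> 0" "f = poly_in coord_t a / poly_in coord_t b" by (rule fun_field_cases)
    obtain d c where c: "inverse coord_t ^ d * poly_in coord_t a = poly_in (inverse coord_t) c" using rev by blast
    obtain d' c' where c': "inverse coord_t ^ d' * poly_in coord_t b = poly_in (inverse coord_t) c'" using rev by blast
    let ?s = "inverse coord_t :: 'p fun_field"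
    have s: "?s ^ k \<noteq> 0" for k by (simp add: coord_t_nz)
    have "poly_in ?s c' \<noteq> 0" using c' s ab(1) poly_in_t_eq_0_iff by (metis mult_eq_0_iff)
    then have nz: "poly_in ?s (monom 1 d * c') \<noteq> 0"
      using s by (simp add: poly_in.ev_mult poly_in_monom const_hom)
    \<comment> \<open>The exponents \<open>d\<close> and \<open>d'\<close> are exchanged so that
      numerator and denominator acquire the same factor, the power of \<open>1 / t\<close> with
      exponent \<open>d + d'\<close>.\<close>
    moreover have "f = poly_in ?s (monom 1 d' * c) / poly_in ?s (monom 1 d * c')"
    proof -
      have "poly_in ?s (monom 1 d' * c) = (?s ^ d * ?s ^ d') * poly_in coord_t a"
        "poly_in ?s (monom 1 d * c') = (?s ^ d * ?s ^ d') * poly_in coord_t b"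
        unfolding poly_in.ev_mult poly_in_monom const_hom mult_1_left c[symmetric] c'[symmetric]
        by (simp_all only: ac_simps)
      then show ?thesis
        using mult_divide_mult_cancel_left[of "?s ^ d * ?s ^ d'"] s[of d] s[of d'] ab(2) by simp
    qed
    moreover have "monom 1 d * c' \<noteq> 0" using nz by (metis poly_in.ev_0)
    ultimately show ?thesis using that 2 by blast
  qed
qed

lemma hasse_sum: "hasse \<tau> n (sum f A) = (\<Sum>i\<in>A. hasse \<tau> n (f i))"
  by (rule k_linear_sum) (rule order_le_k_linear[OF order_hasse])

text \<open>The Hasse derivative of order \<open>degree b\<close> turns a polynomial in \<tau> into
  its leading coefficient, in either chart.\<close>

lemma poly_in_nz:
  assumes "\<tau> \<in> coords" "b \<noteq> 0"
  shows "poly_in \<tau> b \<noteq> 0"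
proof
  assume 0: "poly_in \<tau> b = 0"
  let ?d = "degree b"
  have sum: "poly_in \<tau> (\<Sum>i\<in>A. f i) = (\<Sum>i\<in>A. poly_in \<tau> (f i))" for f :: "nat \<Rightarrow> 'a mod_ring poly" and A
    by (induction A rule: infinite_finite_induct) (simp_all add: poly_in.ev_add)
  have "poly_in \<tau> b = (\<Sum>i\<le>?d. const (coeff b i) * \<tau> ^ i)"
    using sum[of "\<lambda>i. monom (coeff b i) i" "{..?d}"] by (simp add: poly_as_sum_of_monoms poly_in_monom)
  then have "hasse \<tau> ?d (poly_in \<tau> b) = (\<Sum>i\<le>?d. const (coeff b i) * hasse \<tau> ?d (\<tau> ^ i))"
    using order_le_k_linear[OF order_hasse, of \<tau> ?d] by (simp add: hasse_sum k_linear_def)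
  also have "\<dots> = (\<Sum>i\<le>?d. if i = ?d then const (coeff b i) else 0)"
    by (rule sum.cong) (auto simp: hasse_power[OF assms(1)] binomial_eq_0)
  finally have "const (lead_coeff b) = 0"
    using k_linear_zero[OF order_le_k_linear[OF order_hasse], of \<tau> ?d] by (simp add: 0)
  then show False using assms(2) by (simp add: const_eq_0_iff)
qed

text \<open>The difference has finite order and vanishes on polynomials in \<tau>, hence on
  fractions by \<open>order_le_vanish\<close>. This is the only tool for identifying operators
  below.\<close>

lemma chart_operator_unique:
  assumes \<tau>: "\<tau> \<in> coords" and D: "order_le n D" "order_le m D'"
    and eq: "\<And>j. D (\<tau> ^ j) = D' (\<tau> ^ j)"
  shows "D = D'"
proof
  fix f
  let ?E = "\<lambda>g. D g - D' g"
  have E: "order_le (max n m) ?E"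
    by (intro order_le_diff order_le_mono[OF _ D(1)] order_le_mono[OF _ D(2)]) auto
  note lin = order_le_k_linear[OF E]
  \<comment> \<open>The power of \<tau> in front strengthens the induction: \<open>?E\<close> is
    only k-linear, so multiplication by \<tau> cannot be pulled out.\<close>
  have zero: "?E (\<tau> ^ j * poly_in \<tau> a) = 0" for j a
  proof (induction a arbitrary: j)
    case (pCons c a)
    have "\<tau> ^ j * poly_in \<tau> (pCons c a) = const c * \<tau> ^ j + \<tau> ^ Suc j * poly_in \<tau> a"
      by (simp add: algebra_simps)
    moreover have "?E (const c * \<tau> ^ j + \<tau> ^ Suc j * poly_in \<tau> a)
        = const c * ?E (\<tau> ^ j) + ?E (\<tau> ^ Suc j * poly_in \<tau> a)"
      using lin unfolding k_linear_def by metis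
    ultimately show ?case using eq[of j] pCons.IH[of "Suc j"] by simp
  qed (use k_linear_zero[OF lin] in simp)
  obtain a b where ab: "b \<noteq> 0" "poly_in \<tau> b \<noteq> 0" "f = poly_in \<tau> a / poly_in \<tau> b"
    using fractions_of_chart[OF \<tau>] .
  have "?E f = 0"
  proof (rule order_le_vanish[OF _ E, of "range (poly_in \<tau>)"])
    show "u * v \<in> range (poly_in \<tau>)" if "u \<in> range (poly_in \<tau>)" "v \<in> range (poly_in \<tau>)" for u v
      using that by (auto simp flip: poly_in.ev_mult)
    show "?E u = 0" if "u \<in> range (poly_in \<tau>)" for u
      using that zero[of 0] by auto
    show "poly_in \<tau> b \<in> range (poly_in \<tau>)" "poly_in \<tau> b \<noteq> 0" "poly_in \<tau> b * f \<in> range (poly_in \<tau>)"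
      using ab by auto
  qed
  then show "D f = D' f" by simp
qed


section \<open>Local rings\<close>

locale chart_point =
  fixes \<tau> :: "'p::prime_card fun_field" and P :: "'p mod_ring poly set"
  assumes \<tau>: "\<tau> \<in> coords" and P: "P \<in> prime_spec"
begin

sublocale P: primeideal P "type_ring :: 'p mod_ring poly ring"
  using P by (simp add: prime_spec_def)

abbreviation (input) O_x where "O_x \<equiv> local_ring \<tau> P"

lemma notin_prime:
  "0 \<in> P" "1 \<notin> P" "b \<notin> P \<Longrightarrow> c \<notin> P \<Longrightarrow> b * c \<notin> P" "b \<notin> P \<Longrightarrow> poly_in \<tau> b \<noteq> 0"
proof -
  show z: "0 \<in> P" using additive_subgroup.zero_closed[OF P.additive_subgroup_axioms] by simp
  show "1 \<notin> P" using P.one_imp_carrier P.I_notcarr by auto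
  show "b * c \<notin> P" if "b \<notin> P" "c \<notin> P"
    using P.I_prime[of b c] that by auto
  show "poly_in \<tau> b \<noteq> 0" if "b \<notin> P"
    using that z by (intro poly_in_nz[OF \<tau>]) auto
qed

lemma local_ring_closed:
  "f \<in> O_x \<Longrightarrow> g \<in> O_x \<Longrightarrow> f + g \<in> O_x" "f \<in> O_x \<Longrightarrow> g \<in> O_x \<Longrightarrow> f * g \<in> O_x"
  "f \<in> O_x \<Longrightarrow> - f \<in> O_x" "poly_in \<tau> a \<in> O_x" "b \<notin> P \<Longrightarrow> inverse (poly_in \<tau> b) \<in> O_x"
proof -
  have I: "f \<in> O_x" if "b \<notin> P" "f = poly_in \<tau> a / poly_in \<tau> b" for f a b
    using that unfolding local_ring_def by blast
  show "poly_in \<tau> a \<in> O_x" by (rule I[of 1 _ a]) (simp_all add: notin_prime)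
  show "inverse (poly_in \<tau> b) \<in> O_x" if "b \<notin> P"
    by (rule I[OF that, of _ 1]) (simp add: field_simps)
  show "- f \<in> O_x" if "f \<in> O_x"
  proof -
    from that obtain a b where f: "b \<notin> P" "f = poly_in \<tau> a / poly_in \<tau> b" unfolding local_ring_def by blast
    have "poly_in \<tau> (- a) = - poly_in \<tau> a"
      using poly_in.ev_smult[of \<tau> "-1" a] by (simp add: const_hom)
    then show ?thesis by (intro I[OF f(1), of _ "- a"]) (simp add: f)
  qed
  assume "f \<in> O_x" "g \<in> O_x"
  then obtain a b c d where f: "b \<notin> P" "f = poly_in \<tau> a / poly_in \<tau> b"
    and g: "d \<notin> P" "g = poly_in \<tau> c / poly_in \<tau> d" unfolding local_ring_def by blast
  show "f * g \<in> O_x"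
    by (rule I[OF notin_prime(3)[OF f(1) g(1)], of _ "a * c"]) (simp add: f g poly_in.ev_mult)
  show "f + g \<in> O_x"
    by (rule I[OF notin_prime(3)[OF f(1) g(1)], of _ "a * d + c * b"])
      (simp add: f g notin_prime(4)[OF f(1)] notin_prime(4)[OF g(1)] poly_in.ev_mult poly_in.ev_add add_divide_distrib)
qed

lemma local_ring_consts: "0 \<in> O_x" "1 \<in> O_x" "const c \<in> O_x" "\<tau> \<in> O_x" "of_int z \<in> O_x" "f \<in> O_x \<Longrightarrow> f ^ n \<in> O_x"
proof -
  show "0 \<in> O_x" using local_ring_closed(4)[of 0] by simp
  show one: "1 \<in> O_x" using local_ring_closed(4)[of 1] by simp
  show "const c \<in> O_x" using local_ring_closed(4)[of "[:c:]"] by simp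
  show "\<tau> \<in> O_x" using local_ring_closed(4)[of "[:0, 1:]"] by (simp add: const_hom)
  show "of_int z \<in> O_x"
    using local_ring_closed(4)[of "[:of_int z:]"] by (simp add: const_of_int)
  show "f ^ n \<in> O_x" if "f \<in> O_x"
    by (induction n) (auto intro: one local_ring_closed that)
qed

text \<open>Here \<sigma> and \<tau> may be different coordinates. All expansion coefficients of
  \<tau> lie in the local ring, then by Leibniz those of polynomials in \<tau>, and those of
  fractions by \<open>fps_inverse_nth_closed\<close>. Hence the divided powers for one chart are
  regular on the other one too.\<close>

lemma hasse_local:
  assumes \<sigma>: "\<sigma> \<in> coords" and f: "f \<in> O_x"
  shows "hasse \<sigma> n f \<in> O_x"
proof -
  interpret T: taylor_expansion "shifted_t \<sigma>" by (rule taylor_expansion_shifted_t)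
  have coord: "hasse \<sigma> n \<tau> \<in> O_x" for n
  proof (cases "\<tau> = \<sigma>")
    case True
    then show ?thesis
      using taylor_shifted_t[OF \<sigma>] local_ring_consts(1,2,4) by (auto simp: hasse_def fps_X_def)
  next
    case False
    then have \<tau>\<sigma>: "\<tau> = inverse \<sigma>" using coords_inverse[OF \<sigma> \<tau>] by blast
    have "hasse \<sigma> n (\<sigma> powi (- 1)) = of_int (ibinom (- 1) n) * \<sigma> powi (- 1 - int n)"
      by (rule hasse_powi[OF \<sigma>])
    also have "- 1 - int n = - int (Suc n)" by simp
    also have "\<sigma> powi (- int (Suc n)) = \<tau> ^ Suc n"
      by (simp only: power_int_minus power_int_of_nat \<tau>\<sigma> power_inverse)
    finally have "hasse \<sigma> n \<tau> = of_int (ibinom (- 1) n) * \<tau> ^ Suc n"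
      by (simp add: \<tau>\<sigma> power_int_minus)
    then show ?thesis using local_ring_closed local_ring_consts by metis
  qed
  have sum: "sum u A \<in> O_x" if "\<And>i. i \<in> A \<Longrightarrow> u i \<in> O_x" for u :: "nat \<Rightarrow> _" and A
    using that by (induction A rule: infinite_finite_induct) (auto intro: local_ring_consts local_ring_closed)
  have poly: "hasse \<sigma> n (poly_in \<tau> a) \<in> O_x" for n a
  proof (induction a arbitrary: n)
    case 0
    then show ?case using local_ring_consts by (simp add: k_linear_zero[OF order_le_k_linear[OF order_hasse]])
  next
    case (pCons c a)
    have "taylor (shifted_t \<sigma>) (poly_in \<tau> (pCons c a))
        = fps_const (const c) + taylor (shifted_t \<sigma>) \<tau> * taylor (shifted_t \<sigma>) (poly_in \<tau> a)"
      by (simp add: T.taylor_add T.taylor_mult T.taylor_const)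
    then have "hasse \<sigma> n (poly_in \<tau> (pCons c a)) = (if n = 0 then const c else 0)
        + (\<Sum>i=0..n. hasse \<sigma> i \<tau> * hasse \<sigma> (n - i) (poly_in \<tau> a))"
      by (simp add: hasse_def fps_mult_nth)
    moreover have "(\<Sum>i=0..n. hasse \<sigma> i \<tau> * hasse \<sigma> (n - i) (poly_in \<tau> a)) \<in> O_x"
      by (intro sum local_ring_closed coord pCons.IH)
    ultimately show ?case
      using local_ring_closed(1) local_ring_consts(1,3) by (cases "n = 0") simp_all
  qed
  obtain a b where ab: "b \<notin> P" "f = poly_in \<tau> a * inverse (poly_in \<tau> b)"
    using f unfolding local_ring_def by (auto simp: divide_inverse)
  have "hasse \<sigma> n f = (\<Sum>i=0..n. hasse \<sigma> i (poly_in \<tau> a) * fps_nth (inverse (taylor (shifted_t \<sigma>) (poly_in \<tau> b))) (n - i))"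
    by (simp add: ab(2) hasse_def T.taylor_mult T.taylor_inverse notin_prime(4)[OF ab(1)] fps_mult_nth)
  moreover have "fps_nth (inverse (taylor (shifted_t \<sigma>) (poly_in \<tau> b))) k \<in> O_x" for k
    by (rule fps_inverse_nth_closed[where R = O_x])
      (simp_all add: T.taylor_nth_0 notin_prime(4)[OF ab(1)] local_ring_closed(1-3) local_ring_closed(5)[OF ab(1)]
        local_ring_consts(1) poly[unfolded hasse_def])
  ultimately show ?thesis
    by (auto intro!: sum local_ring_closed poly)
qed

end

lemma chart_cases:
  assumes "x \<in> chart \<tau>"
  obtains P where "P \<in> prime_spec" "x = local_ring \<tau> P"
  using assms unfolding chart_def by blast

lemma chart_subset: "\<tau> \<in> coords \<Longrightarrow> chart \<tau> \<subseteq> proj_line"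
  unfolding proj_line_def by blast

lemma proj_line_cases:
  assumes "x \<in> proj_line"
  obtains \<tau> P where "chart_point \<tau> P" "x = local_ring \<tau> P"
  using assms unfolding proj_line_def by (auto elim!: chart_cases intro: chart_point.intro)

text \<open>Since \<open>regular V\<close> is the intersection of the points of \<open>V\<close>,
  regularity can be tested point by point.\<close>

lemma diffops_leI:
  assumes "order_le n D" "\<And>x f. x \<in> U \<Longrightarrow> f \<in> x \<Longrightarrow> D f \<in> x"
  shows "D \<in> diffops_le U n"
  using assms unfolding diffops_le_def regular_def by blast

lemma hasse_point: "\<tau> \<in> coords \<Longrightarrow> x \<in> proj_line \<Longrightarrow> f \<in> x \<Longrightarrow> hasse \<tau> n f \<in> x"
  by (elim proj_line_cases) (auto intro: chart_point.hasse_local)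

lemma carrier_diffops: "carrier (diffops U) = (\<Union>n. diffops_le U n)"
  by (simp add: diffops_def operator_algebra_def)

lemma divpow_deriv_eq:
  assumes "\<tau> \<in> coords"
  shows "divpow_deriv \<tau> n = hasse \<tau> n"
  unfolding divpow_deriv_def
proof (rule the_equality)
  have "hasse \<tau> n \<in> diffops_le (chart \<tau>) n"
    using chart_subset[OF assms] hasse_point[OF assms] by (intro diffops_leI order_hasse) blast
  then show "hasse \<tau> n \<in> carrier (diffops (chart \<tau>)) \<and> (\<forall>j. hasse \<tau> n (\<tau> ^ j) = of_nat (j choose n) * \<tau> ^ (j - n))"
    using hasse_power[OF assms] unfolding carrier_diffops by blast
next
  fix D assume D: "D \<in> carrier (diffops (chart \<tau>)) \<and> (\<forall>j. D (\<tau> ^ j) = of_nat (j choose n) * \<tau> ^ (j - n))"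
  then obtain k where "order_le k D" unfolding carrier_diffops diffops_le_def by blast
  then show "D = hasse \<tau> n"
    by (rule chart_operator_unique[OF assms _ order_hasse[of n \<tau>]]) (use D hasse_power[OF assms] in simp)
qed

section \<open>A representation of the enveloping algebra\<close>

text \<open>The function \<open>u\<close> stands for the series with \<open>u j\<close> as coefficient of the \<open>j\<close>-th power
  of \<open>t\<close>.\<close>

typedef series_endo = "{\<phi> :: (int \<Rightarrow> rat) \<Rightarrow> int \<Rightarrow> rat.
    (\<forall>u v. \<phi> (\<lambda>j. u j + v j) = (\<lambda>j. \<phi> u j + \<phi> v j)) \<and> (\<forall>c u. \<phi> (\<lambda>j. c * u j) = (\<lambda>j. c * \<phi> u j))}"
  by (rule exI[of _ "\<lambda>u. u"]) simp

setup_lifting type_definition_series_endo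

instantiation series_endo :: ring_1
begin

lift_definition zero_series_endo :: series_endo is "\<lambda>u j. 0" by simp
lift_definition one_series_endo :: series_endo is "\<lambda>u. u" by simp
lift_definition plus_series_endo :: "series_endo \<Rightarrow> series_endo \<Rightarrow> series_endo"
  is "\<lambda>\<phi> \<psi> u j. \<phi> u j + \<psi> u j" by (simp add: algebra_simps)
lift_definition minus_series_endo :: "series_endo \<Rightarrow> series_endo \<Rightarrow> series_endo"
  is "\<lambda>\<phi> \<psi> u j. \<phi> u j - \<psi> u j" by (simp add: algebra_simps)
lift_definition uminus_series_endo :: "series_endo \<Rightarrow> series_endo"
  is "\<lambda>\<phi> u j. - \<phi> u j" by simp
lift_definition times_series_endo :: "series_endo \<Rightarrow> series_endo \<Rightarrow> series_endo"
  is "\<lambda>\<phi> \<psi> u. \<phi> (\<psi> u)" by simp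

instance
proof
  fix a b c :: series_endo
  show "a + b + c = a + (b + c)" by transfer (simp add: add.assoc)
  show "a + b = b + a" by transfer (simp add: add.commute)
  show "0 + a = a" by transfer simp
  show "- a + a = 0" by transfer simp
  show "a - b = a + - b" by transfer simp
  show "a * b * c = a * (b * c)" by transfer simp
  show "1 * a = a" by transfer simp
  show "a * 1 = a" by transfer simp
  show "(a + b) * c = a * c + b * c" by transfer simp
  show "a * (b + c) = a * b + a * c" by transfer simp
  show "0 \<noteq> (1 :: series_endo)" by transfer (metis zero_neq_one)
qed

end

lift_definition series_scalar :: "rat \<Rightarrow> series_endo" is "\<lambda>c u j. c * u j"
  by (simp add: algebra_simps)

text \<open>The matrices E, F and H act as the derivations sending the \<open>j\<close>-th power of \<open>t\<close> to
  \<open>j t ^ (j - 1)\<close>, \<open>- j t ^ (j + 1)\<close> and \<open>- 2 j t ^ j\<close>.\<close>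

lift_definition series_act :: "mat2 \<Rightarrow> series_endo" is
  "\<lambda>A u j. A $ 1 $ 2 * ((of_int j + 1) * u (j + 1)) + A $ 2 $ 1 * ((1 - of_int j) * u (j - 1))
      + A $ 1 $ 1 * (- 2 * of_int j * u j)"
  by (simp add: algebra_simps)

lemma series_act_bracket:
  assumes "x \<in> carrier sl2" "y \<in> carrier sl2"
  shows "series_act (x ** y - y ** x) = series_act x * series_act y - series_act y * series_act x"
proof -
  \<comment> \<open>The action does not look at the lower right entry; the vanishing trace expresses
    it through the upper left one.\<close>
  have tr: "x $ 2 $ 2 = - x $ 1 $ 1" "y $ 2 $ 2 = - y $ 1 $ 1"
    using assms by (auto simp: sl2_def trace_def sum_2)
  have entries: "(x ** y - y ** x) $ 1 $ 1 = x $ 1 $ 2 * y $ 2 $ 1 - y $ 1 $ 2 * x $ 2 $ 1"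
    "(x ** y - y ** x) $ 1 $ 2 = 2 * (x $ 1 $ 1 * y $ 1 $ 2 - y $ 1 $ 1 * x $ 1 $ 2)"
    "(x ** y - y ** x) $ 2 $ 1 = 2 * (x $ 2 $ 1 * y $ 1 $ 1 - y $ 2 $ 1 * x $ 1 $ 1)"
    by (simp_all add: matrix_matrix_mult_def sum_2 tr algebra_simps)
  show ?thesis
    by (transfer fixing: x y, unfold entries, intro ext) (simp add: algebra_simps)
qed

interpretation series_eval: free_evaluation series_scalar series_act
proof
  fix a b v
  show "series_scalar (a + b) = series_scalar a + series_scalar b" by transfer (simp add: algebra_simps)
  show "series_scalar (a * b) = series_scalar a * series_scalar b" by transfer (simp add: algebra_simps)
  show "series_scalar 1 = 1" by transfer simp
  show "series_scalar a * series_act v = series_act v * series_scalar a" by transfer (simp add: algebra_simps)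
qed

text \<open>Evaluation on the free algebra descends twice: past the linearity relations because
  \<open>series_act\<close> is linear, and past the bracket relations by
  \<open>series_act_bracket\<close>.\<close>

lemma uea_rep_exists:
  obtains T :: "uea_alg \<Rightarrow> series_endo" where
    "\<And>x y. T (x + y) = T x + T y" "\<And>x y. T (x * y) = T x * T y" "T 1 = 1"
    "\<And>x. x \<in> carrier sl2 \<Longrightarrow> T (uea_of x) = series_act x" "\<And>c. T (uea_scal c) = series_scalar c"
proof -
  let ?ev = "free_eval series_scalar series_act"
  have hom: "?ev \<in> Ring.ring_hom (free_algebra (carrier sl2)) (type_ring :: series_endo ring)"
    by (rule ring_hom_memI)
      (simp_all add: series_eval.free_eval_add series_eval.free_eval_mult series_eval.free_eval_one)
  have zero: "?ev \<xi> = \<zero>\<^bsub>type_ring\<^esub>" if "\<xi> \<in> linearity_rels sl2" for \<xi>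
  proof -
    have "series_act (v + w) = series_act v + series_act w" for v w
      by transfer (simp add: algebra_simps)
    moreover have "series_act (c \<odot>\<^bsub>sl2\<^esub> v) = series_scalar c * series_act v" for c v
      unfolding sl2_def by transfer (simp add: algebra_simps)
    ultimately show ?thesis
      using that unfolding linearity_rels_def
      by (auto simp: series_eval.free_eval_diff series_eval.free_eval_mult series_eval.free_eval_letter
          series_eval.free_eval_scalar sl2_def)
  qed
  obtain h where h: "h \<in> Ring.ring_hom (tensor_algebra sl2) (type_ring :: series_endo ring)"
    and h_class: "\<And>\<xi>. \<xi> \<in> carrier (free_algebra (carrier sl2)) \<Longrightarrow> h (tensor_class sl2 \<xi>) = ?ev \<xi>"
    using sl2.tensor_algebra_lift[OF ring_type_ring hom zero] by blast
  have gen: "h (tensor_gen sl2 v) = series_act v" if "v \<in> carrier sl2" for v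
    using h_class[OF free_alg_closed(6)[OF that]] by (simp add: tensor_gen_def series_eval.free_eval_letter)
  have zero': "h z = \<zero>\<^bsub>type_ring\<^esub>" if "z \<in> uea_rels" for z
  proof -
    interpret TA: ring "tensor_algebra sl2" by (rule sl2.ring_tensor_algebra)
    from that obtain x y where xy: "x \<in> carrier sl2" "y \<in> carrier sl2"
      and z: "z = tensor_gen sl2 x \<otimes>\<^bsub>tensor_algebra sl2\<^esub> tensor_gen sl2 y
        \<ominus>\<^bsub>tensor_algebra sl2\<^esub> tensor_gen sl2 y \<otimes>\<^bsub>tensor_algebra sl2\<^esub> tensor_gen sl2 x
        \<ominus>\<^bsub>tensor_algebra sl2\<^esub> tensor_gen sl2 (x ** y - y ** x)"
      unfolding uea_rels_def Let_def by blast
    note c = sl2.tensor_closed(1)[OF xy(1)] sl2.tensor_closed(1)[OF xy(2)]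
      sl2.tensor_closed(1)[OF sl2_commutator_closed[of x y]]
    show ?thesis
      unfolding z using c
      by (simp add: ring_hom_a_minus[OF sl2.ring_tensor_algebra ring_type_ring h] ring_hom_mult[OF h]
          gen[OF xy(1)] gen[OF xy(2)] gen[OF sl2_commutator_closed] series_act_bracket[OF xy])
  qed
  obtain g where g: "g \<in> Ring.ring_hom uea_ring (type_ring :: series_endo ring)"
    and g_class: "\<And>y. y \<in> carrier (tensor_algebra sl2) \<Longrightarrow> g (ring_pres_class (tensor_algebra sl2) uea_rels y) = h y"
    using ring_pres_lift[OF sl2.ring_tensor_algebra uea_rels_carrier ring_type_ring h zero']
    unfolding uea_ring_def by blast
  show ?thesis
  proof (rule that[of "\<lambda>x. g (Rep_uea_alg x)"])
    fix x y :: uea_alg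
    show "g (Rep_uea_alg (x + y)) = g (Rep_uea_alg x) + g (Rep_uea_alg y)"
      using ring_hom_add[OF g Rep_uea_alg Rep_uea_alg] by (simp add: plus_uea_alg.rep_eq)
    show "g (Rep_uea_alg (x * y)) = g (Rep_uea_alg x) * g (Rep_uea_alg y)"
      using ring_hom_mult[OF g Rep_uea_alg Rep_uea_alg] by (simp add: times_uea_alg.rep_eq)
    show "g (Rep_uea_alg 1) = 1"
      using ring_hom_one[OF g] by (simp add: one_uea_alg.rep_eq)
  next
    fix x assume x: "x \<in> carrier sl2"
    show "g (Rep_uea_alg (uea_of x)) = series_act x"
      using g_class[OF sl2.tensor_closed(1)[OF x]] gen[OF x] by (simp add: Rep_uea_of[OF x] uea_gen_def)
  next
    fix c
    show "g (Rep_uea_alg (uea_scal c)) = series_scalar c"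
      using g_class[OF sl2.tensor_closed(2)[of c]] h_class[OF free_alg_closed(7)[of c]]
      by (simp add: uea_scal.rep_eq uea_scalar_def tensor_scalar_def series_eval.free_eval_scalar)
  qed
qed

definition uea_rep :: "uea_alg \<Rightarrow> series_endo" where
  "uea_rep = (SOME T. (\<forall>x y. T (x + y) = T x + T y) \<and> (\<forall>x y. T (x * y) = T x * T y) \<and> T 1 = 1 \<and>
    (\<forall>x \<in> carrier sl2. T (uea_of x) = series_act x) \<and> (\<forall>c. T (uea_scal c) = series_scalar c))"

lemma uea_rep:
  "uea_rep (x + y) = uea_rep x + uea_rep y" "uea_rep (x * y) = uea_rep x * uea_rep y" "uea_rep 1 = 1"
  "v \<in> carrier sl2 \<Longrightarrow> uea_rep (uea_of v) = series_act v" "uea_rep (uea_scal c) = series_scalar c"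
proof -
  let ?P = "\<lambda>T. (\<forall>x y. T (x + y) = T x + T y) \<and> (\<forall>x y. T (x * y) = T x * T y) \<and> T 1 = 1 \<and>
    (\<forall>x \<in> carrier sl2. T (uea_of x) = series_act x) \<and> (\<forall>c. T (uea_scal c) = series_scalar c)"
  have "\<exists>T. ?P T"
    by (rule uea_rep_exists) blast
  then have "?P uea_rep"
    unfolding uea_rep_def by (rule someI_ex)
  then show "uea_rep (x + y) = uea_rep x + uea_rep y" "uea_rep (x * y) = uea_rep x * uea_rep y"
    "uea_rep 1 = 1" "v \<in> carrier sl2 \<Longrightarrow> uea_rep (uea_of v) = series_act v"
    "uea_rep (uea_scal c) = series_scalar c"
    by blast+
qed

section \<open>The action on Laurent monomials\<close>

definition acts :: "uea_alg \<Rightarrow> (int \<Rightarrow> rat) \<Rightarrow> int \<Rightarrow> rat" where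
  "acts x = Rep_series_endo (uea_rep x)"

lemma acts_simps:
  "acts (x + y) u j = acts x u j + acts y u j" "acts (x * y) u = acts x (acts y u)" "acts 1 u = u"
  "acts (uea_scal c) u j = c * u j"
  by (simp_all add: acts_def uea_rep plus_series_endo.rep_eq times_series_endo.rep_eq
      one_series_endo.rep_eq series_scalar.rep_eq)

lemma acts_linear:
  "acts x (\<lambda>j. u j + v j) = (\<lambda>j. acts x u j + acts x v j)" "acts x (\<lambda>j. c * u j) = (\<lambda>j. c * acts x u j)"
  using Rep_series_endo[of "uea_rep x"] by (simp_all add: acts_def)

lemma acts_uminus: "acts (- x) u j = - acts x u j"
proof -
  have "acts 0 u j = 0" using acts_simps(1)[of 0 0 u j] by simp
  then show ?thesis using acts_simps(1)[of "- x" x u j] by simp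
qed

definition delta :: "int \<Rightarrow> int \<Rightarrow> rat" where
  "delta k j = (if j = k then 1 else 0)"

lemma acts_gens:
  "acts (uea_of sl2_E) (delta k) = (\<lambda>j. of_int k * delta (k - 1) j)"
  "acts (uea_of sl2_F) (delta k) = (\<lambda>j. - of_int k * delta (k + 1) j)"
  "acts (uea_of sl2_H) (delta k) = (\<lambda>j. - 2 * of_int k * delta k j)"
proof -
  have act: "acts (uea_of v) u j = v $ 1 $ 2 * ((of_int j + 1) * u (j + 1)) + v $ 2 $ 1 * ((1 - of_int j) * u (j - 1))
      + v $ 1 $ 1 * (- 2 * of_int j * u j)" if "v \<in> carrier sl2" for v u j
    using that by (simp add: acts_def uea_rep series_act.rep_eq)
  show "acts (uea_of sl2_E) (delta k) = (\<lambda>j. of_int k * delta (k - 1) j)"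
    unfolding act[OF sl2_carriers(1), abs_def] by (auto simp: delta_def sl2_E_def)
  show "acts (uea_of sl2_F) (delta k) = (\<lambda>j. - of_int k * delta (k + 1) j)"
    unfolding act[OF sl2_carriers(2), abs_def] by (auto simp: delta_def sl2_F_def)
  show "acts (uea_of sl2_H) (delta k) = (\<lambda>j. - 2 * of_int k * delta k j)"
    unfolding act[OF sl2_carriers(3), abs_def] by (auto simp: delta_def sl2_H_def)
qed

lemma gchoose_step: "(a gchoose n) * (a - of_nat n) = of_nat (Suc n) * (a gchoose Suc n)" for a :: rat
  by (metis gbinomial_absorb_comp gbinomial_absorption mult.commute)

lemma acts_dp_E: "acts (uea_dp (uea_of sl2_E) n) (delta k) = (\<lambda>j. (of_int k gchoose n) * delta (k - int n) j)"
proof (induction n)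
  case 0
  then show ?case by (simp add: uea.dp_0 acts_simps)
next
  case (Suc n)
  have "acts (uea_scal (of_nat (Suc n)) * uea_dp (uea_of sl2_E) (Suc n)) (delta k)
      = acts (uea_of sl2_E) (acts (uea_dp (uea_of sl2_E) n) (delta k))"
    by (simp only: uea.dp_Suc[symmetric] acts_simps)
  also have "\<dots> = (\<lambda>j. ((of_int k gchoose n) * (of_int k - of_nat n)) * delta (k - int n - 1) j)"
    by (simp add: Suc acts_linear acts_gens mult.assoc)
  finally have "of_nat (Suc n) * acts (uea_dp (uea_of sl2_E) (Suc n)) (delta k) j
      = of_nat (Suc n) * ((of_int k gchoose Suc n) * delta (k - int (Suc n)) j)" for j
    unfolding gchoose_step by (simp add: fun_eq_iff acts_simps mult.assoc diff_diff_add add.commute del: of_nat_Suc) simp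
  then show ?case
    by (simp only: mult_left_cancel of_nat_neq_0 not_False_eq_True fun_eq_iff) simp
qed

lemma acts_dp_F: "acts (uea_dp (uea_of sl2_F) n) (delta k) = (\<lambda>j. (of_int (- k) gchoose n) * delta (k + int n) j)"
proof (induction n)
  case 0
  then show ?case by (simp add: uea.dp_0 acts_simps)
next
  case (Suc n)
  have "acts (uea_scal (of_nat (Suc n)) * uea_dp (uea_of sl2_F) (Suc n)) (delta k)
      = acts (uea_of sl2_F) (acts (uea_dp (uea_of sl2_F) n) (delta k))"
    by (simp only: uea.dp_Suc[symmetric] acts_simps)
  also have "\<dots> = (\<lambda>j. ((of_int (- k) gchoose n) * (of_int (- k) - of_nat n)) * delta (k + int n + 1) j)"
    by (simp add: Suc acts_linear acts_gens mult.assoc algebra_simps)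
  finally have "of_nat (Suc n) * acts (uea_dp (uea_of sl2_F) (Suc n)) (delta k) j
      = of_nat (Suc n) * ((of_int (- k) gchoose Suc n) * delta (k + int n + 1) j)" for j
    unfolding gchoose_step by (simp add: fun_eq_iff acts_simps mult.assoc del: of_nat_Suc)
  moreover have "k + int (Suc n) = k + int n + 1" by simp
  ultimately show ?case
    by (simp only: mult_left_cancel of_nat_neq_0 not_False_eq_True fun_eq_iff) simp
qed

lemma acts_pev: "acts (uea_pev P) (delta k) = (\<lambda>j. poly P (- 2 * of_int k) * delta k j)"
proof (induction P)
  case 0
  show ?case using acts_simps(1)[of 0 0] by (simp add: fun_eq_iff)
next
  case (pCons a P)
  have "acts (uea_of sl2_H * uea_pev P) (delta k) = (\<lambda>j. poly P (- 2 * of_int k) * (- 2 * of_int k * delta k j))"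
    by (simp only: acts_simps pCons.IH acts_linear acts_gens)
  then show ?case
    by (simp only: uea.pev_pCons acts_simps(1,4) fun_eq_iff) (simp add: algebra_simps)
qed


section \<open>Reduction modulo p\<close>

definition red :: "(int \<Rightarrow>\<^sub>0 int) \<Rightarrow> 'p::prime_card fun_field" where
  "red f = (\<Sum>j \<in> Poly_Mapping.keys f. of_int (Poly_Mapping.lookup f j) * coord_t powi j)"

definition rat_series :: "(int \<Rightarrow>\<^sub>0 int) \<Rightarrow> int \<Rightarrow> rat" where
  "rat_series f j = of_int (Poly_Mapping.lookup f j)"

lemma rat_series_inj: "rat_series f = rat_series g \<Longrightarrow> f = g"
  by (rule poly_mapping_eqI) (simp add: rat_series_def fun_eq_iff)

lemma rat_series_add: "rat_series (f + g) = (\<lambda>j. rat_series f j + rat_series g j)"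
  by (simp add: rat_series_def fun_eq_iff lookup_add)

lemma rat_series_single: "rat_series (Poly_Mapping.single k c) = (\<lambda>j. of_int c * delta k j)"
  by (auto simp: rat_series_def fun_eq_iff lookup_single delta_def when_def)

lemma red_superset:
  "finite A \<Longrightarrow> Poly_Mapping.keys f \<subseteq> A \<Longrightarrow> red f = (\<Sum>j\<in>A. of_int (Poly_Mapping.lookup f j) * coord_t powi j)"
  unfolding red_def by (rule sum.mono_neutral_left) (auto simp: in_keys_iff)

lemma red_add: "red (f + g) = red f + red g"
proof -
  let ?A = "Poly_Mapping.keys f \<union> Poly_Mapping.keys g"
  show ?thesis
    using Poly_Mapping.keys_add[of f g]
    by (simp add: red_superset[of ?A] lookup_add distrib_right sum.distrib)
qed

lemma red_single: "red (Poly_Mapping.single k c) = of_int c * coord_t powi k"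
  by (simp add: red_superset[of "{k}"])

text \<open>\<open>D\<close> is the reduction modulo p of the action of \<open>x\<close> on Laurent polynomials with integer
  coefficients.\<close>

definition reduces_to :: "uea_alg \<Rightarrow> 'p::prime_card operator \<Rightarrow> bool" where
  "reduces_to x D \<longleftrightarrow> (\<forall>f. \<exists>g. acts x (rat_series f) = rat_series g \<and> D (red f) = red g)"

lemma reduces_to_add: "reduces_to x D \<Longrightarrow> reduces_to y D' \<Longrightarrow> reduces_to (x + y) (\<lambda>f. D f + D' f)"
  unfolding reduces_to_def by (metis (no_types, lifting) ext acts_simps(1) rat_series_add red_add)

lemma reduces_to_mult: "reduces_to x D \<Longrightarrow> reduces_to y D' \<Longrightarrow> reduces_to (x * y) (D \<circ> D')"
  unfolding reduces_to_def comp_def by (metis acts_simps(2))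

lemma reduces_to_one: "reduces_to 1 id"
  unfolding reduces_to_def by (auto simp: acts_simps)

lemma reduces_to_uminus: "reduces_to x D \<Longrightarrow> reduces_to (- x) (\<lambda>f. - D f)"
proof -
  assume x: "reduces_to x D"
  have "rat_series (- g) = (\<lambda>j. - rat_series g j)" "red (- g) = (- red g :: 'a fun_field)" for g
    by (simp_all add: rat_series_def fun_eq_iff red_def sum_negf)
  with x show ?thesis
    unfolding reduces_to_def by (metis (no_types, lifting) ext acts_uminus)
qed

text \<open>Both actions are additive and compatible with integers, so monomials suffice. The
  integer scalars \<open>c k\<close> show at the same time that \<open>x\<close> preserves integral
  Laurent polynomials.\<close>

lemma reduces_to_monomials:
  assumes D: "k_linear D"
    and act: "\<And>k. acts x (delta k) = (\<lambda>j. of_int (c k) * delta (s k) j)"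
    and D_t: "\<And>k. D (coord_t powi k) = of_int (c k) * coord_t powi (s k)"
  shows "reduces_to x D"
  unfolding reduces_to_def
proof
  fix f :: "int \<Rightarrow>\<^sub>0 int"
  show "\<exists>g. acts x (rat_series f) = rat_series g \<and> D (red f) = red g"
  proof (induction f rule: poly_mapping_single_induct)
    case zero
    have "acts x (\<lambda>j. 0) = (\<lambda>j. 0)" using acts_linear(2)[of x 0 "\<lambda>_. 0"] by simp
    then show ?case
      by (intro exI[of _ 0]) (simp add: rat_series_def[abs_def] red_def k_linear_zero[OF D])
  next
    case (single k z)
    have "D (of_int z * coord_t powi k) = of_int z * D (coord_t powi k)"
      using D unfolding k_linear_def by (metis const_of_int)
    then show ?case
      by (intro exI[of _ "Poly_Mapping.single (s k) (z * c k)"])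
        (simp add: rat_series_single acts_linear act red_single D_t mult.assoc)
  next
    case (add a b)
    then obtain g g' where "acts x (rat_series a) = rat_series g" "D (red a) = red g"
      "acts x (rat_series b) = rat_series g'" "D (red b) = red g'" by blast
    then show ?case
      using D by (intro exI[of _ "g + g'"]) (simp add: rat_series_add acts_linear red_add k_linear_def)
  qed
qed

text \<open>The integral Laurent polynomial witnessing the reduction is determined by the action of
  \<open>x\<close>, so it is the same one for \<open>D\<close> and \<open>D'\<close>.\<close>

lemma reduces_to_power:
  assumes "reduces_to x D" "reduces_to x D'"
  shows "D (coord_t ^ j) = D' (coord_t ^ j)"
  using assms rat_series_inj red_single[of "int j" 1] unfolding reduces_to_def
  by (metis (no_types, lifting) mult_1 of_int_1 power_int_of_nat)

lemma reduces_to_unique: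
  "reduces_to x D \<Longrightarrow> reduces_to x D' \<Longrightarrow> order_le n D \<Longrightarrow> order_le m D' \<Longrightarrow> D = D'"
  using chart_operator_unique[of coord_t n D m D'] reduces_to_power[of x D D']
  by (simp add: coords_def)

section \<open>Algebras of differential operators\<close>

lemma point_closed:
  assumes "x \<in> proj_line" "f \<in> x" "g \<in> x"
  shows "f + g \<in> x" "f * g \<in> x" "- f \<in> x" "0 \<in> x" "const c \<in> x" "of_int z \<in> x"
  using assms by (auto elim!: proj_line_cases
      intro: chart_point.local_ring_closed(1-3) chart_point.local_ring_consts(1,3,5))

lemma diffops_le_iff:
  "D \<in> diffops_le U n \<longleftrightarrow> order_le n D \<and>
     (\<forall>V f. zariski_open V \<longrightarrow> V \<noteq> {} \<longrightarrow> V \<subseteq> U \<longrightarrow> f \<in> regular V \<longrightarrow> D f \<in> regular V)"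
  unfolding diffops_le_def by (auto simp: image_subset_iff)

lemma regular_closed:
  assumes "zariski_open V" "f \<in> regular V" "g \<in> regular V"
  shows "f + g \<in> regular V" "const c * f \<in> regular V" "- f \<in> regular V" "0 \<in> regular V"
proof -
  have "V \<subseteq> proj_line" using assms(1) by (simp add: zariski_open_def)
  moreover have "f \<in> x" "g \<in> x" if "x \<in> V" for x
    using assms(2,3) that by (auto simp: regular_def)
  ultimately have "f + g \<in> x" "const c * f \<in> x" "- f \<in> x" "0 \<in> x" if "x \<in> V" for x
    using that point_closed(1)[of x f g] point_closed(2)[of x "const c" f] point_closed(3,4,5)[of x f f]
    by auto
  then show "f + g \<in> regular V" "const c * f \<in> regular V" "- f \<in> regular V" "0 \<in> regular V"
    by (auto simp: regular_def)
qed

lemma diffops_le_add: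
  "D \<in> diffops_le U n \<Longrightarrow> D' \<in> diffops_le U n \<Longrightarrow> (\<lambda>f. D f + D' f) \<in> diffops_le U n"
  unfolding diffops_le_iff using order_le_add regular_closed(1) by blast

lemma diffops_le_smult: "D \<in> diffops_le U n \<Longrightarrow> (\<lambda>f. const c * D f) \<in> diffops_le U n"
  unfolding diffops_le_iff by (auto intro: order_le_lmult regular_closed(2) simp del: order_le.simps)

lemma diffops_le_uminus: "D \<in> diffops_le U n \<Longrightarrow> (\<lambda>f. - D f) \<in> diffops_le U n"
  using diffops_le_smult[of D U n "-1"] by (simp add: const_hom)

lemma diffops_le_comp: "D \<in> diffops_le U m \<Longrightarrow> D' \<in> diffops_le U n \<Longrightarrow> D \<circ> D' \<in> diffops_le U (m + n)"
  unfolding diffops_le_iff by (auto intro: order_le_comp simp del: order_le.simps)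

lemma diffops_le_mono: "n \<le> m \<Longrightarrow> D \<in> diffops_le U n \<Longrightarrow> D \<in> diffops_le U m"
  unfolding diffops_le_iff by (auto intro: order_le_mono simp del: order_le.simps)

lemma diffops_le_restrict: "V \<subseteq> U \<Longrightarrow> D \<in> diffops_le U n \<Longrightarrow> D \<in> diffops_le V n"
  unfolding diffops_le_iff by blast

lemma diffops_le_zero: "(\<lambda>_. 0) \<in> diffops_le U n"
  unfolding diffops_le_iff using order_le_zero regular_closed(4) by blast

lemma diffops_le_id: "id \<in> diffops_le U 0"
  unfolding diffops_le_iff by (auto simp: k_linear_def)

text \<open>Regularity comes from the two composites, whose order bound \<open>m + n\<close> is one
  too large; the sharp bound comes from \<open>order_le_commutator\<close>.\<close>

lemma diffops_le_commutator:
  assumes "D \<in> diffops_le U m" "D' \<in> diffops_le U n"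
  shows "(\<lambda>f. D (D' f) - D' (D f)) \<in> diffops_le U (m + n - 1)"
proof -
  have "D' \<circ> D \<in> diffops_le U (m + n)"
    using diffops_le_comp[OF assms(2,1)] by (simp only: add.commute)
  then have "(\<lambda>f. (D \<circ> D') f + - (D' \<circ> D) f) \<in> diffops_le U (m + n)"
    by (rule diffops_le_add[OF diffops_le_comp[OF assms] diffops_le_uminus])
  moreover have "order_le (m + n - 1) (\<lambda>f. D (D' f) - D' (D f))"
    by (rule order_le_commutator) (use assms in \<open>auto simp: diffops_le_iff simp del: order_le.simps\<close>)
  ultimately show ?thesis
    unfolding diffops_le_iff by simp
qed

lemma operator_algebra_simps [simp]:
  "carrier (operator_algebra C) = C" "D \<otimes>\<^bsub>operator_algebra C\<^esub> D' = D \<circ> D'"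
  "\<one>\<^bsub>operator_algebra C\<^esub> = id" "\<zero>\<^bsub>operator_algebra C\<^esub> = (\<lambda>_. 0)"
  "D \<oplus>\<^bsub>operator_algebra C\<^esub> D' = (\<lambda>f. D f + D' f)"
  "c \<odot>\<^bsub>operator_algebra C\<^esub> D = (\<lambda>f. const c * D f)"
  by (simp_all add: operator_algebra_def)

text \<open>A common frame for operators over an open set and for germs at a point. Linearity is
  what distributivity of composition over a sum on the right requires.\<close>

locale operator_subalgebra =
  fixes C :: "'p::prime_card operator set"
  assumes k_lin: "D \<in> C \<Longrightarrow> k_linear D"
    and add: "D \<in> C \<Longrightarrow> D' \<in> C \<Longrightarrow> (\<lambda>f. D f + D' f) \<in> C"
    and uminus: "D \<in> C \<Longrightarrow> (\<lambda>f. - D f) \<in> C"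
    and comp: "D \<in> C \<Longrightarrow> D' \<in> C \<Longrightarrow> D \<circ> D' \<in> C"
    and id: "id \<in> C" and zero: "(\<lambda>_. 0) \<in> C"
begin

lemma ring_operator_algebra: "ring (operator_algebra C)"
proof (rule ringI)
  show "abelian_group (operator_algebra C)"
  proof (rule abelian_groupI)
    fix D assume "D \<in> carrier (operator_algebra C)"
    then show "\<exists>D'\<in>carrier (operator_algebra C). D' \<oplus>\<^bsub>operator_algebra C\<^esub> D = \<zero>\<^bsub>operator_algebra C\<^esub>"
      using uminus by (auto intro!: bexI[of _ "\<lambda>f. - D f"])
  qed (auto simp: add zero algebra_simps)
  show "monoid (operator_algebra C)"
    by (rule monoidI) (auto simp: comp id)
next
  fix D1 D2 D3
  assume "D1 \<in> carrier (operator_algebra C)" "D2 \<in> carrier (operator_algebra C)" "D3 \<in> carrier (operator_algebra C)"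
  then show "D3 \<otimes>\<^bsub>operator_algebra C\<^esub> (D1 \<oplus>\<^bsub>operator_algebra C\<^esub> D2)
      = D3 \<otimes>\<^bsub>operator_algebra C\<^esub> D1 \<oplus>\<^bsub>operator_algebra C\<^esub> D3 \<otimes>\<^bsub>operator_algebra C\<^esub> D2"
    using k_lin[of D3] by (auto simp: fun_eq_iff k_linear_def)
qed (auto simp: fun_eq_iff)

lemma operator_minus:
  assumes "D \<in> C" "D' \<in> C"
  shows "D \<ominus>\<^bsub>operator_algebra C\<^esub> D' = (\<lambda>f. D f - D' f)"
proof -
  interpret ring "operator_algebra C" by (rule ring_operator_algebra)
  have "\<ominus>\<^bsub>operator_algebra C\<^esub> D' = (\<lambda>f. - D' f)"
    using minus_equality[of "\<lambda>f. - D' f" D'] assms uminus by simp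
  then show ?thesis by (simp add: a_minus_def)
qed

end

lemma diffops_subalgebra: "operator_subalgebra (\<Union>n. diffops_le U n)"
proof
  fix D D' :: "'a operator"
  assume "D \<in> (\<Union>n. diffops_le U n)"
  then obtain m where m: "D \<in> diffops_le U m" by blast
  then show "k_linear D" unfolding diffops_le_def using order_le_k_linear by blast
  show "(\<lambda>f. - D f) \<in> (\<Union>n. diffops_le U n)" using diffops_le_uminus[OF m] by blast
  assume "D' \<in> (\<Union>n. diffops_le U n)"
  then obtain n where n: "D' \<in> diffops_le U n" by blast
  show "D \<circ> D' \<in> (\<Union>n. diffops_le U n)" using diffops_le_comp[OF m n] by blast
  have "(\<lambda>f. D f + D' f) \<in> diffops_le U (max m n)"
    by (intro diffops_le_add diffops_le_mono[OF _ m] diffops_le_mono[OF _ n]) auto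
  then show "(\<lambda>f. D f + D' f) \<in> (\<Union>n. diffops_le U n)" by blast
qed (use diffops_le_id diffops_le_zero in blast)+

lemma ring_diffops: "ring (diffops U)"
  unfolding diffops_def by (rule operator_subalgebra.ring_operator_algebra[OF diffops_subalgebra])


section \<open>The canonical morphism\<close>

text \<open>The operator \<open>\<tau>^k\<close> times the Hasse derivative of order
  \<open>k\<close> multiplies the power \<open>j\<close> of \<tau> by the binomial of
  \<open>j\<close> over \<open>k\<close>. Newton's expansion of \<open>Q\<close> thus writes the
  operator with eigenvalues \<open>Q j\<close> as an integral combination of these.\<close>

lemma diagonal_operator:
  assumes \<tau>: "\<tau> \<in> coords" and Q: "intval Q"
  obtains D c where "order_le (degree Q) D" "\<And>x f. x \<in> chart \<tau> \<Longrightarrow> f \<in> x \<Longrightarrow> D f \<in> x"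
    "\<And>j. of_int (c j) = poly Q (of_int j)" "\<And>j. D (\<tau> powi j) = of_int (c j) * \<tau> powi j"
proof -
  obtain z where z: "Q = (\<Sum>k\<le>degree Q. smult (of_int (z k)) (pbin k))"
    using newton_expansion[OF Q] .
  let ?D = "\<lambda>f. \<Sum>k\<le>degree Q. of_int (z k) * \<tau> ^ k * hasse \<tau> k f"
  let ?c = "\<lambda>j. \<Sum>k\<le>degree Q. z k * ibinom j k"
  show ?thesis
  proof (rule that[of ?D ?c])
    show "order_le (degree Q) ?D"
      by (intro order_le_sum order_le_lmult order_le_mono[OF _ order_hasse]) simp
    show "?D f \<in> x" if x: "x \<in> chart \<tau>" and f: "f \<in> x" for x f
    proof -
      obtain P where x: "x = local_ring \<tau> P" and P: "chart_point \<tau> P"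
        using chart_cases[OF x] chart_point.intro[OF \<tau>] by metis
      interpret chart_point \<tau> P by (rule P)
      have "(\<Sum>k\<in>A. of_int (z k) * \<tau> ^ k * hasse \<tau> k f) \<in> local_ring \<tau> P" for A
        using f unfolding x
        by (induction A rule: infinite_finite_induct)
          (auto intro!: local_ring_closed(1,2) local_ring_consts hasse_local \<tau>)
      then show ?thesis unfolding x .
    qed
    show "of_int (?c j) = poly Q (of_int j)" for j
    proof -
      have "poly Q (of_int j) = poly (\<Sum>k\<le>degree Q. smult (of_int (z k)) (pbin k)) (of_int j)"
        using z by simp
      then show ?thesis by (simp add: poly_sum poly_pbin of_int_ibinom)
    qed
    show "?D (\<tau> powi j) = of_int (?c j) * \<tau> powi j" for j
    proof -
      have "\<tau> ^ k * \<tau> powi (j - int k) = \<tau> powi j" for k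
        using power_int_add[of \<tau> "int k" "j - int k"] coords_nz[OF \<tau>] by simp
      then have "of_int (z k) * \<tau> ^ k * hasse \<tau> k (\<tau> powi j) = of_int (z k * ibinom j k) * \<tau> powi j" for k
        by (simp add: hasse_powi[OF \<tau>] mult.assoc mult.left_commute[of "\<tau> ^ k"])
      then have "?D (\<tau> powi j) = (\<Sum>k\<le>degree Q. of_int (z k * ibinom j k) * \<tau> powi j)"
        by (intro sum.cong refl)
      then show ?thesis by (simp add: sum_distrib_right)
    qed
  qed
qed

lemma reduces_to_E: "reduces_to (uea_dp (uea_of sl2_E) n) (hasse coord_t n)"
proof (rule reduces_to_monomials)
  show "k_linear (hasse coord_t n)" by (rule order_le_k_linear[OF order_hasse])
  show "acts (uea_dp (uea_of sl2_E) n) (delta k) = (\<lambda>j. of_int (ibinom k n) * delta (k - int n) j)" for k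
    by (simp add: acts_dp_E of_int_ibinom)
  show "hasse coord_t n (coord_t powi k) = of_int (ibinom k n) * coord_t powi (k - int n)" for k
    by (rule hasse_powi) (simp add: coords_def)
qed

lemma inverse_t_powi: "inverse coord_t powi k = coord_t powi (- k)"
  by (simp add: power_int_minus power_int_inverse)

lemma reduces_to_F: "reduces_to (uea_dp (uea_of sl2_F) n) (hasse (inverse coord_t) n)"
proof (rule reduces_to_monomials)
  show "k_linear (hasse (inverse coord_t) n)" by (rule order_le_k_linear[OF order_hasse])
  show "acts (uea_dp (uea_of sl2_F) n) (delta k) = (\<lambda>j. of_int (ibinom (- k) n) * delta (k + int n) j)" for k
    by (simp add: acts_dp_F of_int_ibinom)
  show "hasse (inverse coord_t) n (coord_t powi k) = of_int (ibinom (- k) n) * coord_t powi (k + int n)" for k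
    using hasse_powi[of "inverse coord_t" n "- k"] by (simp add: coords_def inverse_t_powi add.commute)
qed

text \<open>The two charts give two expressions for this operator, each of which is regular on its own
  chart.\<close>

lemma reduces_to_H:
  assumes P: "intval P"
  obtains D :: "'p::prime_card operator"
  where "D \<in> diffops_le proj_line (degree P)" "reduces_to (uea_pev P) D"
proof -
  \<comment> \<open>H has eigenvalue \<open>- 2 j\<close> on \<open>t^j\<close> and
    \<open>2 j\<close> on the power \<open>j\<close> of \<open>1 / t\<close>; this explains the
    substitutions with \<open>- 2\<close> and \<open>2\<close>.\<close>
  let ?Q = "\<lambda>e. pcompose P [:0, e:]"
  have Q: "intval (?Q (- 2))" "intval (?Q 2)"
    using intval_pcompose[OF P, of 0 "-2"] intval_pcompose[OF P, of 0 2] by simp_all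
  have deg: "degree (?Q (- 2)) = degree P" "degree (?Q 2) = degree P"
    by (simp_all add: degree_pcompose)
  obtain D :: "'p operator" and c where D: "order_le (degree P) D" "\<And>x f. x \<in> chart coord_t \<Longrightarrow> f \<in> x \<Longrightarrow> D f \<in> x"
    and c: "\<And>j. of_int (c j) = poly (?Q (- 2)) (of_int j)" "\<And>j. D (coord_t powi j) = of_int (c j) * coord_t powi j"
    using diagonal_operator[OF _ Q(1), of coord_t] unfolding deg coords_def by blast
  obtain D' :: "'p operator" and c' where D': "order_le (degree P) D'" "\<And>x f. x \<in> chart (inverse coord_t) \<Longrightarrow> f \<in> x \<Longrightarrow> D' f \<in> x"
    and c': "\<And>j. of_int (c' j) = poly (?Q 2) (of_int j)"
      "\<And>j. D' (inverse coord_t powi j) = of_int (c' j) * inverse coord_t powi j"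
    using diagonal_operator[OF _ Q(2), of "inverse coord_t"] unfolding deg coords_def by blast
  have "(of_int (c' (- j)) :: rat) = of_int (c j)" for j
    by (simp add: c c' poly_pcompose mult.commute)
  then have cc': "c' (- j) = c j" for j by (simp only: of_int_eq_iff)
  have "D' (coord_t powi j) = D (coord_t powi j)" for j
    using c'(2)[of "- j"] by (simp add: inverse_t_powi cc' c(2))
  then have "D' (coord_t ^ j) = D (coord_t ^ j)" for j
    by (metis power_int_of_nat)
  then have "D' = D"
    by (rule chart_operator_unique[OF _ D'(1) D(1), rotated]) (simp add: coords_def)
  then have "D f \<in> x" if "x \<in> proj_line" "f \<in> x" for x f
    using that D(2) D'(2) unfolding proj_line_def coords_def by blast
  then have "D \<in> diffops_le proj_line (degree P)"
    by (intro diffops_leI D(1))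
  moreover have "reduces_to (uea_pev P) D"
  proof (rule reduces_to_monomials)
    show "k_linear D" by (rule order_le_k_linear[OF D(1)])
    show "acts (uea_pev P) (delta k) = (\<lambda>j. of_int (c k) * delta k j)" for k
      by (simp add: acts_pev c poly_pcompose mult.commute)
    show "D (coord_t powi k) = of_int (c k) * coord_t powi k" for k by (rule c(2))
  qed
  ultimately show ?thesis using that by blast
qed

lemma hasse_diffops: "\<tau> \<in> coords \<Longrightarrow> hasse \<tau> n \<in> diffops_le proj_line n"
  by (intro diffops_leI order_hasse hasse_point)

text \<open>The three factors of a basis element reduce to operators of orders \<open>a\<close>,
  \<open>b\<close> and \<open>c\<close>, which add under composition. This yields the order
  condition on \<open>rho\<close>.\<close>

lemma kspan_reduces:
  assumes "x \<in> uea_kspan n"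
  shows "\<exists>D \<in> diffops_le proj_line n. reduces_to x (D :: 'p::prime_card operator)"
  using assms unfolding uea.kspan_eq
proof (induction x rule: zspan.induct)
  case zero
  have "reduces_to 0 (\<lambda>_. 0 :: 'p fun_field)"
    using reduces_to_add[OF reduces_to_one reduces_to_uminus[OF reduces_to_one]] by simp
  then show ?case using diffops_le_zero by blast
next
  case (base x)
  then obtain a b c where x: "x = uea_dp (uea_of sl2_E) a * uea_pev (pbin b) * uea_dp (uea_of sl2_F) c"
    and n: "a + b + c \<le> n" unfolding uea.kbasis_def by blast
  obtain D :: "'p operator" where D: "D \<in> diffops_le proj_line b" "reduces_to (uea_pev (pbin b)) D"
    using reduces_to_H[OF intval_pbin, of b] unfolding degree_pbin by blast
  have "hasse coord_t a \<circ> D \<circ> hasse (inverse coord_t) c \<in> diffops_le proj_line (a + b + c)"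
    by (intro diffops_le_comp D hasse_diffops) (simp_all add: coords_def)
  moreover have "reduces_to x (hasse coord_t a \<circ> D \<circ> hasse (inverse coord_t) c)"
    unfolding x by (intro reduces_to_mult reduces_to_E reduces_to_F D)
  ultimately show ?case using diffops_le_mono[OF n] by blast
next
  case (add x y)
  then show ?case using reduces_to_add diffops_le_add by blast
next
  case (uminus x)
  then show ?case using reduces_to_uminus diffops_le_uminus by blast
qed

text \<open>Follows the inductive generation of the Kostant form and claims no specific bound on the
  order. It makes \<open>rho\<close> available on the whole algebra of distributions, the orders
  being left to \<open>kspan_reduces\<close>.\<close>

lemma kostant_reduces:
  assumes "y \<in> carrier kostant_ring"
  shows "\<exists>D \<in> carrier (diffops proj_line). reduces_to (Abs_uea_alg y) (D :: 'p::prime_card operator)"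
proof -
  let ?C = "\<Union>n. diffops_le proj_line n :: 'p operator set"
  interpret operator_subalgebra ?C by (rule diffops_subalgebra)
  let ?G = "range (uea_divpow sl2_E) \<union> range (uea_binom sl2_H) \<union> range (uea_divpow sl2_F)"
  have "y \<in> generate_ring uea_ring ?G" using assms by (simp add: kostant_ring_def)
  then have "y \<in> carrier uea_ring \<and> (\<exists>D \<in> ?C. reduces_to (Abs_uea_alg y) D)"
  proof (induction y rule: generate_ring.induct)
    case one
    have "Abs_uea_alg \<one>\<^bsub>uea_ring\<^esub> = 1" by (simp add: one_uea_alg_def)
    then show ?case
      using reduces_to_one id ring.ring_simprules(6)[OF ring_uea] by auto
  next
    case (incl y)
    have hC: "hasse coord_t n \<in> ?C" "hasse (inverse coord_t) n \<in> ?C" for n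
      using hasse_diffops[of coord_t] hasse_diffops[of "inverse coord_t"] by (auto simp: coords_def)
    have "Abs_uea_alg (uea_divpow sl2_E n) = uea_dp (uea_of sl2_E) n"
      "Abs_uea_alg (uea_divpow sl2_F n) = uea_dp (uea_of sl2_F) n"
      "Abs_uea_alg (uea_binom sl2_H n) = uea_pev (pbin n)" for n
      by (simp_all add: Rep_uea_alg_inverse flip: Rep_uea_dp[OF sl2_carriers(1)] Rep_uea_dp[OF sl2_carriers(2)] Rep_uea_binom)
    moreover have "\<exists>D \<in> ?C. reduces_to (uea_pev (pbin n)) D" for n
    proof -
      obtain D :: "'p operator" where "D \<in> diffops_le proj_line (degree (pbin n))" "reduces_to (uea_pev (pbin n)) D"
        by (rule reduces_to_H[OF intval_pbin])
      then show ?thesis by blast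
    qed
    moreover have "\<exists>D \<in> ?C. reduces_to (uea_dp (uea_of sl2_E) n) D" for n
      using hC(1) reduces_to_E by blast
    moreover have "\<exists>D \<in> ?C. reduces_to (uea_dp (uea_of sl2_F) n) D" for n
      using hC(2) reduces_to_F by blast
    ultimately have "\<exists>D \<in> ?C. reduces_to (Abs_uea_alg y) D"
      using incl by (elim UnE rangeE) (simp_all only:)
    then show ?case using incl kostant_gens_carrier by blast
  next
    case (a_inv y)
    then obtain D where D: "D \<in> ?C" "reduces_to (Abs_uea_alg y) D" and y: "y \<in> carrier uea_ring" by blast
    have "Abs_uea_alg (\<ominus>\<^bsub>uea_ring\<^esub> y) = - Abs_uea_alg y"
      using y by (simp add: uminus_uea_alg_def Abs_uea_alg_inverse)
    then show ?case
      using reduces_to_uminus[OF D(2)] uminus[OF D(1)] ring.ring_simprules(3)[OF ring_uea y] by auto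
  next
    case (eng_add y z)
    then obtain D D' where D: "D \<in> ?C" "reduces_to (Abs_uea_alg y) D" "D' \<in> ?C" "reduces_to (Abs_uea_alg z) D'"
      and yz: "y \<in> carrier uea_ring" "z \<in> carrier uea_ring" by blast
    have "Abs_uea_alg (y \<oplus>\<^bsub>uea_ring\<^esub> z) = Abs_uea_alg y + Abs_uea_alg z"
      using yz by (simp add: plus_uea_alg_def Abs_uea_alg_inverse)
    then show ?case
      using reduces_to_add[OF D(2,4)] add[OF D(1,3)] ring.ring_simprules(1)[OF ring_uea yz] by auto
  next
    case (eng_mult y z)
    then obtain D D' where D: "D \<in> ?C" "reduces_to (Abs_uea_alg y) D" "D' \<in> ?C" "reduces_to (Abs_uea_alg z) D'"
      and yz: "y \<in> carrier uea_ring" "z \<in> carrier uea_ring" by blast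
    have "Abs_uea_alg (y \<otimes>\<^bsub>uea_ring\<^esub> z) = Abs_uea_alg y * Abs_uea_alg z"
      using yz by (simp add: times_uea_alg_def Abs_uea_alg_inverse)
    then show ?case
      using reduces_to_mult[OF D(2,4)] comp[OF D(1,3)] ring.ring_simprules(5)[OF ring_uea yz] by auto
  qed
  then show ?thesis unfolding carrier_diffops by blast
qed

lemma of_nat_card_zero: "of_nat CARD('p) = (0 :: 'p::prime_card fun_field)"
proof -
  have "of_nat CARD('p) = (0 :: 'p mod_ring)" by simp
  then show ?thesis by (metis const_of_nat const_hom(4))
qed

lemma reduces_to_card: "reduces_to (uea_scal (of_nat CARD('p))) (\<lambda>_. 0 :: 'p::prime_card fun_field)"
  unfolding reduces_to_def
proof
  fix f :: "int \<Rightarrow>\<^sub>0 int"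
  let ?g = "frag_cmul (int CARD('p)) f"
  have "red ?g = (0 :: 'p fun_field)"
    unfolding red_def by (simp add: of_nat_card_zero)
  moreover have "acts (uea_scal (of_nat CARD('p))) (rat_series f) = rat_series ?g"
    by (simp add: fun_eq_iff acts_simps rat_series_def)
  ultimately show "\<exists>g. acts (uea_scal (of_nat CARD('p))) (rat_series f) = rat_series g \<and> 0 = (red g :: 'p fun_field)"
    by metis
qed

lemma kostant_Rep_Abs: "y \<in> carrier kostant_ring \<Longrightarrow> Rep_uea_alg (Abs_uea_alg y) = y"
  using kostant_subset_uea by (simp add: Abs_uea_alg_inverse subset_iff)

section \<open>Construction of the morphism on distributions\<close>

definition is_rho :: "(dist \<Rightarrow> 'p::prime_card operator) \<Rightarrow> bool" where
  "is_rho \<rho> \<longleftrightarrow>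
     \<rho> \<in> Ring.ring_hom (dist_algebra :: ('p mod_ring, dist) module) (diffops proj_line) \<and>
     (\<forall>n. \<rho> ` dist_order TYPE('p) n \<subseteq> diffops_le proj_line n) \<and>
     (\<forall>n. \<rho> (dist_class CARD('p) (uea_divpow sl2_E n)) = divpow_deriv coord_t n) \<and>
     (\<forall>n. \<rho> (dist_class CARD('p) (uea_divpow sl2_F n)) = divpow_deriv (inverse coord_t) n)"

text \<open>Each element of the Kostant form is sent to some operator it reduces to. By uniqueness
  any operator found by another route is the chosen one, so sums, composites and the generators have
  the expected images. As p reduces to 0, the map factors through distributions.\<close>

lemma is_rho_exists: "\<exists>\<rho> :: dist \<Rightarrow> 'p::prime_card operator. is_rho \<rho>"
proof -
  let ?D = "diffops proj_line :: ('p mod_ring, 'p operator) module"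
  let ?S = "{[CARD('p)] \<cdot>\<^bsub>kostant_ring\<^esub> \<one>\<^bsub>kostant_ring\<^esub>}"
  interpret operator_subalgebra "\<Union>n. diffops_le proj_line n :: 'p operator set"
    by (rule diffops_subalgebra)
  interpret K: ring kostant_ring by (rule ring_kostant)
  have C: "carrier ?D = (\<Union>n. diffops_le proj_line n)" by (rule carrier_diffops)
  define h :: "uea \<Rightarrow> 'p operator" where
    "h y = (SOME D. D \<in> carrier ?D \<and> reduces_to (Abs_uea_alg y) D)" for y
  have h: "h y \<in> carrier ?D" "reduces_to (Abs_uea_alg y) (h y)" if "y \<in> carrier kostant_ring" for y
  proof -
    have "\<exists>D. D \<in> carrier ?D \<and> reduces_to (Abs_uea_alg y) D"
      using kostant_reduces[OF that] by blast
    then have "h y \<in> carrier ?D \<and> reduces_to (Abs_uea_alg y) (h y)"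
      unfolding h_def by (rule someI_ex)
    then show "h y \<in> carrier ?D" "reduces_to (Abs_uea_alg y) (h y)" by blast+
  qed
  have order: "\<exists>n. order_le n D" if "D \<in> carrier ?D" for D
    using that unfolding C diffops_le_def by blast
  have h_eq: "h y = D" if "y \<in> carrier kostant_ring" "D \<in> carrier ?D" "reduces_to (Abs_uea_alg y) D" for y D
    using reduces_to_unique[OF h(2)[OF that(1)] that(3)] order[OF that(2)] order[OF h(1)[OF that(1)]] by blast
  have abs: "Abs_uea_alg (y \<otimes>\<^bsub>uea_ring\<^esub> z) = Abs_uea_alg y * Abs_uea_alg z"
    "Abs_uea_alg (y \<oplus>\<^bsub>uea_ring\<^esub> z) = Abs_uea_alg y + Abs_uea_alg z"
    if "y \<in> carrier kostant_ring" "z \<in> carrier kostant_ring" for y z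
    using that by (simp_all add: times_uea_alg_def plus_uea_alg_def kostant_Rep_Abs)
  have "h \<in> Ring.ring_hom kostant_ring ?D"
  proof (rule ring_hom_memI)
    fix y z assume y: "y \<in> carrier kostant_ring" and z: "z \<in> carrier kostant_ring"
    show "h y \<in> carrier ?D" by (rule h(1)[OF y])
    have "h (y \<otimes>\<^bsub>kostant_ring\<^esub> z) = h y \<circ> h z"
      by (rule h_eq) (use y z h(1)[OF y] h(1)[OF z] comp[of "h y" "h z"] reduces_to_mult[OF h(2)[OF y] h(2)[OF z]]
          abs(1)[OF y z] K.m_closed[OF y z] in \<open>simp_all add: C\<close>)
    then show "h (y \<otimes>\<^bsub>kostant_ring\<^esub> z) = h y \<otimes>\<^bsub>?D\<^esub> h z" by (simp add: diffops_def)
    have "h (y \<oplus>\<^bsub>kostant_ring\<^esub> z) = (\<lambda>f. h y f + h z f)"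
      by (rule h_eq) (use y z h(1)[OF y] h(1)[OF z] add[of "h y" "h z"] reduces_to_add[OF h(2)[OF y] h(2)[OF z]]
          abs(2)[OF y z] K.a_closed[OF y z] in \<open>simp_all add: C\<close>)
    then show "h (y \<oplus>\<^bsub>kostant_ring\<^esub> z) = h y \<oplus>\<^bsub>?D\<^esub> h z" by (simp add: diffops_def)
  next
    have "Abs_uea_alg \<one>\<^bsub>uea_ring\<^esub> = 1" by (simp add: one_uea_alg_def)
    then have "h \<one>\<^bsub>kostant_ring\<^esub> = id"
      by (intro h_eq) (use K.one_closed id reduces_to_one in \<open>auto simp: C\<close>)
    then show "h \<one>\<^bsub>kostant_ring\<^esub> = \<one>\<^bsub>?D\<^esub>" by (simp add: diffops_def)
  qed
  moreover have "h y = \<zero>\<^bsub>?D\<^esub>" if "y \<in> ?S" for y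
  proof -
    \<comment> \<open>The relation is a p-fold sum of the unit, whereas
      \<open>reduces_to_card\<close> speaks of the scalar p; the two are matched by
      induction.\<close>
    have "[n] \<cdot>\<^bsub>kostant_ring\<^esub> \<one>\<^bsub>kostant_ring\<^esub> \<in> carrier kostant_ring \<and>
        Abs_uea_alg ([n] \<cdot>\<^bsub>kostant_ring\<^esub> \<one>\<^bsub>kostant_ring\<^esub>) = uea_scal (of_nat n)" for n :: nat
    proof (induction n)
      case 0
      then show ?case using K.zero_closed by (simp add: uea.sc_zero zero_uea_alg_def)
    next
      case (Suc n)
      then show ?case
        using abs(2) K.one_closed K.a_closed by (simp add: uea.sc_add uea.sc_one one_uea_alg_def add.commute)
    qed
    then have "y \<in> carrier kostant_ring" "Abs_uea_alg y = uea_scal (of_nat CARD('p))"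
      using that by auto
    then have "h y = (\<lambda>_. 0)"
      using reduces_to_card zero by (intro h_eq) (auto simp: C)
    then show ?thesis by (simp add: diffops_def)
  qed
  ultimately obtain \<rho> where \<rho>: "\<rho> \<in> Ring.ring_hom (dist_ring CARD('p)) ?D"
    and \<rho>h: "\<And>y. y \<in> carrier kostant_ring \<Longrightarrow> \<rho> (dist_class CARD('p) y) = h y"
    using ring_pres_lift[OF ring_kostant dist_rel_carrier ring_diffops] unfolding dist_ring_def dist_class_def by metis
  have \<rho>_eq: "\<rho> (dist_of CARD('p) x) = D" if "Rep_uea_alg x \<in> carrier kostant_ring" "D \<in> carrier ?D" "reduces_to x D" for x D
    using that h_eq[of "Rep_uea_alg x" D] \<rho>h by (simp add: dist_of_def Rep_uea_alg_inverse)
  have "is_rho \<rho>"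
    unfolding is_rho_def
  proof (intro conjI allI)
    show "\<rho> \<in> Ring.ring_hom (dist_algebra :: ('p mod_ring, dist) module) ?D"
      using \<rho> by (simp add: Ring.ring_hom_def)
    fix n
    show "\<rho> ` dist_order TYPE('p) n \<subseteq> diffops_le proj_line n"
    proof
      fix D assume "D \<in> \<rho> ` dist_order TYPE('p) n"
      then obtain x where x: "x \<in> uea_kspan n" "D = \<rho> (dist_of CARD('p) x)"
        unfolding dist_order_eq by blast
      obtain D' :: "'p operator" where D': "D' \<in> diffops_le proj_line n" "reduces_to x D'"
        using kspan_reduces[OF x(1)] by blast
      then have "D = D'" unfolding x(2) by (intro \<rho>_eq kspan_kostant[OF x(1)]) (auto simp: C)
      then show "D \<in> diffops_le proj_line n" using D'(1) by simp
    qed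
    have "\<rho> (dist_of CARD('p) (uea_dp (uea_of sl2_E) n)) = hasse coord_t n"
      by (rule \<rho>_eq[OF kostant_gens(1) _ reduces_to_E]) (use hasse_diffops in \<open>auto simp: C coords_def\<close>)
    then show "\<rho> (dist_class CARD('p) (uea_divpow sl2_E n)) = divpow_deriv coord_t n"
      by (simp add: dist_of_def Rep_uea_dp sl2_carriers divpow_deriv_eq coords_def)
    have "\<rho> (dist_of CARD('p) (uea_dp (uea_of sl2_F) n)) = hasse (inverse coord_t) n"
      by (rule \<rho>_eq[OF kostant_gens(2) _ reduces_to_F]) (use hasse_diffops in \<open>auto simp: C coords_def\<close>)
    then show "\<rho> (dist_class CARD('p) (uea_divpow sl2_F n)) = divpow_deriv (inverse coord_t) n"
      by (simp add: dist_of_def Rep_uea_dp sl2_carriers divpow_deriv_eq coords_def)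
  qed
  then show ?thesis by blast
qed

lemma is_rho_rho: "is_rho (rho :: dist \<Rightarrow> 'p::prime_card operator)"
  using someI_ex[OF is_rho_exists] unfolding rho_def is_rho_def .

lemma rho_hom: "rho \<in> Ring.ring_hom (dist_ring CARD('p)) (diffops proj_line :: ('p::prime_card mod_ring, 'p operator) module)"
  using is_rho_rho[where 'p = 'p] by (simp add: is_rho_def Ring.ring_hom_def)

lemma rho_order: "\<mu> \<in> dist_order TYPE('p) n \<Longrightarrow> (rho \<mu> :: 'p::prime_card operator) \<in> diffops_le proj_line n"
  using is_rho_rho[where 'p = 'p] unfolding is_rho_def by blast

lemma rho_gens:
  fixes n :: nat
  shows "rho (dist_of CARD('p) (uea_dp (uea_of sl2_E) n)) = (hasse coord_t n :: 'p::prime_card operator)"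
    "rho (dist_of CARD('p) (uea_dp (uea_of sl2_F) n)) = (hasse (inverse coord_t) n :: 'p operator)"
  using is_rho_rho[where 'p = 'p]
  by (simp_all add: is_rho_def dist_of_def Rep_uea_dp sl2_carriers divpow_deriv_eq coords_def)

lemma rho_k_linear: "\<mu> \<in> carrier (dist_ring CARD('p)) \<Longrightarrow> k_linear (rho \<mu> :: 'p::prime_card operator)"
  using ring_hom_closed[OF rho_hom] operator_subalgebra.k_lin[OF diffops_subalgebra]
  unfolding carrier_diffops by blast

lemma rho_add:
  "\<mu> \<in> carrier (dist_ring CARD('p)) \<Longrightarrow> \<nu> \<in> carrier (dist_ring CARD('p)) \<Longrightarrow>
    rho (\<mu> \<oplus>\<^bsub>dist_ring CARD('p)\<^esub> \<nu>) = (\<lambda>f. (rho \<mu> f :: 'p::prime_card fun_field) + rho \<nu> f)"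
  using ring_hom_add[OF rho_hom] by (simp add: diffops_def)

lemma rho_mult:
  "\<mu> \<in> carrier (dist_ring CARD('p)) \<Longrightarrow> \<nu> \<in> carrier (dist_ring CARD('p)) \<Longrightarrow>
    rho (\<mu> \<otimes>\<^bsub>dist_ring CARD('p)\<^esub> \<nu>) = (rho \<mu> :: 'p::prime_card operator) \<circ> rho \<nu>"
  using ring_hom_mult[OF rho_hom] by (simp add: diffops_def)

lemma rho_one: "rho \<one>\<^bsub>dist_ring CARD('p)\<^esub> = (id :: 'p::prime_card operator)"
  using ring_hom_one[OF rho_hom] by (simp add: diffops_def)

lemma rho_zero: "rho \<zero>\<^bsub>dist_ring CARD('p)\<^esub> = (\<lambda>_. 0 :: 'p::prime_card fun_field)"
  using ring_hom_zero[OF rho_hom ring_dist_ring ring_diffops] by (simp add: diffops_def)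

lemma rho_minus:
  assumes "\<mu> \<in> carrier (dist_ring CARD('p))" "\<nu> \<in> carrier (dist_ring CARD('p))"
  shows "rho (\<mu> \<ominus>\<^bsub>dist_ring CARD('p)\<^esub> \<nu>) = (\<lambda>f. (rho \<mu> f :: 'p::prime_card fun_field) - rho \<nu> f)"
proof -
  interpret D: ring "dist_ring CARD('p)" by (rule ring_dist_ring)
  have "(\<mu> \<ominus>\<^bsub>dist_ring CARD('p)\<^esub> \<nu>) \<oplus>\<^bsub>dist_ring CARD('p)\<^esub> \<nu> = \<mu>"
    using assms by (simp add: a_minus_def D.a_assoc D.l_neg)
  then have "rho \<mu> = (\<lambda>f. (rho (\<mu> \<ominus>\<^bsub>dist_ring CARD('p)\<^esub> \<nu>) f :: 'p fun_field) + rho \<nu> f)"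
    using rho_add[where 'p = 'p, of "\<mu> \<ominus>\<^bsub>dist_ring CARD('p)\<^esub> \<nu>" \<nu>] assms by simp
  then show ?thesis by (simp add: fun_eq_iff)
qed

text \<open>An element of the prime field is the class of a natural number below p, and natural
  multiples are iterated sums.\<close>

lemma rho_smult:
  fixes c :: "'p::prime_card mod_ring"
  assumes \<mu>: "\<mu> \<in> carrier (dist_ring CARD('p))"
  shows "rho ([to_int_mod_ring c] \<cdot>\<^bsub>dist_ring CARD('p)\<^esub> \<mu>) = (\<lambda>f. const c * (rho \<mu> f :: 'p fun_field))"
proof -
  interpret D: ring "dist_ring CARD('p)" by (rule ring_dist_ring)
  have nat: "[n] \<cdot>\<^bsub>dist_ring CARD('p)\<^esub> \<mu> \<in> carrier (dist_ring CARD('p)) \<and>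
      rho ([n] \<cdot>\<^bsub>dist_ring CARD('p)\<^esub> \<mu>) = (\<lambda>f. of_nat n * (rho \<mu> f :: 'p fun_field))" for n :: nat
    by (induction n) (auto simp: \<mu> rho_add rho_zero algebra_simps)
  obtain n where n: "c = of_nat n" "n < CARD('p)" using surj_of_nat_mod_ring[of c] by blast
  have "to_int_mod_ring c = int n"
    using n by (simp add: of_nat_of_int_mod_ring)
  then have "[to_int_mod_ring c] \<cdot>\<^bsub>dist_ring CARD('p)\<^esub> \<mu> = [n] \<cdot>\<^bsub>dist_ring CARD('p)\<^esub> \<mu>"
    by (simp add: add_pow_int_ge)
  then show ?thesis using nat n(1) by (simp add: const_of_nat)
qed

section \<open>The image of the torus element\<close>

lemma hasse_1_powi:
  "hasse coord_t 1 (coord_t powi k) = of_int k * coord_t powi (k - 1)"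
  "hasse (inverse coord_t) 1 (coord_t powi k) = - of_int k * coord_t powi (k + 1)"
proof -
  have 1: "ibinom k 1 = k" for k
  proof -
    have "(of_int (ibinom k 1) :: rat) = of_int k" by (simp add: of_int_ibinom)
    then show ?thesis by (simp only: of_int_eq_iff)
  qed
  show "hasse coord_t 1 (coord_t powi k) = of_int k * coord_t powi (k - 1)"
    using hasse_powi[of coord_t 1 k] by (simp add: coords_def 1[simplified])
  show "hasse (inverse coord_t) 1 (coord_t powi k) = - of_int k * coord_t powi (k + 1)"
    using hasse_powi[of "inverse coord_t" 1 "- k"] by (simp add: coords_def 1[simplified] inverse_t_powi add.commute)
qed

lemma ibinom_Suc: "of_nat (Suc b) * ibinom k (Suc b) = (k - of_nat b) * ibinom k b"
proof -
  have "(of_int (of_nat (Suc b) * ibinom k (Suc b)) :: rat) = of_int ((k - of_nat b) * ibinom k b)"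
    using gchoose_step[of "of_int k" b] by (simp add: of_int_ibinom mult.commute)
  then show ?thesis by (simp only: of_int_eq_iff)
qed

lemma of_nat_fun_field_nz: "0 < n \<Longrightarrow> n < CARD('p) \<Longrightarrow> of_nat n \<noteq> (0 :: 'p::prime_card fun_field)"
proof -
  assume n: "0 < n" "n < CARD('p)"
  have "of_nat n \<noteq> (0 :: 'p mod_ring)"
    using of_nat_0_mod_ring_dvd[of n, where 'a = 'p] n nat_dvd_not_less by blast
  then show ?thesis by (simp flip: const_of_nat add: const_eq_0_iff)
qed

lemma k_linear_of_int: "k_linear D \<Longrightarrow> D (of_int z * f) = of_int z * D f"
  unfolding k_linear_def by (metis const_of_int)

text \<open>Only the values of \<open>rho\<close> on divided powers of E and F are prescribed. With
  \<open>H = E F - F E\<close> they determine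
  \<open>(b + 1) binom(H, b + 1) = binom(H, b) (H - b)\<close> inductively, and \<open>b + 1\<close>
  is invertible modulo p by the bound on \<open>b\<close>.\<close>

lemma rho_binom:
  assumes "b < CARD('p)"
  shows "rho (dist_class CARD('p) (uea_binom sl2_H b)) (coord_t powi k)
      = of_int (ibinom (- 2 * k) b) * (coord_t powi k :: 'p::prime_card fun_field)"
  using assms
proof (induction b arbitrary: k)
  case 0
  have "dist_class CARD('p) (uea_binom sl2_H 0) = \<one>\<^bsub>dist_ring CARD('p)\<^esub>"
    using dist_of_hom(5)[OF kostant_zero kostant_zero, of "CARD('p)"]
    by (simp add: dist_of_def pbin_def uea.sc_one flip: Rep_uea_binom)
  then show ?case using rho_one[where 'p = 'p] by simp
next
  case (Suc b)
  let ?d = "dist_of CARD('p)" and ?K = "\<lambda>x. Rep_uea_alg x \<in> carrier kostant_ring"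
  let ?r = "\<lambda>x. rho (?d x) :: 'p operator"
  let ?e = "uea_dp (uea_of sl2_E) 1" and ?f = "uea_dp (uea_of sl2_F) 1"
  let ?h = "\<lambda>b. uea_pev (pbin b)"
  have e: "?K ?e" and f: "?K ?f" and h: "?K (?h b)" for b by (rule kostant_gens)+
  have r_mult: "?r (x * y) = ?r x \<circ> ?r y" if "?K x" "?K y" for x y
    using rho_mult[where 'p = 'p] dist_of_hom(1,3) that by simp
  have r_minus: "?r (x - y) = (\<lambda>f. ?r x f - ?r y f)" if "?K x" "?K y" for x y
    using rho_minus[where 'p = 'p] dist_of_hom(1,4) that by simp
  have K1: "?K 1"
    using ring.ring_simprules(6)[OF ring_kostant] by (simp add: one_uea_alg.rep_eq)
  \<comment> \<open>Rational scalars have no meaning after reduction; multiples by natural numbers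
    are therefore treated as iterated sums.\<close>
  have nat: "?K (uea_scal (of_nat n) * x) \<and> ?r (uea_scal (of_nat n) * x) = (\<lambda>f. of_nat n * ?r x f)" if "?K x" for n x
  proof (induction n)
    case 0
    then show ?case
      using kostant_zero dist_of_hom(6)[OF kostant_zero kostant_zero, of "CARD('p)"] rho_zero[where 'p = 'p]
      by (simp add: uea.sc_zero)
  next
    case (Suc n)
    have "uea_scal (of_nat (Suc n)) * x = uea_scal (of_nat n) * x + x"
      by (simp add: uea.sc_add uea.sc_one distrib_right)
    moreover have "?r (uea_scal (of_nat n) * x + x) = (\<lambda>f. ?r (uea_scal (of_nat n) * x) f + ?r x f)"
      using rho_add[where 'p = 'p] dist_of_hom(1,2) that Suc by simp
    ultimately show ?case
      using kostant_closed(1)[OF conjunct1[OF Suc.IH] that] Suc by (simp add: algebra_simps)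
  qed
  have "uea_of x = uea_dp (uea_of x) 1" for x
    by (simp add: uea.dp_def uea.sc_one)
  then have H: "uea_of sl2_H = ?e * ?f - ?f * ?e"
    using uea.fe by (metis add_diff_cancel_left' diff_add_cancel diff_diff_eq2)
  have "of_nat (Suc b) * (1 / fact (Suc b)) = (1 / fact b :: rat)"
    by (simp add: field_simps del: of_nat_Suc)
  then have "smult (of_nat (Suc b)) (pbin (Suc b)) = pbin b * [:- of_nat b, 1:]"
    by (simp only: pbin_def pfall.simps smult_smult mult_smult_left)
  then have "uea_scal (of_nat (Suc b)) * ?h (Suc b) = uea_pev (pbin b * [:- of_nat b, 1:])"
    by (simp only: flip: uea.pev_smult)
  also have "\<dots> = ?h b * (?e * ?f - ?f * ?e - uea_scal (of_nat b) * 1)"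
    unfolding uea.pev_mult H[symmetric] by (simp add: uea.sc_minus uea.sc_one uea.sc_zero)
  finally have rec: "uea_scal (of_nat (Suc b)) * ?h (Suc b) = ?h b * (?e * ?f - ?f * ?e - uea_scal (of_nat b) * 1)" .
  have Kminus: "?K (x - y)" if "?K x" "?K y" for x y
    using kostant_closed(1)[OF that(1) kostant_closed(3)[OF that(2) that(2)]] by simp
  note K = kostant_closed(2)[OF e f] kostant_closed(2)[OF f e]
  note K' = Kminus[OF K]
  have r1: "?r 1 = id"
    using rho_one[where 'p = 'p] dist_of_hom(5)[OF K1 K1] by simp
  have lin: "k_linear (?r x)" if "?K x" for x
    by (rule rho_k_linear[OF dist_of_hom(1)[OF that that]])
  have "?r (uea_scal (of_nat (Suc b)) * ?h (Suc b)) (coord_t powi k)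
      = ?r (?h b) (?r ?e (?r ?f (coord_t powi k)) - ?r ?f (?r ?e (coord_t powi k)) - of_nat b * coord_t powi k)"
    unfolding rec using r_mult[OF h Kminus[OF K' conjunct1[OF nat[OF K1]]]] r_minus[OF K' conjunct1[OF nat[OF K1]]]
      r_minus[OF K] r_mult[OF e f] r_mult[OF f e] conjunct2[OF nat[OF K1]] r1 by simp
  also have "?r ?e = hasse coord_t 1" by (rule rho_gens(1))
  also have "?r ?f = hasse (inverse coord_t) 1" by (rule rho_gens(2))
  \<comment> \<open>The eigenvalue of \<open>E F - F E\<close> on the power \<open>k\<close> of
    \<open>t\<close> is \<open>- k (k + 1) + k (k - 1) = - 2 k\<close>.\<close>
  also have "hasse coord_t 1 (hasse (inverse coord_t) 1 (coord_t powi k))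
      - hasse (inverse coord_t) 1 (hasse coord_t 1 (coord_t powi k)) - of_nat b * coord_t powi k
      = of_int (- 2 * k - int b) * (coord_t powi k :: 'p fun_field)"
  proof -
    have l: "hasse \<tau> 1 (of_int z * g) = of_int z * hasse \<tau> 1 g" for \<tau> g :: "'p fun_field" and z
      by (rule k_linear_of_int[OF order_le_k_linear[OF order_hasse]])
    have a1: "hasse coord_t 1 (hasse (inverse coord_t) 1 (coord_t powi k)) = of_int (- k) * (of_int (k + 1) * (coord_t powi k :: 'p fun_field))"
    proof -
      have "hasse coord_t 1 (hasse (inverse coord_t) 1 (coord_t powi k)) = hasse coord_t 1 (of_int (- k) * (coord_t powi (k + 1) :: 'p fun_field))"
        by (simp only: hasse_1_powi of_int_minus)
      then show ?thesis unfolding l hasse_1_powi by simp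
    qed
    have a2: "hasse (inverse coord_t) 1 (hasse coord_t 1 (coord_t powi k)) = of_int k * (- of_int (k - 1) * (coord_t powi k :: 'p fun_field))"
      unfolding hasse_1_powi l by simp
    show ?thesis unfolding a1 a2 by (simp add: algebra_simps)
  qed
  also have "?r (?h b) (of_int (- 2 * k - int b) * (coord_t powi k :: 'p fun_field))
      = of_int (- 2 * k - int b) * ?r (?h b) (coord_t powi k)"
    by (rule k_linear_of_int[OF lin[OF h]])
  also have "?r (?h b) (coord_t powi k) = of_int (ibinom (- 2 * k) b) * coord_t powi k"
    using Suc.IH[of k] Suc.prems by (simp add: dist_of_def Rep_uea_binom)
  also have "of_int (- 2 * k - int b) * (of_int (ibinom (- 2 * k) b) * (coord_t powi k :: 'p fun_field))
      = of_int (of_nat (Suc b) * ibinom (- 2 * k) (Suc b)) * coord_t powi k"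
    unfolding ibinom_Suc by simp
  finally have "of_nat (Suc b) * ?r (?h (Suc b)) (coord_t powi k)
      = of_nat (Suc b) * (of_int (ibinom (- 2 * k) (Suc b)) * (coord_t powi k :: 'p fun_field))"
    using conjunct2[OF nat[OF h[of "Suc b"], of "Suc b"]] by (simp only: of_int_mult of_int_of_nat_eq mult.assoc)
  then show ?case
    using of_nat_fun_field_nz[of "Suc b", where 'p = 'p] Suc.prems
    by (simp add: dist_of_def Rep_uea_binom del: of_nat_Suc)
qed

text \<open>The alternating sum is, up to a sign, the binomial coefficient of \<open>N - 1\<close> over \<open>p - 1\<close>,
  whose product with \<open>(p - 1)!\<close> is a product of consecutive integers.\<close>

lemma alternating_binomial_sum:
  assumes "CARD('p::prime_card) > 2"
  shows "(\<Sum>i<CARD('p). (- 1) ^ i * of_int (ibinom N i)) = (if of_int N = (0 :: 'p fun_field) then 1 else (0 :: 'p fun_field))"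
proof -
  let ?m = "CARD('p) - 1"
  have odd: "even ?m"
    using prime_odd_nat[OF prime_card[where 'a = 'p]] assms by simp
  \<comment> \<open>The partial alternating sum equals \<open>(- 1)^m\<close> times the binomial of
    \<open>N - 1\<close> over \<open>m\<close>; the sign is 1 because \<open>m = p - 1\<close> is
    even.\<close>
  have "(\<Sum>i\<le>?m. (of_int N gchoose i) * (- 1) ^ i) = (of_int (N - 1) gchoose ?m :: rat)"
    using gbinomial_sum_lower_neg[of "of_int N :: rat" ?m] odd by simp
  then have "(of_int (\<Sum>i\<le>?m. (- 1) ^ i * ibinom N i) :: rat) = of_int (ibinom (N - 1) ?m)"
    by (simp add: of_int_ibinom mult.commute)
  then have sum: "(\<Sum>i\<le>?m. (- 1) ^ i * ibinom N i) = ibinom (N - 1) ?m"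
    by (simp only: of_int_eq_iff)
  have "(of_int (fact ?m * ibinom (N - 1) ?m) :: rat) = of_int (\<Prod>i = 0..<?m. N - 1 - int i)"
    using gbinomial_mult_fact[of ?m "of_int (N - 1) :: rat"] by (simp add: of_int_ibinom)
  then have "int (fact ?m) * ibinom (N - 1) ?m = (\<Prod>i = 0..<?m. N - 1 - int i)"
    by (simp only: of_int_eq_iff of_nat_fact)
  then have prod: "of_nat (fact ?m) * of_int (ibinom (N - 1) ?m) = (\<Prod>i = 0..<?m. of_int (N - 1 - int i) :: 'p fun_field)"
    by (metis of_int_of_nat_eq of_int_mult of_int_prod)
  have fact_nz: "of_nat (fact n) \<noteq> (0 :: 'p fun_field)" if "n < CARD('p)" for n
    using that
  proof (induction n)
    case (Suc n)
    then have "of_nat (Suc n) * of_nat (fact n) \<noteq> (0 :: 'p fun_field)"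
      using of_nat_fun_field_nz[of "Suc n", where 'p = 'p] by (simp del: of_nat_Suc)
    then show ?case by (simp only: fact_Suc of_nat_mult of_nat_id not_False_eq_True)
  qed simp
  have "{..<CARD('p)} = {..?m}" using assms by auto
  then have "(\<Sum>i<CARD('p). (- 1) ^ i * of_int (ibinom N i)) = (of_int (\<Sum>i\<le>?m. (- 1) ^ i * ibinom N i) :: 'p fun_field)"
    by simp
  also have "\<dots> = of_int (ibinom (N - 1) ?m)" by (simp only: sum)
  also have "\<dots> = (if of_int N = (0 :: 'p fun_field) then 1 else 0)"
  proof (cases "of_int N = (0 :: 'p fun_field)")
    case True
    have "of_int (N - 1 - int i) = (- 1 * of_nat (Suc i) :: 'p fun_field)" for i
      using True by simp
    then have "(\<Prod>i = 0..<?m. of_int (N - 1 - int i)) = (\<Prod>i = 0..<?m. - 1 * of_nat (Suc i) :: 'p fun_field)"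
      by (intro prod.cong refl)
    also have "\<dots> = (- 1) ^ ?m * of_nat (fact ?m)"
      by (simp only: prod.distrib prod_constant card_atLeastLessThan fact_prod_Suc of_nat_prod of_nat_id diff_zero)
    finally have "of_nat (fact ?m) * of_int (ibinom (N - 1) ?m) = (of_nat (fact ?m) * 1 :: 'p fun_field)"
      using prod odd by simp
    then show ?thesis using fact_nz[of ?m] assms True by (simp only: mult_left_cancel) simp
  next
    case False
    \<comment> \<open>The residue of \<open>N\<close> lies between 1 and \<open>p - 1\<close>, so
      \<open>i\<close> is a legitimate index, and \<open>N - 1 - i\<close> is the factor divisible
      by p.\<close>
    define i where "i = nat (N mod int CARD('p)) - 1"
    have card: "of_int (int CARD('p) * z) = (0 :: 'p fun_field)" for z
      by (simp add: of_nat_card_zero)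
    have N: "N = int CARD('p) * (N div int CARD('p)) + N mod int CARD('p)" by simp
    have mod: "of_int N = (of_int (N mod int CARD('p)) :: 'p fun_field)"
      by (subst N) (simp only: of_int_add card add_0)
    then have "N mod int CARD('p) \<noteq> 0" using False by auto
    moreover have "0 \<le> N mod int CARD('p)" "N mod int CARD('p) < int CARD('p)" using assms by auto
    ultimately have i: "N mod int CARD('p) = int i + 1" "i < ?m" unfolding i_def by linarith+
    have "of_int (N - 1 - int i) = (0 :: 'p fun_field)"
      using mod unfolding i(1) by simp
    then have "(\<Prod>i = 0..<?m. of_int (N - 1 - int i)) = (0 :: 'p fun_field)"
      using i(2) by (intro prod_zero) auto
    then have "of_nat (fact ?m) * of_int (ibinom (N - 1) ?m) = (0 :: 'p fun_field)"
      by (simp only: prod)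
    then show ?thesis using fact_nz[of ?m] assms False by (simp only: mult_eq_0_iff) simp
  qed
  finally show ?thesis .
qed

text \<open>Partial sums allow induction. The order bound and the value of \<open>rho\<close> are
  proved together because additivity of \<open>rho\<close> requires the partial sum to lie in the
  carrier.\<close>

lemma Delta_T_dist_partial:
  assumes "n \<le> CARD('p::prime_card)"
  shows "(\<Oplus>\<^bsub>(dist_algebra :: ('p mod_ring, dist) module)\<^esub>i \<in> {..<n}. ((-1) ^ i :: 'p mod_ring) \<odot>\<^bsub>dist_algebra\<^esub> dist_class CARD('p) (uea_binom sl2_H i))
      \<in> dist_order TYPE('p) (CARD('p) - 1) \<and>
    rho (\<Oplus>\<^bsub>(dist_algebra :: ('p mod_ring, dist) module)\<^esub>i \<in> {..<n}. ((-1) ^ i :: 'p mod_ring) \<odot>\<^bsub>dist_algebra\<^esub> dist_class CARD('p) (uea_binom sl2_H i))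
      = (\<lambda>f. \<Sum>i<n. (-1) ^ i * (rho (dist_class CARD('p) (uea_binom sl2_H i)) f :: 'p fun_field))"
  using assms
proof (induction n)
  case 0
  interpret A: ring "dist_algebra :: ('p mod_ring, dist) module" by (rule ring_dist_algebra)
  have "0 \<in> uea_kspan n" for n unfolding uea.kspan_def by (rule zspan.zero)
  then have "\<zero>\<^bsub>dist_ring CARD('p)\<^esub> \<in> dist_order TYPE('p) n" for n
    unfolding dist_order_eq dist_of_hom(6)[OF kostant_zero kostant_zero, symmetric] by blast
  then show ?case using rho_zero[where 'p = 'p] by simp
next
  case (Suc n)
  let ?A = "dist_algebra :: ('p mod_ring, dist) module"
  interpret A: ring ?A by (rule ring_dist_algebra)
  let ?t = "\<lambda>i. ((-1) ^ i :: 'p mod_ring) \<odot>\<^bsub>?A\<^esub> dist_class CARD('p) (uea_binom sl2_H i)"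
  let ?S = "\<lambda>n. \<Oplus>\<^bsub>?A\<^esub>i \<in> {..<n}. ?t i"
  let ?R = "\<lambda>n f. \<Sum>i<n. (-1) ^ i * (rho (dist_class CARD('p) (uea_binom sl2_H i)) f :: 'p fun_field)"
  have h: "dist_class CARD('p) (uea_binom sl2_H i) \<in> dist_order TYPE('p) (CARD('p) - 1)" if "i \<le> n" for i
    using dist_order_basis[of 0 i 0 "CARD('p) - 1", where ?'p = 'p] Suc.prems that by (simp add: dist_basis_binom)
  have t: "?t i \<in> dist_order TYPE('p) (CARD('p) - 1)" if "i \<le> n" for i
    using dist_order_submodule(2)[OF h[OF that] h[OF that]] by simp
  have closed: "\<mu> \<in> carrier (dist_ring CARD('p))" if "\<mu> \<in> dist_order TYPE('p) (CARD('p) - 1)" for \<mu>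
    by (rule dist_order_facts(1)[OF that that])
  have "?S (Suc n) = ?t n \<oplus>\<^bsub>?A\<^esub> ?S n"
    unfolding lessThan_Suc
    by (rule A.finsum_insert) (use closed[OF t] in \<open>auto simp del: dist_algebra_simps simp add: dist_algebra_simps(1)\<close>)
  then have S: "?S (Suc n) = ?t n \<oplus>\<^bsub>dist_ring CARD('p)\<^esub> ?S n" by simp
  have IH: "?S n \<in> dist_order TYPE('p) (CARD('p) - 1)" "rho (?S n) = ?R n" using Suc by auto
  have "rho (?t n) = (\<lambda>f. const ((-1) ^ n) * (rho (dist_class CARD('p) (uea_binom sl2_H n)) f :: 'p fun_field))"
    using rho_smult[OF closed[OF h], of n "(-1) ^ n"] by simp
  moreover have "const ((-1) ^ n) = ((-1) ^ n :: 'p fun_field)"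
    by (induction n) (simp_all add: const_hom)
  ultimately have "rho (?S (Suc n)) = ?R (Suc n)"
    unfolding S using rho_add[OF closed[OF t] closed[OF IH(1)], of n] IH(2) by (simp add: add.commute)
  moreover have "?S (Suc n) \<in> dist_order TYPE('p) (CARD('p) - 1)"
    unfolding S by (rule dist_order_submodule(1)[OF t IH(1)]) simp
  ultimately show ?case by blast
qed

lemma Delta_T_dist_order: "Delta_T_dist TYPE('p::prime_card) \<in> dist_order TYPE('p) (CARD('p) - 1)"
  using Delta_T_dist_partial[of "CARD('p)", where ?'p = 'p] unfolding Delta_T_dist_def Let_def by blast

lemma rho_Delta_T:
  assumes p: "CARD('p::prime_card) > 2" and \<tau>: "\<tau> \<in> coords"
  shows "rho (Delta_T_dist TYPE('p)) = (dwork_operator \<tau> :: 'p operator)"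
proof (rule chart_operator_unique)
  show "coord_t \<in> (coords :: 'p fun_field set)" by (simp add: coords_def)
  show "order_le (CARD('p) - 1) (rho (Delta_T_dist TYPE('p)) :: 'p operator)"
    using rho_order[OF Delta_T_dist_order[where ?'p = 'p]] unfolding diffops_le_def by blast
  have dw: "dwork_operator \<tau> = (\<lambda>f. \<Sum>r<CARD('p). (- \<tau>) ^ r * hasse \<tau> r f)"
    by (simp add: fun_eq_iff dwork_operator_def divpow_deriv_eq[OF \<tau>])
  show "order_le (CARD('p)) (dwork_operator \<tau>)"
    unfolding dw by (intro order_le_sum order_le_lmult order_le_mono[OF _ order_hasse]) simp
  fix j :: nat
  have "rho (Delta_T_dist TYPE('p)) (coord_t ^ j) = (\<Sum>i<CARD('p). (-1) ^ i * (rho (dist_class CARD('p) (uea_binom sl2_H i)) (coord_t ^ j) :: 'p fun_field))"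
    using Delta_T_dist_partial[of "CARD('p)", where ?'p = 'p] unfolding Delta_T_dist_def Let_def by simp
  also have "\<dots> = (\<Sum>i<CARD('p). (-1) ^ i * of_int (ibinom (- 2 * int j) i)) * coord_t ^ j"
    unfolding sum_distrib_right
    by (rule sum.cong[OF refl]) (use rho_binom[of _ "int j", where 'p = 'p] in simp)
  finally have \<rho>: "rho (Delta_T_dist TYPE('p)) (coord_t ^ j) =
      (if of_int (- 2 * int j) = (0 :: 'p fun_field) then 1 else 0) * (coord_t ^ j :: 'p fun_field)"
    unfolding alternating_binomial_sum[OF p] .
  \<comment> \<open>The test function \<open>t^j\<close> is a power of either coordinate, with
    exponent \<open>j\<close> or \<open>- j\<close>, so both charts are treated at once.\<close>
  obtain k where k: "coord_t ^ j = \<tau> powi k" "k = int j \<or> k = - int j"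
    using \<tau> inverse_t_powi[of "- int j"] unfolding coords_def by (metis insertE minus_minus power_int_of_nat singletonD)
  have "(- \<tau>) ^ r * hasse \<tau> r (\<tau> powi k) = (- 1) ^ r * of_int (ibinom k r) * \<tau> powi k" for r
  proof -
    have "\<tau> ^ r * \<tau> powi (k - int r) = \<tau> powi k"
      using power_int_add[of \<tau> "int r" "k - int r"] coords_nz[OF \<tau>] by simp
    then show ?thesis
      by (simp add: hasse_powi[OF \<tau>] power_minus[of \<tau>] mult.assoc mult.left_commute[of "\<tau> ^ r"])
  qed
  then have "dwork_operator \<tau> (coord_t ^ j) = (\<Sum>r<CARD('p). (- 1) ^ r * of_int (ibinom k r)) * coord_t ^ j"
    unfolding dw k(1) by (simp add: sum_distrib_right)
  then have dwork: "dwork_operator \<tau> (coord_t ^ j) = (if of_int k = (0 :: 'p fun_field) then 1 else 0) * coord_t ^ j"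
    unfolding alternating_binomial_sum[OF p] .
  \<comment> \<open>The factor \<open>- 2\<close> in the eigenvalue of H does not affect
    divisibility by p.\<close>
  have "(of_nat 2 :: 'p fun_field) \<noteq> 0" by (rule of_nat_fun_field_nz) (use p in auto)
  then have "of_int (- 2 * int j) = (0 :: 'p fun_field) \<longleftrightarrow> of_int k = (0 :: 'p fun_field)"
    using k(2) by auto
  then show "rho (Delta_T_dist TYPE('p)) (coord_t ^ j) = dwork_operator \<tau> (coord_t ^ j)"
    unfolding \<rho> dwork by simp
qed

section \<open>Level m algebras\<close>

lemma level_module_simps [simp]:
  "carrier (level_module A F q) = F (2 * q - 1)" "add (level_module A F q) = add A"
  "module.smult (level_module A F q) = module.smult A"
  by (simp_all add: level_module_def)

text \<open>What distributions and germs of differential operators share. Additivity of orders and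
  their drop in commutators place every product and commutator in the level relations inside
  \<open>F (2 * q - 1)\<close>, the part that generates the tensor algebra.\<close>

locale filtered_alg =
  fixes A :: "('k::comm_ring_1, 'v) module" and F :: "nat \<Rightarrow> 'v set" and q :: nat
  assumes ring_A: "ring A" and q_pos: "0 < q"
    and F_carrier: "u \<in> F n \<Longrightarrow> u \<in> carrier A"
    and F_add: "u \<in> F n \<Longrightarrow> v \<in> F n \<Longrightarrow> u \<oplus>\<^bsub>A\<^esub> v \<in> F n"
    and F_smult: "u \<in> F n \<Longrightarrow> c \<odot>\<^bsub>A\<^esub> u \<in> F n"
    and F_one: "\<one>\<^bsub>A\<^esub> \<in> F n"
    and F_mono: "n \<le> m \<Longrightarrow> u \<in> F n \<Longrightarrow> u \<in> F m"
    and F_mult: "u \<in> F n \<Longrightarrow> v \<in> F m \<Longrightarrow> u \<otimes>\<^bsub>A\<^esub> v \<in> F (n + m)"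
    and F_commutator: "u \<in> F n \<Longrightarrow> v \<in> F m \<Longrightarrow> u \<otimes>\<^bsub>A\<^esub> v \<ominus>\<^bsub>A\<^esub> v \<otimes>\<^bsub>A\<^esub> u \<in> F (n + m - 1)"
begin

abbreviation M where "M \<equiv> level_module A F q"

sublocale M: linear_carrier M
  by standard (simp_all add: F_add F_smult)

sublocale A: ring A
  by (rule ring_A)

lemma level_closed:
  "u \<in> F q \<Longrightarrow> u \<in> F (2 * q - 1)" "u \<in> F (q - 1) \<Longrightarrow> u \<in> F q"
  "u \<in> F q \<Longrightarrow> v \<in> F q \<Longrightarrow> u \<otimes>\<^bsub>A\<^esub> v \<ominus>\<^bsub>A\<^esub> v \<otimes>\<^bsub>A\<^esub> u \<in> F (2 * q - 1)"
  "u \<in> F q \<Longrightarrow> v \<in> F (q - 1) \<Longrightarrow> u \<otimes>\<^bsub>A\<^esub> v \<in> F (2 * q - 1)"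
  "u \<in> F q \<Longrightarrow> v \<in> F (q - 1) \<Longrightarrow> v \<otimes>\<^bsub>A\<^esub> u \<in> F (2 * q - 1)"
proof -
  have q: "q \<le> 2 * q - 1" "q + q - 1 = 2 * q - 1" "q + (q - 1) = 2 * q - 1" "q - 1 + q = 2 * q - 1"
    using q_pos by auto
  show "u \<in> F q \<Longrightarrow> u \<in> F (2 * q - 1)" by (rule F_mono[OF q(1)])
  show "u \<in> F (q - 1) \<Longrightarrow> u \<in> F q" by (rule F_mono[of "q - 1"]) simp_all
  show "u \<in> F q \<Longrightarrow> v \<in> F q \<Longrightarrow> u \<otimes>\<^bsub>A\<^esub> v \<ominus>\<^bsub>A\<^esub> v \<otimes>\<^bsub>A\<^esub> u \<in> F (2 * q - 1)"
    using F_commutator[of u q v q] unfolding q(2) .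
  show "u \<in> F q \<Longrightarrow> v \<in> F (q - 1) \<Longrightarrow> u \<otimes>\<^bsub>A\<^esub> v \<in> F (2 * q - 1)"
    using F_mult[of u q v "q - 1"] unfolding q(3) .
  show "u \<in> F q \<Longrightarrow> v \<in> F (q - 1) \<Longrightarrow> v \<otimes>\<^bsub>A\<^esub> u \<in> F (2 * q - 1)"
    using F_mult[of v "q - 1" u q] unfolding q(4) by blast
qed

lemma level_rels_carrier:
  "level_rels A F q \<subseteq> carrier (tensor_algebra M)"
  "level_rels_left A F q \<subseteq> carrier (tensor_algebra M)"
  "level_rels_right A F q \<subseteq> carrier (tensor_algebra M)"
proof -
  interpret T: ring "tensor_algebra M" by (rule M.ring_tensor_algebra)
  have gen: "tensor_gen M u \<in> carrier (tensor_algebra M)" if "u \<in> F (2 * q - 1)" for u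
    using M.tensor_closed(1)[of u] that by simp
  show "level_rels A F q \<subseteq> carrier (tensor_algebra M)"
    unfolding level_rels_def Let_def
    by (auto intro!: T.minus_closed T.m_closed gen M.tensor_closed(2) level_closed(3) F_smult F_one intro: level_closed(1))
  show "level_rels_left A F q \<subseteq> carrier (tensor_algebra M)"
    unfolding level_rels_left_def Let_def
    by (auto intro!: T.minus_closed T.m_closed intro: gen[OF level_closed(1)] gen[OF level_closed(1)[OF level_closed(2)]]
        gen[OF level_closed(4)] gen[OF level_closed(5)] simp del: One_nat_def)
  show "level_rels_right A F q \<subseteq> carrier (tensor_algebra M)"
    unfolding level_rels_right_def Let_def
    by (auto intro!: T.minus_closed T.m_closed intro: gen[OF level_closed(1)] gen[OF level_closed(1)[OF level_closed(2)]]
        gen[OF level_closed(4)] gen[OF level_closed(5)] simp del: One_nat_def)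
qed

end

text \<open>The target side: the quotient \<open>R\<close> with the relations of differential
  operators, computed through the images \<open>gen u\<close> of the generators.\<close>

locale right_level_alg = filtered_alg A F q
  for A :: "('k::comm_ring_1, 'v) module" and F :: "nat \<Rightarrow> 'v set" and q
begin

definition R where "R = ring_pres (tensor_algebra M) (level_rels A F q \<union> level_rels_right A F q)"

definition proj where
  "proj \<xi> = ring_pres_class (tensor_algebra M) (level_rels A F q \<union> level_rels_right A F q) (tensor_class M \<xi>)"

definition gen where "gen u = proj (free_letter u)"

lemma rels: "level_rels A F q \<union> level_rels_right A F q \<subseteq> carrier (tensor_algebra M)"
  using level_rels_carrier by blast

lemma ring_R: "ring R"
  unfolding R_def by (rule ring_ring_pres[OF M.ring_tensor_algebra rels])

sublocale R: ring R
  by (rule ring_R)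

lemma class_hom: "ring_pres_class (tensor_algebra M) (level_rels A F q \<union> level_rels_right A F q)
    \<in> Ring.ring_hom (tensor_algebra M) R"
  unfolding R_def by (rule ring_pres_class_hom[OF M.ring_tensor_algebra rels])

lemma proj_hom: "proj \<in> Ring.ring_hom (free_algebra (F (2 * q - 1))) R"
  using ring_hom_trans[OF M.tensor_class_hom class_hom]
  by (simp add: proj_def[abs_def] comp_def)

lemma proj_linearity: "\<xi> \<in> linearity_rels M \<Longrightarrow> proj \<xi> = \<zero>\<^bsub>R\<^esub>"
  unfolding proj_def using M.tensor_class_zero
    ring_hom_zero[OF class_hom M.ring_tensor_algebra ring_R] by simp

lemma gen_closed: "u \<in> F (2 * q - 1) \<Longrightarrow> gen u \<in> carrier R"
  unfolding gen_def by (rule ring_hom_closed[OF proj_hom]) (rule free_alg_closed)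

lemma gen_add: "u \<in> F (2 * q - 1) \<Longrightarrow> v \<in> F (2 * q - 1) \<Longrightarrow> gen (u \<oplus>\<^bsub>A\<^esub> v) = gen u \<oplus>\<^bsub>R\<^esub> gen v"
proof -
  assume u: "u \<in> F (2 * q - 1)" and v: "v \<in> F (2 * q - 1)"
  let ?\<xi> = "free_letter (u \<oplus>\<^bsub>A\<^esub> v) - free_letter u - free_letter v :: ('v, 'k) free_alg"
  have \<xi>: "?\<xi> \<in> linearity_rels M" unfolding linearity_rels_def using u v by auto
  have mem: "?\<xi> \<in> carrier (free_algebra (F (2 * q - 1)))"
    using M.linearity_rels_carrier \<xi> by auto
  have l: "free_letter u \<in> carrier (free_algebra (F (2 * q - 1)) :: ('v, 'k) free_alg ring)"
    if "u \<in> F (2 * q - 1)" for u using that by (rule free_alg_closed)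
  have "gen (u \<oplus>\<^bsub>A\<^esub> v) = proj (?\<xi> + (free_letter u + free_letter v))"
    by (simp add: gen_def)
  also have "\<dots> = proj ?\<xi> \<oplus>\<^bsub>R\<^esub> (gen u \<oplus>\<^bsub>R\<^esub> gen v)"
    using ring_hom_add[OF proj_hom mem free_alg_closed(4)[OF l[OF u] l[OF v]]]
      ring_hom_add[OF proj_hom l[OF u] l[OF v]] by (simp add: gen_def)
  finally show ?thesis
    using gen_closed[OF u] gen_closed[OF v] by (simp add: proj_linearity[OF \<xi>])
qed

lemma gen_minus:
  assumes "u \<in> F (2 * q - 1)" "v \<in> F (2 * q - 1)" "u \<ominus>\<^bsub>A\<^esub> v \<in> F (2 * q - 1)"
  shows "gen (u \<ominus>\<^bsub>A\<^esub> v) = gen u \<ominus>\<^bsub>R\<^esub> gen v"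
proof -
  note c = gen_closed[OF assms(1)] gen_closed[OF assms(2)] gen_closed[OF assms(3)]
  have "(u \<ominus>\<^bsub>A\<^esub> v) \<oplus>\<^bsub>A\<^esub> v = u"
    using F_carrier assms(1,2) by (simp add: a_minus_def A.a_assoc A.l_neg)
  then have "gen u = gen (u \<ominus>\<^bsub>A\<^esub> v) \<oplus>\<^bsub>R\<^esub> gen v"
    using gen_add[OF assms(3,2)] by simp
  then show ?thesis using c by (simp add: a_minus_def R.a_assoc R.r_neg)
qed

lemma rel_zero:
  "z \<in> level_rels A F q \<union> level_rels_right A F q \<Longrightarrow>
    ring_pres_class (tensor_algebra M) (level_rels A F q \<union> level_rels_right A F q) z = \<zero>\<^bsub>R\<^esub>"
  unfolding R_def by (rule ring_pres_class_zero[OF M.ring_tensor_algebra rels])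

lemma gen_scalar: "proj (free_scalar c) = gen (c \<odot>\<^bsub>A\<^esub> \<one>\<^bsub>A\<^esub>)"
proof -
  let ?z = "tensor_scalar M c \<ominus>\<^bsub>tensor_algebra M\<^esub> tensor_gen M (c \<odot>\<^bsub>A\<^esub> \<one>\<^bsub>A\<^esub>)"
  have u: "c \<odot>\<^bsub>A\<^esub> \<one>\<^bsub>A\<^esub> \<in> F (2 * q - 1)" by (rule F_smult[OF F_one])
  then have c: "tensor_scalar M c \<in> carrier (tensor_algebra M)" "tensor_gen M (c \<odot>\<^bsub>A\<^esub> \<one>\<^bsub>A\<^esub>) \<in> carrier (tensor_algebra M)"
    using M.tensor_closed by auto
  have "?z \<in> level_rels A F q" unfolding level_rels_def Let_def by blast
  then have "proj (free_scalar c) \<ominus>\<^bsub>R\<^esub> gen (c \<odot>\<^bsub>A\<^esub> \<one>\<^bsub>A\<^esub>) = \<zero>\<^bsub>R\<^esub>"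
    using rel_zero[of ?z] ring_hom_a_minus[OF M.ring_tensor_algebra ring_R class_hom c]
    by (simp add: proj_def gen_def tensor_scalar_def tensor_gen_def)
  moreover have "proj (free_scalar c) \<in> carrier R"
    by (rule ring_hom_closed[OF proj_hom]) (rule free_alg_closed)
  ultimately show ?thesis using gen_closed[OF u] by simp
qed

lemma proj_gens:
  assumes "u \<in> F (2 * q - 1)" "v \<in> F (2 * q - 1)" "w \<in> F (2 * q - 1)"
  shows "ring_pres_class (tensor_algebra M) (level_rels A F q \<union> level_rels_right A F q)
      (tensor_gen M u \<otimes>\<^bsub>tensor_algebra M\<^esub> tensor_gen M v) = gen u \<otimes>\<^bsub>R\<^esub> gen v"
    and "ring_pres_class (tensor_algebra M) (level_rels A F q \<union> level_rels_right A F q) (tensor_gen M w) = gen w"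
  using assms ring_hom_mult[OF class_hom] M.tensor_closed(1)
  by (simp_all add: gen_def proj_def tensor_gen_def)

lemma gen_commutator:
  assumes "u \<in> F q" "v \<in> F q"
  shows "gen u \<otimes>\<^bsub>R\<^esub> gen v \<ominus>\<^bsub>R\<^esub> gen v \<otimes>\<^bsub>R\<^esub> gen u = gen (u \<otimes>\<^bsub>A\<^esub> v \<ominus>\<^bsub>A\<^esub> v \<otimes>\<^bsub>A\<^esub> u)"
proof -
  interpret T: ring "tensor_algebra M" by (rule M.ring_tensor_algebra)
  note uv = level_closed(1)[OF assms(1)] level_closed(1)[OF assms(2)] level_closed(3)[OF assms]
  let ?g = "tensor_gen M" and ?w = "u \<otimes>\<^bsub>A\<^esub> v \<ominus>\<^bsub>A\<^esub> v \<otimes>\<^bsub>A\<^esub> u"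
  have c: "?g u \<in> carrier (tensor_algebra M)" "?g v \<in> carrier (tensor_algebra M)" "?g ?w \<in> carrier (tensor_algebra M)"
    using uv M.tensor_closed(1) by auto
  let ?z = "?g u \<otimes>\<^bsub>tensor_algebra M\<^esub> ?g v \<ominus>\<^bsub>tensor_algebra M\<^esub> ?g v \<otimes>\<^bsub>tensor_algebra M\<^esub> ?g u \<ominus>\<^bsub>tensor_algebra M\<^esub> ?g ?w"
  have "?z \<in> level_rels A F q" unfolding level_rels_def Let_def using assms by blast
  then have "(gen u \<otimes>\<^bsub>R\<^esub> gen v \<ominus>\<^bsub>R\<^esub> gen v \<otimes>\<^bsub>R\<^esub> gen u) \<ominus>\<^bsub>R\<^esub> gen ?w = \<zero>\<^bsub>R\<^esub>"
    using rel_zero[of ?z] c uv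
    by (simp add: ring_hom_a_minus[OF M.ring_tensor_algebra ring_R class_hom] proj_gens)
  then show ?thesis using gen_closed uv by simp
qed

lemma gen_right:
  assumes "u \<in> F q" "v \<in> F (q - 1)"
  shows "gen u \<otimes>\<^bsub>R\<^esub> gen v = gen (u \<otimes>\<^bsub>A\<^esub> v)"
proof -
  interpret T: ring "tensor_algebra M" by (rule M.ring_tensor_algebra)
  note uv = level_closed(1)[OF assms(1)] level_closed(1)[OF level_closed(2)[OF assms(2)]] level_closed(4)[OF assms]
  let ?g = "tensor_gen M" and ?w = "u \<otimes>\<^bsub>A\<^esub> v"
  have c: "?g u \<in> carrier (tensor_algebra M)" "?g v \<in> carrier (tensor_algebra M)" "?g ?w \<in> carrier (tensor_algebra M)"
    using uv M.tensor_closed(1) by auto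
  let ?z = "?g u \<otimes>\<^bsub>tensor_algebra M\<^esub> ?g v \<ominus>\<^bsub>tensor_algebra M\<^esub> ?g ?w"
  have "?z \<in> level_rels_right A F q" unfolding level_rels_right_def Let_def using assms by blast
  then have "gen u \<otimes>\<^bsub>R\<^esub> gen v \<ominus>\<^bsub>R\<^esub> gen ?w = \<zero>\<^bsub>R\<^esub>"
    using rel_zero[of ?z] c uv
    by (simp add: ring_hom_a_minus[OF M.ring_tensor_algebra ring_R class_hom] proj_gens)
  then show ?thesis using gen_closed uv by simp
qed

text \<open>The left relations follow from the right ones and the commutator relations.\<close>

lemma gen_left:
  assumes "u \<in> F q" "v \<in> F (q - 1)"
  shows "gen v \<otimes>\<^bsub>R\<^esub> gen u = gen (v \<otimes>\<^bsub>A\<^esub> u)"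
proof -
  note v = level_closed(2)[OF assms(2)]
  note c = gen_closed[OF level_closed(1)[OF assms(1)]] gen_closed[OF level_closed(1)[OF v]]
    gen_closed[OF level_closed(4)[OF assms]] gen_closed[OF level_closed(5)[OF assms]]
  have "gen u \<otimes>\<^bsub>R\<^esub> gen v \<ominus>\<^bsub>R\<^esub> gen v \<otimes>\<^bsub>R\<^esub> gen u = gen (u \<otimes>\<^bsub>A\<^esub> v) \<ominus>\<^bsub>R\<^esub> gen (v \<otimes>\<^bsub>A\<^esub> u)"
    unfolding gen_commutator[OF assms(1) v]
    by (rule gen_minus) (use level_closed assms v in auto)
  then have "gen (u \<otimes>\<^bsub>A\<^esub> v) \<ominus>\<^bsub>R\<^esub> gen v \<otimes>\<^bsub>R\<^esub> gen u = gen (u \<otimes>\<^bsub>A\<^esub> v) \<ominus>\<^bsub>R\<^esub> gen (v \<otimes>\<^bsub>A\<^esub> u)"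
    unfolding gen_right[OF assms] .
  \<comment> \<open>Subtracting both sides from \<open>gen (u v)\<close> isolates the reversed
    product.\<close>
  moreover have "x \<ominus>\<^bsub>R\<^esub> (x \<ominus>\<^bsub>R\<^esub> y) = y" if "x \<in> carrier R" "y \<in> carrier R" for x y
    using that by (simp add: a_minus_def R.minus_add R.r_neg2)
  ultimately show ?thesis using c by (metis R.m_closed)
qed

end

section \<open>Functoriality of the level m algebras\<close>

definition map_letters :: "('v \<Rightarrow> 'w) \<Rightarrow> ('v, 'k::comm_ring_1) free_alg \<Rightarrow> ('w, 'k) free_alg" where
  "map_letters \<phi> = free_eval free_scalar (\<lambda>v. free_letter (\<phi> v))"

interpretation map_letters: free_evaluation free_scalar "\<lambda>v. free_letter (\<phi> v)"
  rewrites "free_eval free_scalar (\<lambda>v. free_letter (\<phi> v)) = map_letters \<phi>" for \<phi> :: "'v \<Rightarrow> 'w"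
  by unfold_locales (simp_all add: free_scalar_hom(1,2,3) map_letters_def, rule free_scalar_hom(4))

lemma map_letters_closed:
  assumes "\<And>v. v \<in> V \<Longrightarrow> \<phi> v \<in> W" "\<xi> \<in> carrier (free_algebra V)"
  shows "map_letters \<phi> \<xi> \<in> carrier (free_algebra W)"
proof -
  have list: "prod_list (map (\<lambda>v. free_letter (\<phi> v)) vs) \<in> carrier (free_algebra W)" if "set vs \<subseteq> V" for vs
    using that by (induction vs) (auto intro!: free_alg_closed assms(1))
  have sum: "sum f A \<in> carrier (free_algebra W)" if "\<And>w. w \<in> A \<Longrightarrow> f w \<in> carrier (free_algebra W)"
    for f :: "'a word_monoid \<Rightarrow> ('b, 'c) free_alg" and A
    using that by (induction A rule: infinite_finite_induct) (auto intro: free_alg_closed)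
  show ?thesis
    unfolding map_letters_def free_eval_def
  proof (rule sum)
    fix w assume "w \<in> Poly_Mapping.keys \<xi>"
    then have "set (letters w) \<subseteq> V" using assms(2) by (simp add: mem_free_algebra)
    then show "free_scalar (Poly_Mapping.lookup \<xi> w) * prod_list (map (\<lambda>v. free_letter (\<phi> v)) (letters w))
        \<in> carrier (free_algebra W)"
      by (intro free_alg_closed(5) free_alg_closed(7) list)
  qed
qed

text \<open>A filtered morphism induces a map from the quotient by left relations to the one by
  right relations; \<open>gen_left\<close> is where the conventions meet. The image is given for
  every free algebra element, not only for generators, since a section must be presented over an
  open set by a single such element.\<close>

lemma level_hom:
  fixes A :: "('k::comm_ring_1, 'v) module" and B :: "('k, 'w) module"
  assumes "filtered_alg A F q" and "filtered_alg B G q"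
    and \<phi>: "\<And>n u. u \<in> F n \<Longrightarrow> \<phi> u \<in> G n"
    and \<phi>_add: "\<And>n u v. u \<in> F n \<Longrightarrow> v \<in> F n \<Longrightarrow> \<phi> (u \<oplus>\<^bsub>A\<^esub> v) = \<phi> u \<oplus>\<^bsub>B\<^esub> \<phi> v"
    and \<phi>_smult: "\<And>n u c. u \<in> F n \<Longrightarrow> \<phi> (c \<odot>\<^bsub>A\<^esub> u) = c \<odot>\<^bsub>B\<^esub> \<phi> u"
    and \<phi>_one: "\<phi> \<one>\<^bsub>A\<^esub> = \<one>\<^bsub>B\<^esub>"
    and \<phi>_mult: "\<And>n m u v. u \<in> F n \<Longrightarrow> v \<in> F m \<Longrightarrow> \<phi> (u \<otimes>\<^bsub>A\<^esub> v) = \<phi> u \<otimes>\<^bsub>B\<^esub> \<phi> v"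
    and \<phi>_minus: "\<And>n m u v. u \<in> F n \<Longrightarrow> v \<in> F m \<Longrightarrow> \<phi> (u \<ominus>\<^bsub>A\<^esub> v) = \<phi> u \<ominus>\<^bsub>B\<^esub> \<phi> v"
  shows "\<exists>r. r \<in> Ring.ring_hom
        (ring_pres (tensor_algebra (level_module A F q)) (level_rels A F q \<union> level_rels_left A F q))
        (ring_pres (tensor_algebra (level_module B G q)) (level_rels B G q \<union> level_rels_right B G q)) \<and>
    (\<forall>\<xi> \<in> carrier (free_algebra (F (2 * q - 1))).
      r (ring_pres_class (tensor_algebra (level_module A F q)) (level_rels A F q \<union> level_rels_left A F q)
          (tensor_class (level_module A F q) \<xi>)) =
      ring_pres_class (tensor_algebra (level_module B G q)) (level_rels B G q \<union> level_rels_right B G q)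
          (tensor_class (level_module B G q) (map_letters \<phi> \<xi>)))"
proof -
  interpret A: filtered_alg A F q by fact
  interpret B: filtered_alg B G q by fact
  interpret B: right_level_alg B G q ..
  let ?V = "F (2 * q - 1)"
  have closed: "map_letters \<phi> \<xi> \<in> carrier (free_algebra (G (2 * q - 1)))"
    if "\<xi> \<in> carrier (free_algebra ?V)" for \<xi> :: "('v, 'k) free_alg"
    by (rule map_letters_closed[OF \<phi> that])
  let ?h = "\<lambda>\<xi>. B.proj (map_letters \<phi> \<xi>)"
  have hom: "?h \<in> Ring.ring_hom (free_algebra ?V) B.R"
    by (rule ring_hom_memI)
      (use ring_hom_closed[OF B.proj_hom closed] ring_hom_mult[OF B.proj_hom closed closed]
        ring_hom_add[OF B.proj_hom closed closed] ring_hom_one[OF B.proj_hom] in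
        \<open>simp_all add: map_letters.free_eval_add map_letters.free_eval_mult map_letters.free_eval_one\<close>)
  have "?h \<xi> = \<zero>\<^bsub>B.R\<^esub>" if "\<xi> \<in> linearity_rels A.M" for \<xi>
  proof (rule B.proj_linearity)
    from that consider (add) v w where "v \<in> ?V" "w \<in> ?V"
        "\<xi> = free_letter (v \<oplus>\<^bsub>A\<^esub> w) - free_letter v - free_letter w"
      | (smult) c v where "v \<in> ?V" "\<xi> = free_letter (c \<odot>\<^bsub>A\<^esub> v) - free_scalar c * free_letter v"
      unfolding linearity_rels_def by auto
    then show "map_letters \<phi> \<xi> \<in> linearity_rels B.M"
    proof cases
      case add
      then have "map_letters \<phi> \<xi> = free_letter (\<phi> v \<oplus>\<^bsub>B\<^esub> \<phi> w) - free_letter (\<phi> v) - free_letter (\<phi> w)"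
        by (simp add: map_letters.free_eval_diff map_letters.free_eval_letter \<phi>_add)
      then show ?thesis unfolding linearity_rels_def using \<phi>[OF add(1)] \<phi>[OF add(2)] by auto
    next
      case smult
      then have "map_letters \<phi> \<xi> = free_letter (c \<odot>\<^bsub>B\<^esub> \<phi> v) - free_scalar c * free_letter (\<phi> v)"
        by (simp add: map_letters.free_eval_diff map_letters.free_eval_letter map_letters.free_eval_mult
            map_letters.free_eval_scalar \<phi>_smult)
      then show ?thesis unfolding linearity_rels_def using \<phi>[OF smult(1)] by auto
    qed
  qed
  then obtain h where h: "h \<in> Ring.ring_hom (tensor_algebra A.M) B.R"
    and h_class: "\<And>\<xi>. \<xi> \<in> carrier (free_algebra ?V) \<Longrightarrow> h (tensor_class A.M \<xi>) = ?h \<xi>"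
    using A.M.tensor_algebra_lift[OF B.ring_R, of ?h] hom by auto
  have h_gen: "h (tensor_gen A.M u) = B.gen (\<phi> u)" if "u \<in> ?V" for u
    using h_class[OF free_alg_closed(6)[OF that]]
    by (simp add: tensor_gen_def B.gen_def map_letters.free_eval_letter)
  have h_scalar: "h (tensor_scalar A.M c) = B.gen (c \<odot>\<^bsub>B\<^esub> \<one>\<^bsub>B\<^esub>)" for c
    using h_class[OF free_alg_closed(7)] by (simp add: tensor_scalar_def B.gen_scalar map_letters.free_eval_scalar)
  have gen_closed: "tensor_gen A.M u \<in> carrier (tensor_algebra A.M)" if "u \<in> ?V" for u
    using A.M.tensor_closed(1)[of u] that by simp
  interpret T: ring "tensor_algebra A.M" by (rule A.M.ring_tensor_algebra)
  note h_simps = ring_hom_a_minus[OF A.M.ring_tensor_algebra B.ring_R h] ring_hom_mult[OF h] h_gen h_scalar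
    gen_closed A.M.tensor_closed(2)
  have "h z = \<zero>\<^bsub>B.R\<^esub>" if "z \<in> level_rels A F q \<union> level_rels_left A F q" for z
  proof -
    from that consider (scalar) c where "z = tensor_scalar A.M c \<ominus>\<^bsub>tensor_algebra A.M\<^esub> tensor_gen A.M (c \<odot>\<^bsub>A\<^esub> \<one>\<^bsub>A\<^esub>)"
      | (comm) x y where "x \<in> F q" "y \<in> F q"
        "z = tensor_gen A.M x \<otimes>\<^bsub>tensor_algebra A.M\<^esub> tensor_gen A.M y \<ominus>\<^bsub>tensor_algebra A.M\<^esub>
          tensor_gen A.M y \<otimes>\<^bsub>tensor_algebra A.M\<^esub> tensor_gen A.M x \<ominus>\<^bsub>tensor_algebra A.M\<^esub>
          tensor_gen A.M (x \<otimes>\<^bsub>A\<^esub> y \<ominus>\<^bsub>A\<^esub> y \<otimes>\<^bsub>A\<^esub> x)"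
      | (left) x y where "x \<in> F q" "y \<in> F (q - 1)"
        "z = tensor_gen A.M y \<otimes>\<^bsub>tensor_algebra A.M\<^esub> tensor_gen A.M x \<ominus>\<^bsub>tensor_algebra A.M\<^esub>
          tensor_gen A.M (y \<otimes>\<^bsub>A\<^esub> x)"
      unfolding level_rels_def level_rels_left_def Let_def by blast
    then show ?thesis
    proof cases
      case scalar
      have u: "c \<odot>\<^bsub>A\<^esub> \<one>\<^bsub>A\<^esub> \<in> ?V" by (rule A.F_smult[OF A.F_one])
      have "\<phi> (c \<odot>\<^bsub>A\<^esub> \<one>\<^bsub>A\<^esub>) = c \<odot>\<^bsub>B\<^esub> \<one>\<^bsub>B\<^esub>" using \<phi>_smult[OF A.F_one] \<phi>_one by simp
      moreover have "B.gen (c \<odot>\<^bsub>B\<^esub> \<one>\<^bsub>B\<^esub>) \<in> carrier B.R"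
        by (rule B.gen_closed[OF B.F_smult[OF B.F_one]])
      ultimately show ?thesis
        unfolding scalar using u by (simp add: h_simps)
    next
      case comm
      note u = A.level_closed(1)[OF comm(1)] A.level_closed(1)[OF comm(2)] A.level_closed(3)[OF comm(1,2)]
      have "\<phi> (x \<otimes>\<^bsub>A\<^esub> y \<ominus>\<^bsub>A\<^esub> y \<otimes>\<^bsub>A\<^esub> x) = \<phi> x \<otimes>\<^bsub>B\<^esub> \<phi> y \<ominus>\<^bsub>B\<^esub> \<phi> y \<otimes>\<^bsub>B\<^esub> \<phi> x"
        using \<phi>_minus[OF A.F_mult[OF comm(1,2)] A.F_mult[OF comm(2,1)]] \<phi>_mult comm(1,2) by metis
      moreover have "B.gen (\<phi> x \<otimes>\<^bsub>B\<^esub> \<phi> y \<ominus>\<^bsub>B\<^esub> \<phi> y \<otimes>\<^bsub>B\<^esub> \<phi> x) \<in> carrier B.R"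
        by (rule B.gen_closed[OF B.level_closed(3)[OF \<phi>[OF comm(1)] \<phi>[OF comm(2)]]])
      ultimately show ?thesis
        unfolding comm(3) using u B.gen_commutator[OF \<phi>[OF comm(1)] \<phi>[OF comm(2)]]
        by (simp add: h_simps)
    next
      case left
      note y = A.level_closed(2)[OF left(2)]
      note u = A.level_closed(1)[OF left(1)] A.level_closed(1)[OF y] A.level_closed(5)[OF left(1,2)]
      have "B.gen (\<phi> y \<otimes>\<^bsub>B\<^esub> \<phi> x) \<in> carrier B.R"
        by (rule B.gen_closed[OF B.level_closed(5)[OF \<phi>[OF left(1)] \<phi>[OF left(2)]]])
      then show ?thesis
        unfolding left(3) using u B.gen_left[OF \<phi>[OF left(1)] \<phi>[OF left(2)]] \<phi>_mult[OF left(2,1)]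
        by (simp add: h_simps)
    qed
  qed
  moreover have "level_rels A F q \<union> level_rels_left A F q \<subseteq> carrier (tensor_algebra A.M)"
    using A.level_rels_carrier by blast
  ultimately obtain r where r: "r \<in> Ring.ring_hom (ring_pres (tensor_algebra A.M) (level_rels A F q \<union> level_rels_left A F q)) B.R"
    and r_class: "\<And>y. y \<in> carrier (tensor_algebra A.M) \<Longrightarrow>
      r (ring_pres_class (tensor_algebra A.M) (level_rels A F q \<union> level_rels_left A F q) y) = h y"
    using ring_pres_lift[OF A.M.ring_tensor_algebra _ B.ring_R h] by metis
  show ?thesis
  proof (intro exI[of _ r] conjI ballI)
    show "r \<in> Ring.ring_hom (ring_pres (tensor_algebra A.M) (level_rels A F q \<union> level_rels_left A F q))
      (ring_pres (tensor_algebra B.M) (level_rels B G q \<union> level_rels_right B G q))"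
      using r unfolding B.R_def .
    show "r (ring_pres_class (tensor_algebra A.M) (level_rels A F q \<union> level_rels_left A F q) (tensor_class A.M \<xi>)) =
        ring_pres_class (tensor_algebra B.M) (level_rels B G q \<union> level_rels_right B G q) (tensor_class B.M (map_letters \<phi> \<xi>))"
      if "\<xi> \<in> carrier (free_algebra ?V)" for \<xi>
    proof -
      have "tensor_class A.M \<xi> \<in> carrier (tensor_algebra A.M)"
        using that A.M.carrier_tensor_algebra by auto
      then show ?thesis
        using r_class h_class[OF that] by (simp add: B.proj_def)
    qed
  qed
qed

section \<open>Stalks\<close>

text \<open>A prime contains all products of elements of \<open>I\<close> and \<open>J\<close>
  exactly if it contains \<open>I\<close> or \<open>J\<close>.\<close>

lemma zariski_open_Int:
  assumes "zariski_open U" "zariski_open V"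
  shows "zariski_open (U \<inter> V)"
  unfolding zariski_open_def
proof (intro conjI ballI)
  show "U \<inter> V \<subseteq> proj_line" using assms unfolding zariski_open_def by blast
  fix \<tau> :: "'a fun_field" assume \<tau>: "\<tau> \<in> coords"
  obtain I where I: "{P \<in> prime_spec. local_ring \<tau> P \<in> U} = {P \<in> prime_spec. \<not> I \<subseteq> P}"
    using assms(1) \<tau> unfolding zariski_open_def by blast
  obtain J where J: "{P \<in> prime_spec. local_ring \<tau> P \<in> V} = {P \<in> prime_spec. \<not> J \<subseteq> P}"
    using assms(2) \<tau> unfolding zariski_open_def by blast
  \<comment> \<open>Open sets are described by arbitrary sets \<open>I\<close>, so the products are
    not completed to an ideal.\<close>
  let ?IJ = "{a * b | a b. a \<in> I \<and> b \<in> J}"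
  have product: "?IJ \<subseteq> P \<longleftrightarrow> I \<subseteq> P \<or> J \<subseteq> P" if "P \<in> prime_spec" for P
  proof -
    interpret chart_point \<tau> P by (rule chart_point.intro[OF \<tau> that])
    have "a * b \<in> P" if "a \<in> P \<or> b \<in> P" for a b
      using that P.I_l_closed[of b a] P.I_r_closed[of a b] by auto
    moreover have "\<exists>a\<in>I. \<exists>b\<in>J. a * b \<notin> P" if "\<not> I \<subseteq> P" "\<not> J \<subseteq> P"
      using that notin_prime(3) by blast
    ultimately show ?thesis by blast
  qed
  have "local_ring \<tau> P \<in> U \<inter> V \<longleftrightarrow> \<not> ?IJ \<subseteq> P" if "P \<in> prime_spec" for P
    unfolding product[OF that] using eqset_imp_iff[OF I, of P] eqset_imp_iff[OF J, of P] that by simp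
  then show "\<exists>I. {P \<in> prime_spec. local_ring \<tau> P \<in> U \<inter> V} = {P \<in> prime_spec. \<not> I \<subseteq> P}"
    by (intro exI[of _ ?IJ] Collect_cong conj_cong refl)
qed

lemma zariski_open_proj_line: "zariski_open (proj_line :: 'p::prime_card point set)"
  unfolding zariski_open_def
proof (intro conjI ballI)
  fix \<tau> :: "'p fun_field" assume \<tau>: "\<tau> \<in> coords"
  \<comment> \<open>The whole polynomial ring, lying in no prime, serves as
    \<open>I\<close>.\<close>
  have "\<not> UNIV \<subseteq> P" if "P \<in> prime_spec" for P :: "'p mod_ring poly set"
    using chart_point.notin_prime(2)[OF chart_point.intro[OF \<tau> that]] by blast
  moreover have "local_ring \<tau> P \<in> proj_line" if "P \<in> prime_spec" for P
    using that \<tau> unfolding proj_line_def chart_def by blast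
  ultimately have "{P \<in> prime_spec. local_ring \<tau> P \<in> proj_line} = {P \<in> prime_spec. \<not> UNIV \<subseteq> P}" by blast
  then show "\<exists>I. {P \<in> prime_spec. local_ring \<tau> P \<in> proj_line} = {P \<in> prime_spec. \<not> I \<subseteq> P}" by blast
qed simp

lemma stalk_le_common:
  assumes "D \<in> stalk_le x m" "D' \<in> stalk_le x n"
  obtains U where "zariski_open U" "x \<in> U" "D \<in> diffops_le U m" "D' \<in> diffops_le U n"
proof -
  from assms obtain U V where "zariski_open U" "x \<in> U" "D \<in> diffops_le U m"
    "zariski_open V" "x \<in> V" "D' \<in> diffops_le V n"
    unfolding stalk_le_def by blast
  then show ?thesis
    using that[of "U \<inter> V"] zariski_open_Int diffops_le_restrict[of "U \<inter> V"] by blast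
qed

lemma stalk_leI: "zariski_open U \<Longrightarrow> x \<in> U \<Longrightarrow> D \<in> diffops_le U n \<Longrightarrow> D \<in> stalk_le x n"
  unfolding stalk_le_def by blast

lemma stalk_le_proj_line: "x \<in> proj_line \<Longrightarrow> D \<in> diffops_le proj_line n \<Longrightarrow> D \<in> stalk_le x n"
  by (rule stalk_leI[OF zariski_open_proj_line])

lemma stalk_le_mono: "n \<le> m \<Longrightarrow> D \<in> stalk_le x n \<Longrightarrow> D \<in> stalk_le x m"
  unfolding stalk_le_def using diffops_le_mono by blast

lemma stalk_le_closed:
  assumes D: "D \<in> stalk_le x m" and D': "D' \<in> stalk_le x n"
  shows "(\<lambda>f. - D f) \<in> stalk_le x m" "(\<lambda>f. const c * D f) \<in> stalk_le x m"
    "D \<circ> D' \<in> stalk_le x (m + n)" "(\<lambda>f. D f + D' f) \<in> stalk_le x (max m n)"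
    "(\<lambda>f. D (D' f) - D' (D f)) \<in> stalk_le x (m + n - 1)" "k_linear D"
proof -
  obtain U where U: "zariski_open U" "x \<in> U" and m: "D \<in> diffops_le U m" and n: "D' \<in> diffops_le U n"
    using stalk_le_common[OF assms] .
  show "(\<lambda>f. - D f) \<in> stalk_le x m" by (rule stalk_leI[OF U diffops_le_uminus[OF m]])
  show "(\<lambda>f. const c * D f) \<in> stalk_le x m" by (rule stalk_leI[OF U diffops_le_smult[OF m]])
  show "D \<circ> D' \<in> stalk_le x (m + n)" by (rule stalk_leI[OF U diffops_le_comp[OF m n]])
  show "(\<lambda>f. D f + D' f) \<in> stalk_le x (max m n)"
    by (rule stalk_leI[OF U diffops_le_add[OF diffops_le_mono[OF _ m] diffops_le_mono[OF _ n]]]) auto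
  show "(\<lambda>f. D (D' f) - D' (D f)) \<in> stalk_le x (m + n - 1)"
    by (rule stalk_leI[OF U diffops_le_commutator[OF m n]])
  show "k_linear D" using m order_le_k_linear unfolding diffops_le_def by blast
qed

context
  fixes x :: "'p::prime_card point"
  assumes x: "x \<in> proj_line"
begin

lemma stalk_subalgebra: "operator_subalgebra (\<Union>n. stalk_le x n)"
proof
  fix D D' :: "'p operator"
  assume "D \<in> (\<Union>n. stalk_le x n)"
  then obtain m where m: "D \<in> stalk_le x m" by blast
  show "k_linear D" by (rule stalk_le_closed(6)[OF m m])
  show "(\<lambda>f. - D f) \<in> (\<Union>n. stalk_le x n)" using stalk_le_closed(1)[OF m m] by blast
  assume "D' \<in> (\<Union>n. stalk_le x n)"
  then obtain n where n: "D' \<in> stalk_le x n" by blast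
  show "D \<circ> D' \<in> (\<Union>n. stalk_le x n)" using stalk_le_closed(3)[OF m n] by blast
  show "(\<lambda>f. D f + D' f) \<in> (\<Union>n. stalk_le x n)" using stalk_le_closed(4)[OF m n] by blast
next
  show "id \<in> (\<Union>n. stalk_le x n)" using stalk_le_proj_line[OF x diffops_le_id] by blast
  show "(\<lambda>_. 0) \<in> (\<Union>n. stalk_le x n)" using stalk_le_proj_line[OF x diffops_le_zero] by blast
qed

interpretation S: operator_subalgebra "\<Union>n. stalk_le x n"
  by (rule stalk_subalgebra)

lemma stalk_minus:
  "D \<in> stalk_le x m \<Longrightarrow> D' \<in> stalk_le x n \<Longrightarrow> D \<ominus>\<^bsub>stalk_diffops x\<^esub> D' = (\<lambda>f. D f - D' f)"
  unfolding stalk_diffops_def by (rule S.operator_minus) blast+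

lemma filtered_stalk:
  assumes "0 < q"
  shows "filtered_alg (stalk_diffops x) (stalk_le x) q"
proof (rule filtered_alg.intro)
  show "0 < q" by fact
  show "ring (stalk_diffops x)"
    unfolding stalk_diffops_def by (rule S.ring_operator_algebra)
next
  fix D D' :: "'p operator" and m n c
  assume D: "D \<in> stalk_le x n"
  show "D \<in> carrier (stalk_diffops x)" using D by (auto simp: stalk_diffops_def)
  show "c \<odot>\<^bsub>stalk_diffops x\<^esub> D \<in> stalk_le x n"
    using stalk_le_closed(2)[OF D D] by (simp add: stalk_diffops_def)
  show "n \<le> m \<Longrightarrow> D \<in> stalk_le x m" using D by (rule stalk_le_mono[rotated])
  show "D \<oplus>\<^bsub>stalk_diffops x\<^esub> D' \<in> stalk_le x n" if "D' \<in> stalk_le x n"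
    using stalk_le_closed(4)[OF D that] by (simp add: stalk_diffops_def)
  assume D': "D' \<in> stalk_le x m"
  show "D \<otimes>\<^bsub>stalk_diffops x\<^esub> D' \<in> stalk_le x (n + m)"
    using stalk_le_closed(3)[OF D D'] by (simp add: stalk_diffops_def)
  have "D \<otimes>\<^bsub>stalk_diffops x\<^esub> D' \<ominus>\<^bsub>stalk_diffops x\<^esub> D' \<otimes>\<^bsub>stalk_diffops x\<^esub> D = (\<lambda>f. D (D' f) - D' (D f))"
    using stalk_minus[OF stalk_le_closed(3)[OF D D'] stalk_le_closed(3)[OF D' D]] by (simp add: stalk_diffops_def)
  then show "D \<otimes>\<^bsub>stalk_diffops x\<^esub> D' \<ominus>\<^bsub>stalk_diffops x\<^esub> D' \<otimes>\<^bsub>stalk_diffops x\<^esub> D \<in> stalk_le x (n + m - 1)"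
    using stalk_le_closed(5)[OF D D'] by simp
next
  fix n
  show "\<one>\<^bsub>stalk_diffops x\<^esub> \<in> stalk_le x n"
    using stalk_le_proj_line[OF x diffops_le_mono[OF _ diffops_le_id]] by (simp add: stalk_diffops_def)
qed

end

lemma filtered_dist:
  assumes "0 < q"
  shows "filtered_alg (dist_algebra :: ('p::prime_card mod_ring, dist) module) (dist_order TYPE('p)) q"
proof (rule filtered_alg.intro)
  show "0 < q" by fact
  show "ring (dist_algebra :: ('p mod_ring, dist) module)" by (rule ring_dist_algebra)
  fix u v :: dist and n m and c :: "'p mod_ring"
  show "\<one>\<^bsub>(dist_algebra :: ('p mod_ring, dist) module)\<^esub> \<in> dist_order TYPE('p) n"
    by (simp add: dist_order_one)
  assume u: "u \<in> dist_order TYPE('p) n"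
  show "u \<in> carrier (dist_algebra :: ('p mod_ring, dist) module)"
    using dist_order_facts(1)[OF u u] by simp
  show "c \<odot>\<^bsub>dist_algebra\<^esub> u \<in> dist_order TYPE('p) n"
    using dist_order_submodule(2)[OF u u] by simp
  show "n \<le> m \<Longrightarrow> u \<in> dist_order TYPE('p) m" using u by (rule dist_order_mono[rotated])
  show "u \<oplus>\<^bsub>(dist_algebra :: ('p mod_ring, dist) module)\<^esub> v \<in> dist_order TYPE('p) n" if "v \<in> dist_order TYPE('p) n"
    using dist_order_submodule(1)[OF u that] by simp
  assume v: "v \<in> dist_order TYPE('p) m"
  show "u \<otimes>\<^bsub>(dist_algebra :: ('p mod_ring, dist) module)\<^esub> v \<in> dist_order TYPE('p) (n + m)"
    using dist_order_facts(2)[OF u v] by simp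
  show "u \<otimes>\<^bsub>(dist_algebra :: ('p mod_ring, dist) module)\<^esub> v \<ominus>\<^bsub>(dist_algebra :: ('p mod_ring, dist) module)\<^esub>
      v \<otimes>\<^bsub>(dist_algebra :: ('p mod_ring, dist) module)\<^esub> u \<in> dist_order TYPE('p) (n + m - 1)"
    using dist_order_facts(3)[OF u v] by simp
qed


section \<open>The morphism of level m\<close>

lemma rho_stalk_hom:
  fixes x :: "'p::prime_card point"
  assumes x: "x \<in> proj_line"
  shows "\<exists>r. r \<in> Ring.ring_hom (ulevel_ring m) (dlevel_stalk m x) \<and>
    (\<forall>\<xi> \<in> carrier (free_algebra (dist_order TYPE('p) (2 * CARD('p) ^ m - 1))).
      r (ring_pres_class (tensor_algebra (ulevel_module TYPE('p) m)) (ulevel_rels TYPE('p) m)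
          (tensor_class (ulevel_module TYPE('p) m) \<xi>)) = dlevel_germ m x (map_letters rho \<xi>))"
proof -
  let ?A = "dist_algebra :: ('p mod_ring, dist) module" and ?B = "stalk_diffops x"
  have q: "0 < CARD('p) ^ m" by simp
  have c: "u \<in> carrier (dist_ring CARD('p))" if "u \<in> dist_order TYPE('p) n" for u n
    by (rule dist_order_facts(1)[OF that that])
  have stalk: "(rho u :: 'p operator) \<in> stalk_le x n" if "u \<in> dist_order TYPE('p) n" for u n
    by (rule stalk_le_proj_line[OF x rho_order[OF that]])
  have add: "rho (u \<oplus>\<^bsub>?A\<^esub> v) = rho u \<oplus>\<^bsub>?B\<^esub> rho v"
    if "u \<in> dist_order TYPE('p) n" "v \<in> dist_order TYPE('p) n" for u v n
    using rho_add[OF c[OF that(1)] c[OF that(2)]] by (simp add: stalk_diffops_def)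
  have smult: "rho (k \<odot>\<^bsub>?A\<^esub> u) = k \<odot>\<^bsub>?B\<^esub> rho u" if "u \<in> dist_order TYPE('p) n" for u n and k :: "'p mod_ring"
    using rho_smult[OF c[OF that]] by (simp add: stalk_diffops_def)
  have one: "rho \<one>\<^bsub>?A\<^esub> = \<one>\<^bsub>?B\<^esub>"
    using rho_one[where 'p = 'p] by (simp add: stalk_diffops_def)
  have mult: "rho (u \<otimes>\<^bsub>?A\<^esub> v) = rho u \<otimes>\<^bsub>?B\<^esub> rho v"
    if "u \<in> dist_order TYPE('p) n" "v \<in> dist_order TYPE('p) k" for u v n k
    using rho_mult[OF c[OF that(1)] c[OF that(2)]] by (simp add: stalk_diffops_def)
  have minus: "rho (u \<ominus>\<^bsub>?A\<^esub> v) = rho u \<ominus>\<^bsub>?B\<^esub> rho v"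
    if "u \<in> dist_order TYPE('p) n" "v \<in> dist_order TYPE('p) k" for u v n k
    using rho_minus[OF c[OF that(1)] c[OF that(2)]] stalk_minus[OF x stalk[OF that(1)] stalk[OF that(2)]] by simp
  show ?thesis
    unfolding ulevel_ring_def ulevel_rels_def ulevel_module_def dlevel_stalk_def dlevel_rels_def
      dlevel_module_def dlevel_germ_def
    by (rule level_hom[OF filtered_dist[OF q] filtered_stalk[OF x q] stalk add smult one mult minus])
qed

definition is_rho_level :: "nat \<Rightarrow> ('p::prime_card ulevel \<Rightarrow> 'p point \<Rightarrow> 'p dlevel) \<Rightarrow> bool" where
  "is_rho_level m r \<longleftrightarrow> r \<in> Ring.ring_hom (ulevel_ring m) (dlevel_sections m proj_line) \<and>
     (\<forall>\<mu> \<in> dist_order TYPE('p) (2 * CARD('p) ^ m - 1).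
        r (to_ulevel m \<mu>) = to_dlevel m proj_line (rho \<mu>))"

text \<open>Morphisms chosen independently at the points fit together: at each point the class of
  \<xi> goes to the germ of the same element \<open>map_letters rho\<close> \<xi>. The local
  presentation required of a section therefore holds with the whole line as open set.\<close>

lemma is_rho_level_exists: "\<exists>r :: 'p::prime_card ulevel \<Rightarrow> 'p point \<Rightarrow> 'p dlevel. is_rho_level m r"
proof -
  let ?U = "ulevel_ring m :: 'p ulevel ring" and ?n = "2 * CARD('p) ^ m - 1"
  let ?V = "dist_order TYPE('p) ?n"
  let ?class = "\<lambda>\<xi>. ring_pres_class (tensor_algebra (ulevel_module TYPE('p) m)) (ulevel_rels TYPE('p) m)
          (tensor_class (ulevel_module TYPE('p) m) \<xi>)"
  interpret A: filtered_alg "dist_algebra :: ('p mod_ring, dist) module" "dist_order TYPE('p)" "CARD('p) ^ m"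
    by (rule filtered_dist) simp
  have U: "ulevel_rels TYPE('p) m \<subseteq> carrier (tensor_algebra (ulevel_module TYPE('p) m))"
    unfolding ulevel_rels_def ulevel_module_def using A.level_rels_carrier by blast
  have ringT: "ring (tensor_algebra (ulevel_module TYPE('p) m))"
    unfolding ulevel_module_def by (rule A.M.ring_tensor_algebra)
  have ringU: "ring ?U" unfolding ulevel_ring_def by (rule ring_ring_pres[OF ringT U])
  have carrier_U: "carrier ?U = ?class ` carrier (free_algebra ?V)"
    unfolding ulevel_ring_def carrier_ring_pres[OF ringT U]
    unfolding ulevel_module_def A.M.carrier_tensor_algebra by auto
  let ?P = "\<lambda>x r. r \<in> Ring.ring_hom ?U (dlevel_stalk m x) \<and>
    (\<forall>\<xi> \<in> carrier (free_algebra ?V). r (?class \<xi>) = dlevel_germ m x (map_letters rho \<xi>))"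
  have "\<forall>x \<in> proj_line. \<exists>r. ?P x r"
    by (rule ballI) (rule rho_stalk_hom)
  then obtain r where r0: "\<forall>x \<in> proj_line. ?P x (r x)"
    by (rule bchoice[THEN exE])
  have r: "r x \<in> Ring.ring_hom ?U (dlevel_stalk m x)" if "x \<in> proj_line" for x
    using r0 that by simp
  have r_class: "r x (?class \<xi>) = dlevel_germ m x (map_letters rho \<xi>)"
    if "x \<in> proj_line" "\<xi> \<in> carrier (free_algebra ?V)" for x \<xi>
    using r0 that by simp
  define r' where "r' u = (\<lambda>x \<in> proj_line. r x u)" for u
  have "is_rho_level m r'"
    unfolding is_rho_level_def
  proof (intro conjI ballI)
    show "r' \<in> Ring.ring_hom ?U (dlevel_sections m proj_line)"
    proof (rule ring_hom_memI)
      fix u assume "u \<in> carrier ?U"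
      then obtain \<xi> where \<xi>: "\<xi> \<in> carrier (free_algebra ?V)" "u = ?class \<xi>"
        unfolding carrier_U by blast
      have "map_letters rho \<xi> \<in> carrier (free_algebra (diffops_le (proj_line :: 'p point set) ?n))"
        by (rule map_letters_closed[OF rho_order \<xi>(1)])
      moreover have "\<forall>x \<in> proj_line. r' u x = dlevel_germ m x (map_letters rho \<xi>)"
        using r_class \<xi> by (simp add: r'_def)
      moreover have "r' u \<in> extensional proj_line" by (simp add: r'_def)
      ultimately show "r' u \<in> carrier (dlevel_sections m proj_line)"
        unfolding dlevel_sections_def using zariski_open_proj_line[where 'p = 'p] by auto
    next
      fix u v assume u: "u \<in> carrier ?U" and v: "v \<in> carrier ?U"
      show "r' (u \<otimes>\<^bsub>?U\<^esub> v) = r' u \<otimes>\<^bsub>dlevel_sections m proj_line\<^esub> r' v"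
        by (simp add: r'_def dlevel_sections_def restrict_def fun_eq_iff ring_hom_mult[OF r u v])
      show "r' (u \<oplus>\<^bsub>?U\<^esub> v) = r' u \<oplus>\<^bsub>dlevel_sections m proj_line\<^esub> r' v"
        by (simp add: r'_def dlevel_sections_def restrict_def fun_eq_iff ring_hom_add[OF r u v])
    next
      show "r' \<one>\<^bsub>?U\<^esub> = \<one>\<^bsub>dlevel_sections m proj_line\<^esub>"
        by (simp add: r'_def dlevel_sections_def restrict_def fun_eq_iff ring_hom_one[OF r])
    qed
    fix \<mu> assume "\<mu> \<in> ?V"
    then show "r' (to_ulevel m \<mu>) = to_dlevel m proj_line (rho \<mu>)"
      using r_class[OF _ free_alg_closed(6)]
      by (simp add: r'_def to_ulevel_def to_dlevel_def tensor_gen_def restrict_def fun_eq_iff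
          map_letters.free_eval_letter)
  qed
  then show ?thesis by blast
qed

lemma rho_level_to_ulevel:
  assumes "\<mu> \<in> dist_order TYPE('p) (2 * CARD('p) ^ m - 1)"
  shows "rho_level m (to_ulevel m \<mu> :: 'p::prime_card ulevel) = to_dlevel m proj_line (rho \<mu>)"
proof -
  have "is_rho_level m (rho_level m :: 'p ulevel \<Rightarrow> _)"
    using someI_ex[OF is_rho_level_exists[of m]] unfolding rho_level_def is_rho_level_def .
  with assms show ?thesis unfolding is_rho_level_def by blast
qed

text \<open>The two charts cover the line, so a section is determined by its restrictions to them;
  off the line, extensionality fixes its values.\<close>

lemma dwork_eq:
  fixes D :: "'p::prime_card operator"
  assumes D: "D \<in> diffops_le proj_line (2 * CARD('p) ^ m - 1)"
    and dwork: "\<And>\<tau>. \<tau> \<in> coords \<Longrightarrow> D = dwork_operator \<tau>"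
  shows "dwork m = to_dlevel m proj_line D"
  unfolding dwork_def
proof (rule the_equality)
  have "to_dlevel m proj_line D \<in> carrier (dlevel_sections m proj_line)"
    unfolding dlevel_sections_def to_dlevel_def
    using zariski_open_proj_line[where 'p = 'p] free_alg_closed(6)[OF D] by auto
  moreover have "restrict (to_dlevel m proj_line D) (chart \<tau>) = to_dlevel m (chart \<tau>) (dwork_operator \<tau>)"
    if "\<tau> \<in> coords" for \<tau>
    unfolding dwork[OF that, symmetric] to_dlevel_def
    using chart_subset[OF that] by (intro ext) (auto simp: restrict_def)
  ultimately show "to_dlevel m proj_line D \<in> carrier (dlevel_sections m proj_line) \<and>
      (\<forall>\<tau> \<in> coords. restrict (to_dlevel m proj_line D) (chart \<tau>) = to_dlevel m (chart \<tau>) (dwork_operator \<tau>))"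
    by blast
next
  fix \<sigma> :: "'p point \<Rightarrow> 'p dlevel"
  assume \<sigma>: "\<sigma> \<in> carrier (dlevel_sections m proj_line) \<and>
    (\<forall>\<tau> \<in> coords. restrict \<sigma> (chart \<tau>) = to_dlevel m (chart \<tau>) (dwork_operator \<tau>))"
  show "\<sigma> = to_dlevel m proj_line D"
  proof
    fix x
    show "\<sigma> x = to_dlevel m proj_line D x"
    proof (cases "x \<in> proj_line")
      case True
      then obtain \<tau> where \<tau>: "\<tau> \<in> coords" "x \<in> chart \<tau>" unfolding proj_line_def by blast
      then have "restrict \<sigma> (chart \<tau>) x = to_dlevel m (chart \<tau>) D x" using \<sigma> dwork[OF \<tau>(1)] by simp
      then show ?thesis using True \<tau> by (simp add: to_dlevel_def)
    next
      case False
      then show ?thesis using \<sigma> by (simp add: dlevel_sections_def extensional_def to_dlevel_def)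
    qed
  qed
qed

theorem proposition3p2p1:
  fixes m :: nat
  assumes "CARD('p::prime_card) > 2" and "m > 0"
  shows "rho_level m (Delta_T m :: 'p ulevel) = dwork m"
proof -
  \<comment> \<open>Positivity of \<open>m\<close> gives \<open>p \<le> p^m\<close>, so the order
    \<open>p - 1\<close> of the torus element stays within the generating range of level m.\<close>
  have "CARD('p) ^ 1 \<le> CARD('p) ^ m" using assms by (intro power_increasing) auto
  then have "CARD('p) - 1 \<le> 2 * CARD('p) ^ m - 1" by simp
  then have Delta: "Delta_T_dist TYPE('p) \<in> dist_order TYPE('p) (2 * CARD('p) ^ m - 1)"
    by (rule dist_order_mono[OF _ Delta_T_dist_order])
  have "rho_level m (Delta_T m :: 'p ulevel) = to_dlevel m proj_line (rho (Delta_T_dist TYPE('p)))"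
    unfolding Delta_T_def by (rule rho_level_to_ulevel[OF Delta])
  also have "\<dots> = dwork m"
    by (rule dwork_eq[symmetric, OF rho_order[OF Delta] rho_Delta_T[OF assms(1)]])
  finally show ?thesis .
qed

end
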